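(* Let $(\mathcal Q,d)$ be a Hadamard space, let $\alpha\in(1,2]$, let $Y$ be a $\mathcal Q$-valued random variable with $\mathbf E[d(Y,o)^{\alpha-1}]<\infty$ that is concentrated on a unit-speed geodesic $\gamma$, let $m$ be its $\alpha$-Fréchet mean and $m_n$ the empirical $\alpha$-Fréchet mean of $n$ independent copies $Y_1,\dots,Y_n$ of $Y$. Assume $\sigma_{2\alpha-2}:=\mathbf E[d(Y,m)^{2\alpha-2}]<\infty$. Let $g\colon[0,\infty)\to[0,\infty)$ be lower semi-continuous. (i) Assume there is $\beta>2$ such that $\lim_{t\searrow0}t^{\alpha-\beta}\,\mathbf P(d(Y,m)\le t)=0$. Then $\sigma_{\alpha-2}:=\mathbf E[d(Y,m)^{\alpha-2}]<\infty$ and $$\liminf_{n\to\infty}\mathbf E\big[g\big(\sqrt n\,d(m,m_n)\big)\big]\ge\mathbf E[g(|Z|)],$$ where $Z\sim\mathcal N\big(0,(\alpha-1)^{-2}\sigma_{\alpha-2}^{-2}\sigma_{2\alpha-2}\big)$. (ii) Assume there are $\beta\in(\alpha,2)$ and $b\in(0,\infty)$ such that $$\frac{\mathbf P\big(0\le\gamma^{-1}(Y)-\gamma^{-1}(m)\le t\big)}{b\,t^{\beta-\alpha}}\xrightarrow{t\searrow0}1\quad\text{and}\quad\frac{\mathbf P\big(0\ge\gamma^{-1}(Y)-\gamma^{-1}(m)\ge-t\big)}{b\,t^{\beta-\alpha}}\xrightarrow{t\searrow0}1.$$ Then $$\liminf_{n\to\infty}\mathbf E\Big[g\Big(n^{\frac1{2(\beta-1)}}\,d(m,m_n)\Big)\Big]\ge\mathbf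 E\Big[g\Big(C_{\alpha,\beta,b}\,|W|^{\frac1{\beta-1}}\Big)\Big],$$ where $W\sim\mathcal N(0,\sigma_{2\alpha-2})$ and $C_{\alpha,\beta,b}\in(0,\infty)$ is a constant depending only on $\alpha,\beta,b$.
   Context: A Hadamard space is a nonempty complete metric space $(\mathcal Q,d)$ such that for all $y_0,y_1\in\mathcal Q$ there is $p\in\mathcal Q$ with $\frac12 d(y_0,q)^2+\frac12 d(y_1,q)^2-\frac14 d(y_0,y_1)^2\ge d(q,p)^2$ for all $q\in\mathcal Q$; it carries its Borel $\sigma$-algebra. A unit-speed geodesic is a map $\gamma\colon I\to\mathcal Q$ on a convex set $I\subset\mathbb R$ with $d(\gamma(s),\gamma(t))=|s-t|$ for all $s,t\in I$; $Y$ concentrated on $\gamma$ means $\mathbf P(Y\in\gamma(I))=1$. (The $\alpha$-Fréchet mean $m$ then also lies on the geodesic.) The $\alpha$-Fréchet mean is the unique $m=\arg\min_{q\in\mathcal Q}\mathbf E[d(Y,q)^\alpha-d(Y,o)^\alpha]$ with an arbitrary reference point $o\in\mathcal Q$ (independent of $o$), and $m_n=\arg\min_{q\in\mathcal Q}\sum_{j=1}^n d(Y_j,q)^\alpha$, regarded as a measurable function of $(Y_1,\dots,Y_n)$. Conventions: $0^0:=1$ and $0^\varphi:=\infty$ for $\varphi<0$. $\mathcal N(\mu,v)$ is the normal distribution with mean $\mu$ and variance $v$. *)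

theory Defs
  imports "HOL-Probability.Probability"
begin

class hadamard_space = complete_space +
  assumes hadamard:
    "\<exists>p. \<forall>q. (dist q p)\<^sup>2
      \<le> (dist y0 q)\<^sup>2 / 2 + (dist y1 q)\<^sup>2 / 2 - (dist y0 y1)\<^sup>2 / 4"

definition unit_speed_geodesic :: "real set \<Rightarrow> (real \<Rightarrow> 'a::metric_space) \<Rightarrow> bool" where
  "unit_speed_geodesic I \<gamma> \<longleftrightarrow>
     convex I \<and> (\<forall>s\<in>I. \<forall>t\<in>I. dist (\<gamma> s) (\<gamma> t) = \<bar>s - t\<bar>)"

text \<open>Real powers of nonnegative reals, with \<open>0\<^sup>0 = 1\<close> and \<open>0\<^sup>\<phi> = \<infinity>\<close> for \<open>\<phi> < 0\<close>
  (whereas \<open>0 powr \<phi> = 0\<close> for every \<open>\<phi>\<close>).\<close>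

definition epow :: "real \<Rightarrow> real \<Rightarrow> ennreal" where
  "epow x \<phi> =
     (if x = 0 then (if \<phi> < 0 then \<infinity> else if \<phi> = 0 then 1 else 0) else ennreal (x powr \<phi>))"

definition dist_moment ::
    "'w measure \<Rightarrow> ('w \<Rightarrow> 'a::metric_space) \<Rightarrow> 'a \<Rightarrow> real \<Rightarrow> ennreal" where
  "dist_moment M Y q \<phi> = (\<integral>\<^sup>+\<omega>. epow (dist (Y \<omega>) q) \<phi> \<partial>M)"

text \<open>The reference point \<open>p\<close> only serves to make the integral exist when
  \<open>E[d(Y,q)\<^sup>\<alpha>]\<close> is infinite; the minimizers do not depend on it.\<close>

definition is_frechet_mean ::
    "real \<Rightarrow> 'w measure \<Rightarrow> ('w \<Rightarrow> 'a::metric_space) \<Rightarrow> 'a \<Rightarrow> 'a \<Rightarrow> bool" where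
  "is_frechet_mean \<alpha> M Y p m \<longleftrightarrow>
     is_arg_min (\<lambda>q. \<integral>\<omega>. dist (Y \<omega>) q powr \<alpha> - dist (Y \<omega>) p powr \<alpha> \<partial>M) (\<lambda>_. True) m"

definition is_empirical_frechet_mean ::
    "real \<Rightarrow> nat \<Rightarrow> (nat \<Rightarrow> 'a::metric_space) \<Rightarrow> 'a \<Rightarrow> bool" where
  "is_empirical_frechet_mean \<alpha> n y m \<longleftrightarrow>
     is_arg_min (\<lambda>q. \<Sum>j=1..n. dist (y j) q powr \<alpha>) (\<lambda>_. True) m"

definition lower_semicontinuous_on :: "real set \<Rightarrow> (real \<Rightarrow> real) \<Rightarrow> bool" where
  "lower_semicontinuous_on S g \<longleftrightarrow>
     (\<forall>x\<in>S. \<forall>c<g x. eventually (\<lambda>y. c < g y) (at x within S))"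

text \<open>The normal law with mean \<open>\<mu>\<close> and variance \<open>v\<close> (not standard deviation), for \<open>v > 0\<close>.\<close>

definition normal_law :: "real \<Rightarrow> real \<Rightarrow> real measure" where
  "normal_law \<mu> v = density lborel (\<lambda>x. ennreal (normal_density \<mu> (sqrt v) x))"

text \<open>
  With \<open>X = \<gamma>\<^sup>-\<^sup>1(Y) - \<gamma>\<^sup>-\<^sup>1(m)\<close> and \<open>\<psi>(x) = sgn(x) |x|\<^sup>\<alpha>\<^sup>-\<^sup>1\<close>, the mean \<open>m\<close> is characterized by
  \<open>E \<psi>(X) = 0\<close>, and \<open>E \<psi>(t - X)\<close> behaves like \<open>c sgn(t) |t|\<^sup>\<beta>\<^sup>-\<^sup>1\<close> as \<open>t\<close> tends to \<open>0\<close>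
  if \<open>P(0 \<le> X \<le> t)\<close> and \<open>P(-t \<le> X \<le> 0)\<close> both behave like \<open>b t\<^sup>\<beta>\<^sup>-\<^sup>\<alpha>\<close> as \<open>t\<close> decreases
  to \<open>0\<close>. Here \<open>c\<close> is the integral of \<open>\<psi>(1 - x) + \<psi>(x)\<close> against the scaling limit
  \<open>b (\<beta> - \<alpha>) |x|\<^sup>\<beta>\<^sup>-\<^sup>\<alpha>\<^sup>-\<^sup>1 dx\<close> of the law of \<open>X\<close> near \<open>0\<close>. Solving
  \<open>c sgn(t) |t|\<^sup>\<beta>\<^sup>-\<^sup>1 = W / sqrt n\<close> for \<open>|t|\<close> gives \<open>C\<^sub>\<alpha>\<^sub>,\<^sub>\<beta>\<^sub>,\<^sub>b = c powr (-1/(\<beta> - 1))\<close>.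
  The constant is given explicitly, instead of being existentially quantified in the theorem,
  because it must not depend on the type of the Hadamard space.\<close>

definition frechet_rate_const :: "real \<Rightarrow> real \<Rightarrow> real \<Rightarrow> real" where
  "frechet_rate_const \<alpha> \<beta> b =
     (b * (\<beta> - \<alpha>) *
        (\<integral>x. (sgn (1 - x) * \<bar>1 - x\<bar> powr (\<alpha> - 1) + sgn x * \<bar>x\<bar> powr (\<alpha> - 1))
             * \<bar>x\<bar> powr (\<beta> - \<alpha> - 1) \<partial>lborel))
     powr (- 1 / (\<beta> - 1))"

end

theory Submission
  imports Defs
begin

text \<open>Along a geodesic a Hadamard space looks like an interval of the real line, and this reduces the
  theorem to real random variables. The nearest-point projection onto a closed geodesic strictly
  shortens the distance from any other point to every point of the geodesic; hence Frechet means,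
  of the population as well as of a sample, lie on it (\<open>frechet_mean_on_geodesic\<close>). Put
  \<open>\<psi>(x) = sgn(x) |x|\<^sup>\<alpha>\<^sup>-\<^sup>1\<close>, and let \<open>X\<close>, \<open>X\<^sub>j\<close> and \<open>T\<^sub>n\<close> be the coordinates of \<open>Y\<close>, \<open>Y\<^sub>j\<close> and
  \<open>m\<^sub>n\<close> along the geodesic, with origin at \<open>m\<close>. Then \<open>|T\<^sub>n| = d(m, m\<^sub>n)\<close>, and minimality becomes the
  pair of score equations \<open>E \<psi>(X) = 0\<close> and \<open>\<Sum>\<^sub>j \<psi>(T\<^sub>n - X\<^sub>j) = 0\<close> (\<open>frechet_mean_coordinates\<close>).

  Since \<open>\<psi>\<close> is strictly increasing, \<open>T\<^sub>n \<le> t\<close> holds exactly when \<open>\<Sum>\<^sub>j \<psi>(t - X\<^sub>j) \<ge> 0\<close>. The summands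
  have mean \<open>f(t) = E \<psi>(t - X)\<close>, and as \<open>\<psi>\<close> is Hoelder continuous, the fluctuations of the sum for
  small \<open>t\<close> are those of \<open>- \<Sum>\<^sub>j \<psi>(X\<^sub>j)\<close>, which the central limit theorem describes. With
  \<open>W\<close> normal of mean \<open>0\<close> and variance \<open>E |X|\<^sup>2\<^sup>\<alpha>\<^sup>-\<^sup>2\<close>, this yields \<open>P(T\<^sub>n \<le> t\<^sub>n) \<longlonglongrightarrow> P(W \<le> L)\<close>
  whenever \<open>t\<^sub>n \<longlonglongrightarrow> 0\<close> and \<open>sqrt n f(t\<^sub>n) \<longlonglongrightarrow> L\<close> (\<open>score_crossing_limit\<close>). If \<open>f(t)\<close> behaves like
  \<open>c sgn(t) |t|\<^sup>r\<close> near \<open>0\<close>, taking \<open>t\<^sub>n\<close> to be a multiple of the \<open>1/(2r)\<close>-th power of \<open>1/n\<close> shows that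
  \<open>T\<^sub>n\<close>, rescaled by the \<open>1/(2r)\<close>-th power of \<open>n\<close>, converges weakly to the solution \<open>V\<close> of
  \<open>c sgn(V) |V|\<^sup>r = W\<close>. Realizing the convergence almost surely and applying Fatou's lemma gives the
  lower bound for every lower semi-continuous \<open>g\<close> (\<open>liminf_score_root\<close>).

  It remains to find \<open>c\<close> and \<open>r\<close>. In case (i) the small-ball condition makes \<open>E |X|\<^sup>\<alpha>\<^sup>-\<^sup>2\<close> finite, and
  one may differentiate under the expectation: \<open>r = 1\<close> and \<open>c = (\<alpha> - 1) E |X|\<^sup>\<alpha>\<^sup>-\<^sup>2\<close>
  (\<open>negative_moment_finite\<close>, \<open>score_derivative\<close>). In case (ii) homogeneity gives
  \<open>f(t) = t\<^sup>\<alpha>\<^sup>-\<^sup>1 E k(X / t)\<close> for \<open>t > 0\<close>, with \<open>k(x) = \<psi>(1 - x) + \<psi>(x)\<close>. On each half-line the superlevel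
  sets of \<open>k\<close> are intervals, whose rescaled probabilities converge by hypothesis; the layer-cake
  formula and dominated convergence integrate this over the levels, so that \<open>r = \<beta> - 1\<close> and \<open>c\<close> is the
  integral of \<open>k\<close> against the limiting power law (\<open>power_law_scaling_limit\<close>, \<open>score_power_law\<close>).\<close>

section \<open>Signed powers\<close>

definition spow :: "real \<Rightarrow> real \<Rightarrow> real" where
  "spow a x = sgn x * \<bar>x\<bar> powr a"

lemma spow_0 [simp]: "spow a 0 = 0"
  by (simp add: spow_def)

lemma spow_minus [simp]: "spow a (- x) = - spow a x"
  by (simp add: spow_def sgn_minus)

lemma abs_spow: "\<bar>spow a x\<bar> = \<bar>x\<bar> powr a"
  by (simp add: spow_def abs_mult abs_sgn_eq)

lemma spow_pos: "0 < x \<Longrightarrow> spow a x = x powr a"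
  and spow_neg: "x < 0 \<Longrightarrow> spow a x = - ((- x) powr a)"
  by (simp_all add: spow_def)

lemma spow_nonneg: "0 \<le> x \<Longrightarrow> spow a x = x powr a"
  by (cases "x = 0") (simp_all add: spow_def)

lemma spow_1 [simp]: "spow 1 x = x"
  by (simp add: spow_def sgn_mult_abs)

lemma spow_power2: "(spow a x)\<^sup>2 = \<bar>x\<bar> powr (2 * a)"
proof -
  have "(spow a x)\<^sup>2 = (\<bar>x\<bar> powr a)\<^sup>2"
    unfolding abs_spow[symmetric] by (rule power2_abs[symmetric])
  also have "\<dots> = \<bar>x\<bar> powr (2 * a)"
    unfolding mult_2 powr_add by (rule power2_eq_square)
  finally show ?thesis .
qed

lemma spow_mult: "0 \<le> c \<Longrightarrow> spow a (c * x) = c powr a * spow a x"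
  by (cases "c = 0") (simp_all add: spow_def sgn_mult abs_mult powr_mult)

lemma spow_spow_inverse: "a \<noteq> 0 \<Longrightarrow> spow (1 / a) (spow a x) = x"
  by (cases "x = 0")
    (simp_all add: spow_def sgn_mult abs_mult abs_sgn_eq powr_powr sgn_mult_abs)

lemma spow_measurable [measurable]: "spow a \<in> borel_measurable borel"
  unfolding spow_def[abs_def] by measurable

lemma strict_mono_spow:
  assumes "0 < a" shows "strict_mono (spow a)"
proof
  fix x y :: real assume "x < y"
  consider "0 \<le> x" | "x < 0" "0 \<le> y" | "x < 0" "y < 0" by linarith
  then show "spow a x < spow a y"
  proof cases
    case 1 then show ?thesis using \<open>x < y\<close> assms by (simp add: spow_nonneg powr_less_mono2)
  next
    case 2 
    have "spow a x < 0" using 2 by (simp add: spow_neg)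
    also have "0 \<le> spow a y" using 2 by (simp add: spow_nonneg)
    finally show ?thesis .
  next
    case 3 then show ?thesis using \<open>x < y\<close> assms by (simp add: spow_neg powr_less_mono2)
  qed
qed

text \<open>After dividing by \<open>(x + y)\<^sup>a\<close> this is \<open>u \<le> u\<^sup>a\<close> for the two shares \<open>u \<in> [0, 1]\<close>.\<close>

lemma powr_subadditive:
  fixes x y :: real
  assumes "0 \<le> x" "0 \<le> y" "0 < a" "a \<le> 1"
  shows "(x + y) powr a \<le> x powr a + y powr a"
proof (cases "x + y = 0")
  case False
  with assms have s: "0 < x + y" by linarith
  have *: "u \<le> u powr a" if "0 \<le> u" "u \<le> 1" for u :: real
  proof (cases "u = 0")
    case False
    then show ?thesis using powr_mono'[of a 1 u] that assms by simp
  qed simp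
  have "1 = x / (x + y) + y / (x + y)" using s by (metis add_divide_distrib divide_self_if less_irrefl)
  also have "\<dots> \<le> (x / (x + y)) powr a + (y / (x + y)) powr a"
    using assms s by (intro add_mono *) auto
  also have "\<dots> = (x powr a + y powr a) / (x + y) powr a"
    using assms s by (simp add: powr_divide add_divide_distrib)
  finally show ?thesis using s by (simp add: field_simps)
qed (use assms in simp)

text \<open>For arguments of equal sign this is subadditivity of the power. For opposite signs both powers are at
  most \<open>|x - y|\<^sup>a\<close>, which is where the factor 2 comes from.\<close>

lemma spow_hoelder:
  assumes "0 < a" "a \<le> 1"
  shows "\<bar>spow a x - spow a y\<bar> \<le> 2 * \<bar>x - y\<bar> powr a"
proof -
  have 1: "\<bar>spow a x - spow a y\<bar> \<le> 2 * \<bar>x - y\<bar> powr a" if "0 \<le> y" "y \<le> x" for x y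
  proof -
    have "x powr a \<le> y powr a + (x - y) powr a"
      using powr_subadditive[of y "x - y" a] that assms by simp
    moreover have "y powr a \<le> x powr a" using that assms by (intro powr_mono2) auto
    moreover have "0 \<le> (x - y) powr a" by simp
    ultimately show ?thesis using that by (simp add: spow_nonneg)
  qed
  have 2: "\<bar>spow a x - spow a y\<bar> \<le> 2 * \<bar>x - y\<bar> powr a" if "y \<le> 0" "0 \<le> x" for x y
  proof -
    have "x powr a \<le> (x - y) powr a" "(- y) powr a \<le> (x - y) powr a"
      using that assms by (auto intro!: powr_mono2)
    moreover have "spow a y = - ((- y) powr a)"
      using spow_nonneg[of "- y" a] that by simp
    ultimately show ?thesis using that by (simp add: spow_nonneg)
  qed
  have 3: "\<bar>spow a x - spow a y\<bar> \<le> 2 * \<bar>x - y\<bar> powr a" if "y \<le> x" for x y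
  proof -
    consider "0 \<le> y" | "y \<le> 0" "0 \<le> x" | "x \<le> 0" by linarith
    then show ?thesis
    proof cases
      case 3
      then show ?thesis using 1[of "- x" "- y"] that by (simp add: abs_minus_commute)
    qed (use 1 2 that in auto)
  qed
  show ?thesis
    using 3[of x y] 3[of y x] by (cases "y \<le> x") (auto simp: abs_minus_commute)
qed

lemma DERIV_spow:
  assumes "x \<noteq> 0"
  shows "(spow a has_real_derivative a * \<bar>x\<bar> powr (a - 1)) (at x)"
proof (cases "x > 0")
  case True
  have "((\<lambda>x. x powr a) has_real_derivative a * \<bar>x\<bar> powr (a - 1)) (at x)"
    using True by (auto intro!: derivative_eq_intros)
  then show ?thesis
    by (rule has_field_derivative_transform_within_open[where S="{0<..}"])
      (use True in \<open>auto simp: spow_pos\<close>)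
next
  case False
  have "((\<lambda>x. - ((- x) powr a)) has_real_derivative a * \<bar>x\<bar> powr (a - 1)) (at x)"
    using False assms by (auto intro!: derivative_eq_intros)
  then show ?thesis
    by (rule has_field_derivative_transform_within_open[where S="{..<0}"])
      (use False assms in \<open>auto simp: spow_neg\<close>)
qed

lemma isCont_spow:
  assumes "0 < a" shows "isCont (spow a) x"
proof (cases "x = 0")
  case True
  have "((\<lambda>x. \<bar>x\<bar> powr a) \<longlongrightarrow> \<bar>0::real\<bar> powr a) (at 0)"
    using assms by (intro tendsto_powr' tendsto_intros) auto
  then have "((\<lambda>x. \<bar>spow a x\<bar>) \<longlongrightarrow> 0) (at 0)"
    by (simp add: abs_spow)
  then show ?thesis using True by (simp add: isCont_def tendsto_rabs_zero_iff)
qed (rule DERIV_isCont[OF DERIV_spow])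

lemma spow_shift_bound:
  assumes "0 < a" "a \<le> 1"
  shows "\<bar>spow a (t - x) + spow a x\<bar> \<le> 2 * \<bar>t\<bar> powr a"
  using spow_hoelder[OF assms, of "t - x" "- x"] by simp

text \<open>A bound that is linear in \<open>t\<close>, uniformly in \<open>x\<close>; it is the integrable majorant for
  differentiating under the expectation. For \<open>|t| \<ge> |x| / 2\<close> it follows from Hoelder continuity, because
  \<open>|t|\<^sup>a\<^sup>-\<^sup>1\<close> decreases in \<open>|t|\<close>. Otherwise \<open>x - t\<close> stays on the side of \<open>x\<close>, at distance at least
  \<open>|x| / 2\<close> from the singularity at \<open>0\<close>.\<close>

lemma spow_increment_bound:
  assumes a: "0 < a" "a \<le> 1" and x: "x \<noteq> 0"
  shows "\<bar>spow a (t - x) + spow a x\<bar> \<le> 4 * \<bar>t\<bar> * \<bar>x\<bar> powr (a - 1)"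
proof -
  have half: "(\<bar>x\<bar> / 2) powr (a - 1) \<le> 2 * \<bar>x\<bar> powr (a - 1)" for x :: real
  proof -
    have e: "(2 :: real) powr (1 - a) = 1 / 2 powr (a - 1)"
      using powr_minus_divide[of "2 :: real" "a - 1"] by simp
    have "(\<bar>x\<bar> / 2) powr (a - 1) = \<bar>x\<bar> powr (a - 1) / 2 powr (a - 1)"
      by (simp add: powr_divide)
    also have "\<dots> = \<bar>x\<bar> powr (a - 1) * 2 powr (1 - a)"
      unfolding e by simp
    also have "\<dots> \<le> \<bar>x\<bar> powr (a - 1) * 2 powr 1"
      using a by (intro mult_left_mono powr_mono) auto
    finally show ?thesis by simp
  qed
  have pos: "\<bar>y powr a - x powr a\<bar> \<le> \<bar>y - x\<bar> * (x / 2) powr (a - 1)" if "0 < x" "x / 2 \<le> y" for x y :: real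
  proof -
    have *: "\<bar>u powr a - w powr a\<bar> \<le> \<bar>u - w\<bar> * (x / 2) powr (a - 1)" if "w \<le> u" "x / 2 \<le> w" for u w
    proof -
      have w: "0 < w" using that \<open>0 < x\<close> by linarith
      have "u powr a = u * u powr (a - 1)" "w powr a = w * w powr (a - 1)"
        using w that by (simp_all add: powr_diff)
      moreover have "u powr (a - 1) \<le> w powr (a - 1)"
        using w that a by (intro powr_mono2') auto
      ultimately have "u powr a - w powr a \<le> (u - w) * w powr (a - 1)"
        using w that by (simp add: algebra_simps mult_left_mono)
      also have "\<dots> \<le> (u - w) * (x / 2) powr (a - 1)"
        using that \<open>0 < x\<close> a by (intro mult_left_mono powr_mono2') auto
      finally show ?thesis using that w powr_mono2[of a w u] a by simp
    qed
    show ?thesis using *[of x y] *[of y x] that by (cases "x \<le> y") (auto simp: abs_minus_commute)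
  qed
  show ?thesis
  proof (cases "\<bar>x\<bar> \<le> 2 * \<bar>t\<bar>")
    case True
    have t: "t \<noteq> 0" using True x by auto
    have "\<bar>spow a (t - x) + spow a x\<bar> \<le> 2 * \<bar>t\<bar> powr a" by (rule spow_shift_bound[OF a])
    also have "\<bar>t\<bar> powr a = \<bar>t\<bar> * \<bar>t\<bar> powr (a - 1)" using t by (simp add: powr_diff)
    also have "2 * (\<bar>t\<bar> * \<bar>t\<bar> powr (a - 1)) \<le> 2 * (\<bar>t\<bar> * (2 * \<bar>x\<bar> powr (a - 1)))"
    proof (intro mult_left_mono)
      have "\<bar>t\<bar> powr (a - 1) \<le> (\<bar>x\<bar> / 2) powr (a - 1)"
        using True x a by (intro powr_mono2') auto
      also note half
      finally show "\<bar>t\<bar> powr (a - 1) \<le> 2 * \<bar>x\<bar> powr (a - 1)" .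
    qed auto
    finally show ?thesis by simp
  next
    case False
    have "\<bar>spow a (t - x) + spow a x\<bar> = \<bar>\<bar>x - t\<bar> powr a - \<bar>x\<bar> powr a\<bar> \<and> \<bar>x\<bar> / 2 \<le> \<bar>x - t\<bar> \<and> \<bar>\<bar>x - t\<bar> - \<bar>x\<bar>\<bar> = \<bar>t\<bar>"
    proof (cases "0 < x")
      case True
      then have "t < x" using False by linarith
      then show ?thesis using True False by (auto simp: spow_pos spow_neg)
    next
      case neg: False
      then have "x < t" "x < 0" using False x by linarith+
      then show ?thesis using neg False by (auto simp: spow_pos spow_neg)
    qed
    then have "\<bar>spow a (t - x) + spow a x\<bar> \<le> \<bar>t\<bar> * (\<bar>x\<bar> / 2) powr (a - 1)"
      using pos[of "\<bar>x\<bar>" "\<bar>x - t\<bar>"] x by simp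
    also have "\<dots> \<le> \<bar>t\<bar> * (2 * \<bar>x\<bar> powr (a - 1))" by (intro mult_left_mono half) simp
    also have "\<dots> \<le> 4 * \<bar>t\<bar> * \<bar>x\<bar> powr (a - 1)" by simp
    finally show ?thesis .
  qed
qed

text \<open>The convex function \<open>|x|\<^sup>\<alpha>\<close> lies above its tangent at \<open>y\<close>: by Young's inequality
  \<open>|x| |y|\<^sup>\<alpha>\<^sup>-\<^sup>1\<close> is at most \<open>|x|\<^sup>\<alpha> / \<alpha> + (1 - 1/\<alpha>) |y|\<^sup>\<alpha>\<close>.\<close>

lemma abs_powr_tangent:
  fixes x y :: real
  assumes "1 < \<alpha>"
  shows "\<bar>y\<bar> powr \<alpha> + \<alpha> * spow (\<alpha> - 1) y * (x - y) \<le> \<bar>x\<bar> powr \<alpha>"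
proof -
  have "\<bar>x\<bar> * \<bar>y\<bar> powr (\<alpha> - 1) \<le> \<bar>x\<bar> powr \<alpha> / \<alpha> + (\<bar>y\<bar> powr (\<alpha> - 1)) powr (\<alpha> / (\<alpha> - 1)) / (\<alpha> / (\<alpha> - 1))"
    using assms by (intro Youngs_inequality) (auto simp: field_simps)
  also have "(\<bar>y\<bar> powr (\<alpha> - 1)) powr (\<alpha> / (\<alpha> - 1)) = \<bar>y\<bar> powr \<alpha>"
    using assms by (simp add: powr_powr)
  finally have young: "\<alpha> * (\<bar>x\<bar> * \<bar>y\<bar> powr (\<alpha> - 1)) \<le> \<bar>x\<bar> powr \<alpha> + (\<alpha> - 1) * \<bar>y\<bar> powr \<alpha>"
    using assms by (simp add: field_simps)
  have "spow (\<alpha> - 1) y * x \<le> \<bar>spow (\<alpha> - 1) y * x\<bar>" by simp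
  also have "\<dots> = \<bar>x\<bar> * \<bar>y\<bar> powr (\<alpha> - 1)" by (simp add: abs_mult abs_spow)
  finally have "\<alpha> * (spow (\<alpha> - 1) y * x) \<le> \<alpha> * (\<bar>x\<bar> * \<bar>y\<bar> powr (\<alpha> - 1))"
    using assms by simp
  moreover have "spow (\<alpha> - 1) y * y = \<bar>y\<bar> powr \<alpha>"
  proof (cases "y = 0")
    case False
    have "spow (\<alpha> - 1) y * y = \<bar>y\<bar> powr (\<alpha> - 1) * \<bar>y\<bar> powr 1"
      by (simp add: spow_def abs_sgn[symmetric] mult.commute mult.left_commute)
    also have "\<dots> = \<bar>y\<bar> powr \<alpha>" unfolding powr_add[symmetric] by simp
    finally show ?thesis .
  qed simp
  ultimately show ?thesis using young by (simp add: algebra_simps)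
qed

lemma powr_diff_bound:
  fixes x y :: real
  assumes "1 < \<alpha>" "0 \<le> x" "0 \<le> y"
  shows "\<bar>x powr \<alpha> - y powr \<alpha>\<bar> \<le> \<alpha> * \<bar>x - y\<bar> * (x powr (\<alpha> - 1) + y powr (\<alpha> - 1))"
proof -
  have *: "u powr \<alpha> - w powr \<alpha> \<le> \<alpha> * \<bar>u - w\<bar> * (u powr (\<alpha> - 1) + w powr (\<alpha> - 1))"
    if "0 \<le> u" "0 \<le> w" for u w :: real
  proof -
    have "u powr \<alpha> - w powr \<alpha> \<le> \<alpha> * u powr (\<alpha> - 1) * (u - w)"
      using abs_powr_tangent[OF assms(1), of u w] that by (simp add: spow_nonneg algebra_simps)
    also have "\<dots> \<le> \<alpha> * u powr (\<alpha> - 1) * \<bar>u - w\<bar>"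
      using assms(1) by (intro mult_left_mono) auto
    also have "\<dots> \<le> \<alpha> * \<bar>u - w\<bar> * (u powr (\<alpha> - 1) + w powr (\<alpha> - 1))"
      using assms(1) by (simp add: algebra_simps)
    finally show ?thesis .
  qed
  show ?thesis
    using *[OF assms(2,3)] *[OF assms(3,2)] unfolding abs_minus_commute[of y x]
    by (simp add: abs_le_iff add.commute)
qed

section \<open>Geodesics in Hadamard spaces\<close>

text \<open>The point that the axiom of a Hadamard space provides for two points of a geodesic can only be their
  midpoint on it: inserting that midpoint for \<open>q\<close> makes the right-hand side of the axiom vanish.\<close>

lemma geodesic_midpoint:
  fixes \<gamma> :: "real \<Rightarrow> 'a::hadamard_space"
  assumes \<gamma>: "unit_speed_geodesic J \<gamma>" and st: "s \<in> J" "t \<in> J"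
  shows "(dist q (\<gamma> ((s + t) / 2)))\<^sup>2 \<le> (dist q (\<gamma> s))\<^sup>2 / 2 + (dist q (\<gamma> t))\<^sup>2 / 2 - (s - t)\<^sup>2 / 4"
proof -
  let ?r = "(s + t) / 2"
  have r: "?r \<in> J"
    using \<gamma> st convexD[of J s t "1/2" "1/2"] by (simp add: unit_speed_geodesic_def add_divide_distrib)
  have d: "dist (\<gamma> x) (\<gamma> y) = \<bar>x - y\<bar>" if "x \<in> J" "y \<in> J" for x y
    using \<gamma> that by (simp add: unit_speed_geodesic_def)
  obtain p where p: "\<And>q. (dist q p)\<^sup>2 \<le> (dist (\<gamma> s) q)\<^sup>2 / 2 + (dist (\<gamma> t) q)\<^sup>2 / 2 - (dist (\<gamma> s) (\<gamma> t))\<^sup>2 / 4"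
    using hadamard by blast
  have "(dist (\<gamma> ?r) p)\<^sup>2 \<le> (s - ?r)\<^sup>2 / 2 + (t - ?r)\<^sup>2 / 2 - (s - t)\<^sup>2 / 4"
    using p[of "\<gamma> ?r"] st r by (simp add: d)
  also have "\<dots> = 0" by (simp add: power2_eq_square field_simps)
  finally have "\<gamma> ?r = p" by simp
  then show ?thesis using p[of q] st by (simp add: d dist_commute)
qed

lemma uniformly_continuous_on_geodesic:
  assumes "unit_speed_geodesic J \<gamma>" shows "uniformly_continuous_on J \<gamma>"
  using assms by (auto simp: unit_speed_geodesic_def uniformly_continuous_on_def dist_real_def)

text \<open>The nearest point on a closed geodesic exists by compactness. The squared distance \<open>\<phi>(s)\<close> from \<open>q\<close>
  satisfies the midpoint inequality of the strongly convex function \<open>s\<^sup>2\<close>. Bisecting towards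
  the minimizer \<open>s0\<close> improves a bound \<open>\<phi>(s) - \<phi>(s0) \<ge> \<kappa> (s - s0)\<^sup>2\<close> to one with \<open>(1 + \<kappa>) / 2\<close> in
  place of \<open>\<kappa>\<close>, so that \<open>\<kappa>\<close> tends to 1.\<close>

lemma geodesic_projection:
  fixes \<gamma> :: "real \<Rightarrow> 'a::hadamard_space"
  assumes \<gamma>: "unit_speed_geodesic J \<gamma>" and J: "closed J" "J \<noteq> {}"
  obtains s0 where "s0 \<in> J"
    and "\<And>s. s \<in> J \<Longrightarrow> (dist q (\<gamma> s0))\<^sup>2 + (s - s0)\<^sup>2 \<le> (dist q (\<gamma> s))\<^sup>2"
proof -
  have d: "dist (\<gamma> x) (\<gamma> y) = \<bar>x - y\<bar>" if "x \<in> J" "y \<in> J" for x y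
    using \<gamma> that by (simp add: unit_speed_geodesic_def)
  have cont: "continuous_on J (\<lambda>s. dist q (\<gamma> s))"
    using uniformly_continuous_on_geodesic[OF \<gamma>] by (intro continuous_intros uniformly_continuous_imp_continuous)
  obtain a where a: "a \<in> J" using J by auto
  define K where "K = J \<inter> cball a (2 * dist q (\<gamma> a))"
  have "compact K" "a \<in> K" using J a by (auto simp: K_def closed_Int_compact)
  then obtain s0 where s0: "s0 \<in> K" "\<And>s. s \<in> K \<Longrightarrow> dist q (\<gamma> s0) \<le> dist q (\<gamma> s)"
    using continuous_attains_inf[of K "\<lambda>s. dist q (\<gamma> s)"] continuous_on_subset[OF cont, of K]
    by (metis K_def Int_lower1 empty_iff)
  have min: "dist q (\<gamma> s0) \<le> dist q (\<gamma> s)" if "s \<in> J" for s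
  proof (cases "s \<in> K")
    case False
    then have "2 * dist q (\<gamma> a) < dist (\<gamma> a) (\<gamma> s)"
      using that a by (simp add: K_def d dist_real_def)
    also have "\<dots> \<le> dist q (\<gamma> a) + dist q (\<gamma> s)"
      by (metis dist_commute dist_triangle2)
    finally show ?thesis using s0(2)[OF \<open>a \<in> K\<close>] by linarith
  qed (rule s0(2))
  have "s0 \<in> J" using s0 by (simp add: K_def)
  \<comment> \<open>The hypothesis for \<open>k\<close> is applied to the midpoint of \<open>s\<close> and \<open>s0\<close>.\<close>
  have step: "(1 - (1 / 2) ^ k) * (s - s0)\<^sup>2 \<le> (dist q (\<gamma> s))\<^sup>2 - (dist q (\<gamma> s0))\<^sup>2" if "s \<in> J" for s and k :: nat
    using that
  proof (induction k arbitrary: s)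
    case 0
    then show ?case using min by simp
  next
    case (Suc k)
    have r: "(s + s0) / 2 \<in> J"
      using \<gamma> Suc.prems \<open>s0 \<in> J\<close> convexD[of J s s0 "1/2" "1/2"]
      by (simp add: unit_speed_geodesic_def add_divide_distrib)
    have e: "((s + s0) / 2 - s0)\<^sup>2 = (s - s0)\<^sup>2 / 4"
      by (simp add: power2_eq_square field_simps)
    define E where "E = (s - s0)\<^sup>2 * (1 / 2) ^ k"
    have "((s - s0)\<^sup>2 - E) / 4 \<le> (dist q (\<gamma> ((s + s0) / 2)))\<^sup>2 - (dist q (\<gamma> s0))\<^sup>2"
      using Suc.IH[OF r] unfolding e E_def by (simp add: algebra_simps)
    moreover have "(1 - (1 / 2) ^ Suc k) * (s - s0)\<^sup>2 = (s - s0)\<^sup>2 - E / 2"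
      unfolding E_def by (simp add: algebra_simps)
    moreover have "B - E / 2 \<le> S - A" if "(B - E) / 4 \<le> R - A" "R \<le> S / 2 + A / 2 - B / 4" for A B R S :: real
      using that by (simp add: field_simps)
    ultimately show ?case
      using geodesic_midpoint[OF \<gamma> Suc.prems \<open>s0 \<in> J\<close>, of q] by metis
  qed
  have "(dist q (\<gamma> s0))\<^sup>2 + (s - s0)\<^sup>2 \<le> (dist q (\<gamma> s))\<^sup>2" if "s \<in> J" for s
  proof -
    have "(\<lambda>k. (1 - (1 / 2) ^ k) * (s - s0)\<^sup>2) \<longlonglongrightarrow> (1 - 0) * (s - s0)\<^sup>2"
      by (intro tendsto_intros LIMSEQ_power_zero) simp
    then have "(1 - 0) * (s - s0)\<^sup>2 \<le> (dist q (\<gamma> s))\<^sup>2 - (dist q (\<gamma> s0))\<^sup>2"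
      by (rule LIMSEQ_le_const2) (use step[OF that] in auto)
    then show ?thesis by simp
  qed
  then show ?thesis using that \<open>s0 \<in> J\<close> by blast
qed

text \<open>The interval of a geodesic may lack its end points, whereas nearest points exist only on closed
  geodesics; completeness of the space supplies the extension.\<close>

lemma geodesic_closure:
  fixes \<gamma> :: "real \<Rightarrow> 'a::complete_space"
  assumes \<gamma>: "unit_speed_geodesic I \<gamma>"
  obtains \<gamma>' where "unit_speed_geodesic (closure I) \<gamma>'" "\<And>s. s \<in> I \<Longrightarrow> \<gamma>' s = \<gamma> s"
proof -
  obtain \<gamma>' where uc: "uniformly_continuous_on (closure I) \<gamma>'" and eq: "\<And>s. s \<in> I \<Longrightarrow> \<gamma> s = \<gamma>' s"
    using uniformly_continuous_on_extension_on_closure[OF uniformly_continuous_on_geodesic[OF \<gamma>]] by metis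
  have lim: "(\<lambda>n. \<gamma>' (x n)) \<longlonglongrightarrow> \<gamma>' s" if "\<And>n. x n \<in> I" "x \<longlonglongrightarrow> s" "s \<in> closure I" for x s
    using uniformly_continuous_imp_continuous[OF uc] that closure_subset[of I]
    by (auto intro!: continuous_on_tendsto_compose[of "closure I" \<gamma>'] always_eventually)
  have "dist (\<gamma>' s) (\<gamma>' t) = \<bar>s - t\<bar>" if st: "s \<in> closure I" "t \<in> closure I" for s t
  proof -
    obtain x y where x: "\<And>n. x n \<in> I" "x \<longlonglongrightarrow> s" and y: "\<And>n. y n \<in> I" "y \<longlonglongrightarrow> t"
      using st unfolding closure_sequential by metis
    have "(\<lambda>n. dist (\<gamma>' (x n)) (\<gamma>' (y n))) \<longlonglongrightarrow> dist (\<gamma>' s) (\<gamma>' t)"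
      using lim[OF x st(1)] lim[OF y st(2)] by (rule tendsto_dist)
    moreover have "(\<lambda>n. dist (\<gamma>' (x n)) (\<gamma>' (y n))) = (\<lambda>n. \<bar>x n - y n\<bar>)"
      using \<gamma> x(1) y(1) by (simp add: eq[symmetric] unit_speed_geodesic_def)
    moreover have "(\<lambda>n. \<bar>x n - y n\<bar>) \<longlonglongrightarrow> \<bar>s - t\<bar>"
      using x(2) y(2) by (intro tendsto_intros)
    ultimately show ?thesis using LIMSEQ_unique by metis
  qed
  then have "unit_speed_geodesic (closure I) \<gamma>'"
    using \<gamma> by (auto simp: unit_speed_geodesic_def convex_closure)
  then show ?thesis using that eq by metis
qed

text \<open>For two points \<open>a < b\<close> of the parameter interval, the difference of \<open>(s - a)\<^sup>2\<close> and \<open>(s - b)\<^sup>2\<close> is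
  affine in \<open>s\<close>. Solving for \<open>s\<close> and replacing \<open>|s - a|\<close> and \<open>|s - b|\<close> by distances gives a
  coordinate that is continuous on the whole space and hence measurable.\<close>

lemma geodesic_coordinate:
  fixes \<gamma> :: "real \<Rightarrow> 'a::metric_space"
  assumes \<gamma>: "unit_speed_geodesic J \<gamma>"
  obtains h :: "'a \<Rightarrow> real" where "continuous_on UNIV h" "\<And>s. s \<in> J \<Longrightarrow> h (\<gamma> s) = s"
proof (cases "\<exists>a\<in>J. \<exists>b\<in>J. a < b")
  case True
  then obtain a b where ab: "a \<in> J" "b \<in> J" "a < b" by blast
  define h where "h y = (((dist y (\<gamma> a))\<^sup>2 - (dist y (\<gamma> b))\<^sup>2) / (b - a) + a + b) / 2" for y
  have "continuous_on UNIV h"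
    unfolding h_def using ab by (intro continuous_intros) auto
  moreover have "h (\<gamma> s) = s" if "s \<in> J" for s
  proof -
    have "(dist (\<gamma> s) (\<gamma> a))\<^sup>2 - (dist (\<gamma> s) (\<gamma> b))\<^sup>2 = (s - a)\<^sup>2 - (s - b)\<^sup>2"
      using \<gamma> ab that by (simp add: unit_speed_geodesic_def)
    also have "\<dots> = (2 * s - a - b) * (b - a)"
      by (simp add: power2_eq_square algebra_simps)
    finally show ?thesis using ab by (simp add: h_def)
  qed
  ultimately show ?thesis by (rule that)
next
  case False
  define c where "c = (SOME s. s \<in> J)"
  have "c = s" if "s \<in> J" for s
    using someI[of "\<lambda>s. s \<in> J", OF that] False that unfolding c_def
    by (metis linorder_less_linear)
  then show ?thesis using that[of "\<lambda>_. c"] by simp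
qed

lemma closed_geodesic_image:
  fixes \<gamma> :: "real \<Rightarrow> 'a::metric_space"
  assumes \<gamma>: "unit_speed_geodesic J \<gamma>" and J: "closed J"
    and h: "continuous_on UNIV h" "\<And>s. s \<in> J \<Longrightarrow> h (\<gamma> s) = s"
  shows "closed (\<gamma> ` J)"
  unfolding closed_sequential_limits
proof (intro allI impI)
  fix y l assume y: "(\<forall>n. y n \<in> \<gamma> ` J) \<and> y \<longlonglongrightarrow> l"
  have s: "h (y n) \<in> J" "\<gamma> (h (y n)) = y n" for n
    using y h(2) by (metis imageE)+
  have lim: "(\<lambda>n. h (y n)) \<longlonglongrightarrow> h l"
    using h(1) y by (auto intro: continuous_on_tendsto_compose)
  then have hl: "h l \<in> J" by (rule closed_sequentially[OF J s(1)])
  have "(\<lambda>n. \<gamma> (h (y n))) \<longlonglongrightarrow> \<gamma> (h l)"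
    using uniformly_continuous_imp_continuous[OF uniformly_continuous_on_geodesic[OF \<gamma>]] lim hl s(1)
    by (intro continuous_on_tendsto_compose[of J \<gamma>]) auto
  then have "y \<longlonglongrightarrow> \<gamma> (h l)" by (simp add: s(2))
  then have "\<gamma> (h l) = l" using y LIMSEQ_unique by blast
  then show "l \<in> \<gamma> ` J" using hl by force
qed

section \<open>The score equation of a Frechet mean on a geodesic\<close>

text \<open>One half of the first-order condition at a minimizer \<open>x0\<close>. Using the tangent at \<open>s > x0\<close> instead of the
  one at \<open>x0\<close> bounds the increment of the objective from above by a multiple of the score at \<open>s\<close>, which is
  therefore nonnegative; let \<open>s\<close> decrease to \<open>x0\<close>. If \<open>x0\<close> is the right end point of \<open>J\<close>, then
  \<open>x0 - X\<close> is nonnegative almost surely.\<close>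

lemma score_nonneg:
  fixes X :: "'w \<Rightarrow> real"
  assumes "finite_measure M" and \<alpha>: "1 < \<alpha>" "\<alpha> \<le> 2"
    and [measurable]: "X \<in> borel_measurable M"
    and J: "convex J" "x0 \<in> J" "AE \<omega> in M. X \<omega> \<in> J"
    and int: "\<And>s. s \<in> J \<Longrightarrow> integrable M (\<lambda>\<omega>. spow (\<alpha> - 1) (s - X \<omega>))"
    and int': "\<And>s. s \<in> J \<Longrightarrow> integrable M (\<lambda>\<omega>. \<bar>s - X \<omega>\<bar> powr \<alpha> - \<bar>x0 - X \<omega>\<bar> powr \<alpha>)"
    and min: "\<And>s. s \<in> J \<Longrightarrow> 0 \<le> (\<integral>\<omega>. \<bar>s - X \<omega>\<bar> powr \<alpha> - \<bar>x0 - X \<omega>\<bar> powr \<alpha> \<partial>M)"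
  shows "0 \<le> (\<integral>\<omega>. spow (\<alpha> - 1) (x0 - X \<omega>) \<partial>M)"
proof (cases "\<exists>s1\<in>J. x0 < s1")
  case False
  have "AE \<omega> in M. 0 \<le> spow (\<alpha> - 1) (x0 - X \<omega>)"
    using J(3) by eventually_elim (use False in \<open>auto simp: spow_nonneg not_less\<close>)
  then show ?thesis by (rule integral_nonneg_AE)
next
  case True
  then obtain s1 where s1: "s1 \<in> J" "x0 < s1" by blast
  interpret finite_measure M by fact
  let ?F = "\<lambda>s. \<integral>\<omega>. spow (\<alpha> - 1) (s - X \<omega>) \<partial>M"
  have F: "0 \<le> ?F s" if "s \<in> J" "x0 < s" for s
  proof -
    have "0 \<le> (\<integral>\<omega>. \<bar>s - X \<omega>\<bar> powr \<alpha> - \<bar>x0 - X \<omega>\<bar> powr \<alpha> \<partial>M)" by (rule min) fact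
    also have "\<dots> \<le> (\<integral>\<omega>. \<alpha> * (s - x0) * spow (\<alpha> - 1) (s - X \<omega>) \<partial>M)"
    proof (rule integral_mono)
      fix \<omega>
      show "\<bar>s - X \<omega>\<bar> powr \<alpha> - \<bar>x0 - X \<omega>\<bar> powr \<alpha> \<le> \<alpha> * (s - x0) * spow (\<alpha> - 1) (s - X \<omega>)"
        using abs_powr_tangent[OF \<alpha>(1), of "s - X \<omega>" "x0 - X \<omega>"] by (simp add: algebra_simps)
    qed (use int int' that in auto)
    also have "\<dots> = \<alpha> * (s - x0) * ?F s" by simp
    finally have "0 \<le> (\<alpha> * (s - x0)) * ?F s" .
    moreover have "0 < \<alpha> * (s - x0)" using \<alpha> that by simp
    ultimately show ?thesis by (simp only: zero_le_mult_iff) auto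
  qed
  have lower: "- (2 * \<bar>s - x0\<bar> powr (\<alpha> - 1) * measure M (space M)) \<le> ?F x0" if "s \<in> J" "x0 < s" for s
  proof -
    have "?F s \<le> (\<integral>\<omega>. spow (\<alpha> - 1) (x0 - X \<omega>) + 2 * \<bar>s - x0\<bar> powr (\<alpha> - 1) \<partial>M)"
    proof (rule integral_mono)
      fix \<omega>
      show "spow (\<alpha> - 1) (s - X \<omega>) \<le> spow (\<alpha> - 1) (x0 - X \<omega>) + 2 * \<bar>s - x0\<bar> powr (\<alpha> - 1)"
        using spow_hoelder[of "\<alpha> - 1" "s - X \<omega>" "x0 - X \<omega>"] \<alpha> by simp
    qed (use int that J in auto)
    also have "\<dots> = ?F x0 + 2 * \<bar>s - x0\<bar> powr (\<alpha> - 1) * measure M (space M)"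
      using int[OF J(2)] by simp
    finally show ?thesis using F[OF that] by simp
  qed
  have "((\<lambda>s. - (2 * \<bar>s - x0\<bar> powr (\<alpha> - 1) * measure M (space M))) \<longlongrightarrow>
      - (2 * \<bar>x0 - x0\<bar> powr (\<alpha> - 1) * measure M (space M))) (at_right x0)"
    using \<alpha> by (intro tendsto_intros tendsto_powr') auto
  moreover have "eventually (\<lambda>s. - (2 * \<bar>s - x0\<bar> powr (\<alpha> - 1) * measure M (space M)) \<le> ?F x0) (at_right x0)"
    unfolding eventually_at_right_field
  proof (intro exI[of _ s1] conjI allI impI)
    fix s assume "x0 < s" "s < s1"
    moreover have "s \<in> J"
      using J(1,2) s1 \<open>x0 < s\<close> \<open>s < s1\<close> by (meson is_interval_convex_1 mem_is_interval_1_I less_imp_le)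
    ultimately show "- (2 * \<bar>s - x0\<bar> powr (\<alpha> - 1) * measure M (space M)) \<le> ?F x0" by (intro lower)
  qed (rule s1)
  ultimately show ?thesis
    by (intro tendsto_upperbound[where F="at_right x0" and f="\<lambda>s. - (2 * \<bar>s - x0\<bar> powr (\<alpha> - 1) * measure M (space M))"]) auto
qed

text \<open>Replacing a minimizer \<open>m\<close> off the geodesic by its projection would decrease every distance to \<open>Y\<close>
  strictly. On the geodesic the problem is one-dimensional, and the score is both nonnegative and, after
  reflection, nonpositive. Finite measures are admitted so that the counting measure on sample indices,
  and with it the empirical mean, is an instance.\<close>

theorem frechet_mean_on_geodesic:
  fixes Y :: "'w \<Rightarrow> 'a::hadamard_space" and h :: "'a \<Rightarrow> real"
  assumes "finite_measure M" and nz: "emeasure M (space M) \<noteq> 0" and \<alpha>: "1 < \<alpha>" "\<alpha> \<le> 2"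
    and [measurable]: "Y \<in> borel_measurable M"
    and p: "integrable M (\<lambda>\<omega>. dist (Y \<omega>) p powr (\<alpha> - 1))"
    and \<gamma>: "unit_speed_geodesic J \<gamma>" and J: "closed J"
    and h: "continuous_on UNIV h" "\<And>s. s \<in> J \<Longrightarrow> h (\<gamma> s) = s"
    and Y: "AE \<omega> in M. Y \<omega> \<in> \<gamma> ` J"
    and m: "is_frechet_mean \<alpha> M Y p m"
  shows "h m \<in> J" "\<gamma> (h m) = m"
    and "(\<integral>\<omega>. spow (\<alpha> - 1) (h m - h (Y \<omega>)) \<partial>M) = 0"
proof -
  interpret finite_measure M by fact
  have [measurable]: "h \<in> borel_measurable borel"
    using h(1) by (rule borel_measurable_continuous_onI)
  have [measurable]: "(\<lambda>\<omega>. dist (Y \<omega>) q) \<in> borel_measurable M" for q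
    by (rule measurable_compose[OF _ borel_measurable_continuous_onI]) (auto intro!: continuous_intros)
  define f where "f q = (\<integral>\<omega>. dist (Y \<omega>) q powr \<alpha> - dist (Y \<omega>) p powr \<alpha> \<partial>M)" for q
  have f_min: "f m \<le> f q" for q
    using m by (auto simp: is_frechet_mean_def is_arg_min_def f_def not_less)
  have int1: "integrable M (\<lambda>\<omega>. dist (Y \<omega>) q powr (\<alpha> - 1))" for q
  proof (rule Bochner_Integration.integrable_bound)
    show "integrable M (\<lambda>\<omega>. dist (Y \<omega>) p powr (\<alpha> - 1) + dist p q powr (\<alpha> - 1))" using p by simp
    show "AE \<omega> in M. norm (dist (Y \<omega>) q powr (\<alpha> - 1)) \<le> norm (dist (Y \<omega>) p powr (\<alpha> - 1) + dist p q powr (\<alpha> - 1))"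
    proof (rule AE_I2)
      fix \<omega>
      have "dist (Y \<omega>) q powr (\<alpha> - 1) \<le> (dist (Y \<omega>) p + dist p q) powr (\<alpha> - 1)"
        using \<alpha> by (intro powr_mono2 dist_triangle) auto
      also have "\<dots> \<le> dist (Y \<omega>) p powr (\<alpha> - 1) + dist p q powr (\<alpha> - 1)"
        using \<alpha> by (intro powr_subadditive) auto
      finally show "norm (dist (Y \<omega>) q powr (\<alpha> - 1)) \<le> norm (dist (Y \<omega>) p powr (\<alpha> - 1) + dist p q powr (\<alpha> - 1))"
        by simp
    qed
  qed simp
  have int2: "integrable M (\<lambda>\<omega>. dist (Y \<omega>) q powr \<alpha> - dist (Y \<omega>) q' powr \<alpha>)" for q q'
  proof (rule Bochner_Integration.integrable_bound)
    show "integrable M (\<lambda>\<omega>. \<alpha> * dist q q' * (dist (Y \<omega>) q powr (\<alpha> - 1) + dist (Y \<omega>) q' powr (\<alpha> - 1)))"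
      using int1 by simp
    show "AE \<omega> in M. norm (dist (Y \<omega>) q powr \<alpha> - dist (Y \<omega>) q' powr \<alpha>)
      \<le> norm (\<alpha> * dist q q' * (dist (Y \<omega>) q powr (\<alpha> - 1) + dist (Y \<omega>) q' powr (\<alpha> - 1)))"
    proof (rule AE_I2)
      fix \<omega>
      have "\<bar>dist (Y \<omega>) q powr \<alpha> - dist (Y \<omega>) q' powr \<alpha>\<bar>
        \<le> \<alpha> * \<bar>dist (Y \<omega>) q - dist (Y \<omega>) q'\<bar> * (dist (Y \<omega>) q powr (\<alpha> - 1) + dist (Y \<omega>) q' powr (\<alpha> - 1))"
        using \<alpha> by (intro powr_diff_bound) auto
      also have "\<dots> \<le> \<alpha> * dist q q' * (dist (Y \<omega>) q powr (\<alpha> - 1) + dist (Y \<omega>) q' powr (\<alpha> - 1))"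
        using \<alpha> abs_dist_diff_le[of q "Y \<omega>" q'] by (intro mult_right_mono mult_left_mono) (auto simp: dist_commute)
      finally show "norm (dist (Y \<omega>) q powr \<alpha> - dist (Y \<omega>) q' powr \<alpha>)
        \<le> norm (\<alpha> * dist q q' * (dist (Y \<omega>) q powr (\<alpha> - 1) + dist (Y \<omega>) q' powr (\<alpha> - 1)))"
        using \<alpha> by simp
    qed
  qed simp
  have f_diff: "f q - f q' = (\<integral>\<omega>. dist (Y \<omega>) q powr \<alpha> - dist (Y \<omega>) q' powr \<alpha> \<partial>M)" for q q'
    unfolding f_def by (subst Bochner_Integration.integral_diff[symmetric]) (use int2 in auto)
  have "J \<noteq> {}"
  proof
    assume "J = {}"
    then have "AE \<omega> in M. False" using Y by simp
    then show False using nz by (simp add: eventually_False ae_filter_eq_bot_iff)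
  qed
  then obtain s0 where s0: "s0 \<in> J" "\<And>s. s \<in> J \<Longrightarrow> (dist m (\<gamma> s0))\<^sup>2 + (s - s0)\<^sup>2 \<le> (dist m (\<gamma> s))\<^sup>2"
    using geodesic_projection[OF \<gamma> J] by metis
  have d: "dist (\<gamma> x) (\<gamma> y) = \<bar>x - y\<bar>" if "x \<in> J" "y \<in> J" for x y
    using \<gamma> that by (simp add: unit_speed_geodesic_def)
  have m_eq: "\<gamma> s0 = m"
  proof (rule ccontr)
    assume ne: "\<gamma> s0 \<noteq> m"
    have "AE \<omega> in M. dist (Y \<omega>) (\<gamma> s0) powr \<alpha> - dist (Y \<omega>) m powr \<alpha> < 0"
      using Y
    proof eventually_elim
      case (elim \<omega>)
      then obtain s where s: "s \<in> J" "Y \<omega> = \<gamma> s" by blast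
      have "0 < (dist m (\<gamma> s0))\<^sup>2" using ne by simp
      then have "(s - s0)\<^sup>2 < (dist m (\<gamma> s))\<^sup>2"
        using s0(2)[OF s(1)] by linarith
      moreover have "(dist (Y \<omega>) (\<gamma> s0))\<^sup>2 = (s - s0)\<^sup>2" "dist (Y \<omega>) m = dist m (\<gamma> s)"
        using s s0(1) by (simp_all add: d dist_commute power2_commute)
      ultimately have "(dist (Y \<omega>) (\<gamma> s0))\<^sup>2 < (dist (Y \<omega>) m)\<^sup>2"
        by metis
      then have "dist (Y \<omega>) (\<gamma> s0) < dist (Y \<omega>) m" by (rule power_less_imp_less_base) simp
      then show ?case using \<alpha> by (simp add: powr_less_mono2)
    qed
    then have "(\<integral>\<omega>. dist (Y \<omega>) (\<gamma> s0) powr \<alpha> - dist (Y \<omega>) m powr \<alpha> \<partial>M) < (\<integral>\<omega>. 0 \<partial>M)"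
      using int2 nz by (intro integral_less_AE_space) auto
    then show False using f_diff[of "\<gamma> s0" m] f_min[of "\<gamma> s0"] by simp
  qed
  then have hm: "h m = s0" using h(2)[OF s0(1)] by simp
  then show hJ: "h m \<in> J" and m_eq': "\<gamma> (h m) = m" using s0(1) m_eq by auto
  have hY: "AE \<omega> in M. h (Y \<omega>) \<in> J \<and> (\<forall>s\<in>J. dist (Y \<omega>) (\<gamma> s) = \<bar>s - h (Y \<omega>)\<bar>)"
    using Y by eventually_elim (auto simp: h(2) d abs_minus_commute)
  have int3: "integrable M (\<lambda>\<omega>. spow (\<alpha> - 1) (s - h (Y \<omega>)))" if "s \<in> J" for s
  proof (rule Bochner_Integration.integrable_bound[OF int1[of "\<gamma> s"]])
    show "AE \<omega> in M. norm (spow (\<alpha> - 1) (s - h (Y \<omega>))) \<le> norm (dist (Y \<omega>) (\<gamma> s) powr (\<alpha> - 1))"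
      using hY by eventually_elim (use that in \<open>simp add: abs_spow\<close>)
  qed simp
  have eq4: "AE \<omega> in M. dist (Y \<omega>) (\<gamma> s) powr \<alpha> - dist (Y \<omega>) m powr \<alpha>
      = \<bar>s - h (Y \<omega>)\<bar> powr \<alpha> - \<bar>h m - h (Y \<omega>)\<bar> powr \<alpha>" if "s \<in> J" for s
    using hY
  proof eventually_elim
    case (elim \<omega>)
    then have "dist (Y \<omega>) (\<gamma> (h m)) = \<bar>h m - h (Y \<omega>)\<bar>" using hJ by blast
    then show ?case using elim that m_eq' by simp
  qed
  have int4: "integrable M (\<lambda>\<omega>. \<bar>s - h (Y \<omega>)\<bar> powr \<alpha> - \<bar>h m - h (Y \<omega>)\<bar> powr \<alpha>)" if "s \<in> J" for s
    using int2[of "\<gamma> s" m] by (rule integrable_cong_AE_imp) (use eq4[OF that] in auto)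
  have min4: "0 \<le> (\<integral>\<omega>. \<bar>s - h (Y \<omega>)\<bar> powr \<alpha> - \<bar>h m - h (Y \<omega>)\<bar> powr \<alpha> \<partial>M)" if "s \<in> J" for s
  proof -
    have "f (\<gamma> s) - f m = (\<integral>\<omega>. \<bar>s - h (Y \<omega>)\<bar> powr \<alpha> - \<bar>h m - h (Y \<omega>)\<bar> powr \<alpha> \<partial>M)"
      unfolding f_diff by (rule integral_cong_AE) (use eq4[OF that] in auto)
    then show ?thesis using f_min[of "\<gamma> s"] by simp
  qed
  have conv: "convex J" using \<gamma> by (simp add: unit_speed_geodesic_def)
  have "0 \<le> (\<integral>\<omega>. spow (\<alpha> - 1) (h m - h (Y \<omega>)) \<partial>M)"
    using hY by (intro score_nonneg[of M \<alpha> _ J]) (auto intro: finite_measure_axioms \<alpha> conv hJ int3 int4 min4)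
  moreover have "0 \<le> (\<integral>\<omega>. spow (\<alpha> - 1) (- h m - (- h (Y \<omega>))) \<partial>M)"
  proof (rule score_nonneg[of M \<alpha> _ "uminus ` J"])
    have flip: "\<bar>- s - - x\<bar> = \<bar>s - x\<bar>" "spow (\<alpha> - 1) (- s - - x) = - spow (\<alpha> - 1) (s - x)" for s x
      using spow_minus[of "\<alpha> - 1" "s - x"] by simp_all
    fix s assume "s \<in> uminus ` J"
    then obtain r where r: "s = - r" "r \<in> J" by blast
    show "integrable M (\<lambda>\<omega>. spow (\<alpha> - 1) (s - - h (Y \<omega>)))"
      using int3[OF r(2)] unfolding r flip by simp
    show "integrable M (\<lambda>\<omega>. \<bar>s - - h (Y \<omega>)\<bar> powr \<alpha> - \<bar>- h m - - h (Y \<omega>)\<bar> powr \<alpha>)"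
      using int4[OF r(2)] unfolding r flip .
    show "0 \<le> (\<integral>\<omega>. \<bar>s - - h (Y \<omega>)\<bar> powr \<alpha> - \<bar>- h m - - h (Y \<omega>)\<bar> powr \<alpha> \<partial>M)"
      using min4[OF r(2)] unfolding r flip .
  next
    show "convex (uminus ` J)" using convex_scaling[OF conv, of "-1"] by simp
    show "AE \<omega> in M. - h (Y \<omega>) \<in> uminus ` J" using hY by eventually_elim auto
  qed (use \<alpha> hJ finite_measure_axioms in auto)
  moreover have "(\<integral>\<omega>. spow (\<alpha> - 1) (- h m - (- h (Y \<omega>))) \<partial>M) = - (\<integral>\<omega>. spow (\<alpha> - 1) (h m - h (Y \<omega>)) \<partial>M)"
    using spow_minus[of "\<alpha> - 1" "h m - h (Y _)"] by (simp flip: integral_minus)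
  ultimately show "(\<integral>\<omega>. spow (\<alpha> - 1) (h m - h (Y \<omega>)) \<partial>M) = 0" by simp
qed

section \<open>Normal approximation of the root of the empirical score\<close>

lemma real_distribution_normal_law: "0 < v \<Longrightarrow> real_distribution (normal_law 0 v)"
proof -
  assume "0 < v"
  then have "prob_space (normal_law 0 v)"
    unfolding normal_law_def by (intro prob_space_normal_density) simp
  then show ?thesis
    by (auto simp: real_distribution_def real_distribution_axioms_def normal_law_def)
qed

lemma normal_law_scale:
  assumes "0 < v" "0 < c"
  shows "distr (normal_law 0 v) borel (\<lambda>x. c * x) = normal_law 0 (c\<^sup>2 * v)"
proof -
  interpret real_distribution "normal_law 0 v"
    by (rule real_distribution_normal_law) fact
  have "distributed (normal_law 0 v) lborel (\<lambda>x. x) (normal_density 0 (sqrt v))"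
    unfolding distributed_def
    by (auto simp: normal_law_def distr_id2 sets_eq_imp_space_eq)
  then have "distributed (normal_law 0 v) lborel (\<lambda>x. 0 + c * x) (normal_density (0 + c * 0) (\<bar>c\<bar> * sqrt v))"
    using assms by (intro normal_density_affine) auto
  then have "distr (normal_law 0 v) lborel (\<lambda>x. c * x) = normal_law 0 (c\<^sup>2 * v)"
    using assms by (simp add: distributed_def normal_law_def real_sqrt_mult)
  moreover have "distr (normal_law 0 v) lborel (\<lambda>x. c * x) = distr (normal_law 0 v) borel (\<lambda>x. c * x)"
    by (rule distr_cong) auto
  ultimately show ?thesis by simp
qed

lemma measure_normal_law_singleton: "measure (normal_law 0 v) {x} = 0"
proof -
  have "{x} \<in> null_sets lborel" by (simp add: null_sets_def)
  then have "{x} \<in> null_sets (normal_law 0 v)"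
    unfolding normal_law_def
    using absolutely_continuousI_density[of "\<lambda>x. ennreal (normal_density 0 (sqrt v) x)" lborel]
    by (auto simp: absolutely_continuous_def)
  then show ?thesis by (simp add: measure_def null_sets_def)
qed

text \<open>Outside the event \<open>|R| \<ge> \<delta>\<close> the event in question is squeezed between \<open>U \<le> L - \<delta>\<close> and
  \<open>U \<le> L + \<delta>\<close>.\<close>

lemma (in prob_space) slutsky_cdf:
  fixes U R :: "nat \<Rightarrow> 'a \<Rightarrow> real" and F :: "real \<Rightarrow> real"
  assumes [measurable]: "\<And>n. U n \<in> borel_measurable M" "\<And>n. R n \<in> borel_measurable M"
    and U: "\<And>x. (\<lambda>n. prob {\<omega> \<in> space M. U n \<omega> \<le> x}) \<longlonglongrightarrow> F x"
    and R: "\<And>\<delta>. 0 < \<delta> \<Longrightarrow> (\<lambda>n. prob {\<omega> \<in> space M. \<delta> \<le> \<bar>R n \<omega>\<bar>}) \<longlonglongrightarrow> 0"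
    and F: "isCont F L"
  shows "(\<lambda>n. prob {\<omega> \<in> space M. U n \<omega> \<le> L + R n \<omega>}) \<longlonglongrightarrow> F L"
proof (rule LIMSEQ_I)
  fix e :: real assume "0 < e"
  have "\<exists>d>0. \<forall>x. dist x L < d \<longrightarrow> dist (F x) (F L) < e / 3"
    using F[unfolded continuous_at_eps_delta, rule_format, of "e / 3"] \<open>0 < e\<close> by simp
  then obtain d where d: "0 < d" "\<And>x. \<bar>x - L\<bar> < d \<Longrightarrow> \<bar>F x - F L\<bar> < e / 3"
    by (auto simp: dist_real_def)
  define \<delta> where "\<delta> = d / 2"
  have \<delta>: "0 < \<delta>" "\<bar>F (L + \<delta>) - F L\<bar> < e / 3" "\<bar>F (L - \<delta>) - F L\<bar> < e / 3"
    using d by (auto simp: \<delta>_def)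
  let ?P = "\<lambda>n x. prob {\<omega> \<in> space M. U n \<omega> \<le> x}"
  let ?Q = "\<lambda>n. prob {\<omega> \<in> space M. \<delta> \<le> \<bar>R n \<omega>\<bar>}"
  let ?S = "\<lambda>n. prob {\<omega> \<in> space M. U n \<omega> \<le> L + R n \<omega>}"
  have up: "?S n \<le> ?P n (L + \<delta>) + ?Q n" for n
  proof -
    have "?S n \<le> prob ({\<omega> \<in> space M. U n \<omega> \<le> L + \<delta>} \<union> {\<omega> \<in> space M. \<delta> \<le> \<bar>R n \<omega>\<bar>})"
      by (intro finite_measure_mono) auto
    also have "\<dots> \<le> ?P n (L + \<delta>) + ?Q n" by (intro measure_Un_le) auto
    finally show ?thesis .
  qed
  have lo: "?P n (L - \<delta>) \<le> ?S n + ?Q n" for n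
  proof -
    have "?P n (L - \<delta>) \<le> prob ({\<omega> \<in> space M. U n \<omega> \<le> L + R n \<omega>} \<union> {\<omega> \<in> space M. \<delta> \<le> \<bar>R n \<omega>\<bar>})"
      by (intro finite_measure_mono) auto
    also have "\<dots> \<le> ?S n + ?Q n" by (intro measure_Un_le) auto
    finally show ?thesis .
  qed
  have "eventually (\<lambda>n. \<bar>?P n (L + \<delta>) - F (L + \<delta>)\<bar> < e / 3) sequentially"
       "eventually (\<lambda>n. \<bar>?P n (L - \<delta>) - F (L - \<delta>)\<bar> < e / 3) sequentially"
       "eventually (\<lambda>n. \<bar>?Q n - 0\<bar> < e / 3) sequentially"
    using \<open>0 < e\<close> U[THEN tendstoD, of "e/3"] R[OF \<delta>(1), THEN tendstoD, of "e/3"]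
    by (auto simp: dist_real_def)
  then have "eventually (\<lambda>n. norm (?S n - F L) < e) sequentially"
  proof eventually_elim
    case (elim n)
    then show ?case using up[of n] lo[of n] \<delta> unfolding real_norm_def by linarith
  qed
  then show "\<exists>no. \<forall>n\<ge>no. norm (?S n - F L) < e"
    by (simp add: eventually_sequentially)
qed

text \<open>Independent centred variables are orthogonal.\<close>

lemma (in prob_space) expectation_sum_indep_power2:
  fixes D :: "nat \<Rightarrow> 'a \<Rightarrow> real"
  assumes ind: "indep_vars (\<lambda>_. borel) D UNIV"
    and sq: "\<And>j. integrable M (\<lambda>\<omega>. (D j \<omega>)\<^sup>2)"
    and mean: "\<And>j. expectation (D j) = 0"
  shows "integrable M (\<lambda>\<omega>. (\<Sum>j<n. D j \<omega>)\<^sup>2)"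
    and "expectation (\<lambda>\<omega>. (\<Sum>j<n. D j \<omega>)\<^sup>2) = (\<Sum>j<n. expectation (\<lambda>\<omega>. (D j \<omega>)\<^sup>2))"
proof -
  have [measurable]: "D j \<in> borel_measurable M" for j
    using ind unfolding indep_vars_def2 by simp
  have int: "integrable M (D j)" for j
    by (rule square_integrable_imp_integrable[OF _ sq]) simp
  have prod: "integrable M (\<lambda>\<omega>. D i \<omega> * D j \<omega>) \<and> expectation (\<lambda>\<omega>. D i \<omega> * D j \<omega>) = 0" if "i \<noteq> j" for i j
  proof -
    have "indep_vars (\<lambda>_. borel) D {i, j}"
      using ind by (rule indep_vars_subset) simp
    then show ?thesis
      using indep_vars_integrable[of "{i, j}" D] indep_vars_lebesgue_integral[of "{i, j}" D] int mean that
      by simp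
  qed
  have eq: "(\<Sum>j<n. D j \<omega>)\<^sup>2 = (\<Sum>i<n. \<Sum>j<n. D i \<omega> * D j \<omega>)" for \<omega>
    by (simp add: power2_eq_square sum_product)
  have int2: "integrable M (\<lambda>\<omega>. D i \<omega> * D j \<omega>)" for i j
    using prod[of i j] sq[of i] by (cases "i = j") (auto simp: power2_eq_square)
  show "integrable M (\<lambda>\<omega>. (\<Sum>j<n. D j \<omega>)\<^sup>2)"
    unfolding eq using int2 by auto
  have "expectation (\<lambda>\<omega>. (\<Sum>j<n. D j \<omega>)\<^sup>2) = (\<Sum>i<n. \<Sum>j<n. expectation (\<lambda>\<omega>. D i \<omega> * D j \<omega>))"
    unfolding eq using int2 by (simp add: Bochner_Integration.integral_sum)
  also have "\<dots> = (\<Sum>i<n. \<Sum>j<n. if i = j then expectation (\<lambda>\<omega>. (D i \<omega>)\<^sup>2) else 0)"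
    using prod by (intro sum.cong) (auto simp: power2_eq_square)
  also have "\<dots> = (\<Sum>i<n. expectation (\<lambda>\<omega>. (D i \<omega>)\<^sup>2))"
    by (intro sum.cong) (auto simp: sum.delta)
  finally show "expectation (\<lambda>\<omega>. (\<Sum>j<n. D j \<omega>)\<^sup>2) = (\<Sum>j<n. expectation (\<lambda>\<omega>. (D j \<omega>)\<^sup>2))" .
qed

text \<open>The central limit theorem without standardization. Normal laws have no atoms, so the distribution
  functions converge everywhere.\<close>

lemma cdf_tendsto_normal_law:
  fixes X :: "nat \<Rightarrow> 'a \<Rightarrow> real"
  assumes "prob_space M" "prob_space.indep_vars M (\<lambda>_. borel) X UNIV"
    and mean: "\<And>j. integral\<^sup>L M (X j) = 0"
    and sq: "\<And>j. integrable M (\<lambda>\<omega>. (X j \<omega>)\<^sup>2)" "\<And>j. (\<integral>\<omega>. (X j \<omega>)\<^sup>2 \<partial>M) = v" "0 < v"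
    and distr: "\<And>j. distr M borel (X j) = \<mu>"
  shows "(\<lambda>n. measure M {\<omega> \<in> space M. (\<Sum>j<n. X j \<omega>) / sqrt n \<le> x})
           \<longlonglongrightarrow> measure (normal_law 0 v) {..x}"
proof -
  interpret prob_space M by fact
  have [measurable]: "X j \<in> borel_measurable M" for j
    using assms(2) unfolding indep_vars_def2 by simp
  let ?Z = "\<lambda>n \<omega>. (\<Sum>j<n. X j \<omega>) / sqrt (n * (sqrt v)\<^sup>2)"
  have "weak_conv_m (\<lambda>n. distr M borel (?Z n)) std_normal_distribution"
    using assms by (intro central_limit_theorem_zero_mean[where \<mu>=\<mu>]) auto
  then have w: "weak_conv_m (\<lambda>n. distr M borel (?Z n)) (normal_law 0 1)"
    by (simp add: normal_law_def)
  interpret N: real_distribution "normal_law 0 1"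
    by (rule real_distribution_normal_law) simp
  have "(\<lambda>n. cdf (distr M borel (?Z n)) (x / sqrt v)) \<longlonglongrightarrow> cdf (normal_law 0 1) (x / sqrt v)"
    using w by (simp add: weak_conv_m_def weak_conv_def N.isCont_cdf measure_normal_law_singleton)
  moreover have "cdf (distr M borel (?Z n)) (x / sqrt v) = measure M {\<omega> \<in> space M. (\<Sum>j<n. X j \<omega>) / sqrt n \<le> x}" for n
  proof -
    have "?Z n -` {..x / sqrt v} \<inter> space M = {\<omega> \<in> space M. (\<Sum>j<n. X j \<omega>) / sqrt n \<le> x}"
      using \<open>0 < v\<close> by (auto simp: real_sqrt_mult divide_simps)
    then show ?thesis by (simp add: cdf_def measure_distr)
  qed
  moreover have "cdf (normal_law 0 1) (x / sqrt v) = measure (normal_law 0 v) {..x}"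
  proof -
    have "measure (normal_law 0 v) {..x} = measure (distr (normal_law 0 1) borel (\<lambda>x. sqrt v * x)) {..x}"
      using normal_law_scale[of 1 "sqrt v"] \<open>0 < v\<close> by simp
    also have "\<dots> = measure (normal_law 0 1) ((\<lambda>x. sqrt v * x) -` {..x} \<inter> space (normal_law 0 1))"
      by (rule measure_distr) auto
    also have "(\<lambda>x. sqrt v * x) -` {..x} \<inter> space (normal_law 0 1) = {..x / sqrt v}"
      using \<open>0 < v\<close> by (auto simp: field_simps)
    finally show ?thesis by (simp add: cdf_def)
  qed
  ultimately show ?thesis by simp
qed

text \<open>Monotonicity of the score turns the event \<open>T\<^sub>n \<le> t\<^sub>n\<close> into one about a sum of independent variables.
  Centring \<open>\<psi>(t\<^sub>n - X\<^sub>j) + \<psi>(X\<^sub>j)\<close> leaves variables \<open>D\<close> of size \<open>O(|t\<^sub>n|\<^sup>a)\<close>; by Chebyshev's inequality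
  their normalized sum vanishes in the limit. Up to this error the event reads
  \<open>n\<^sup>-\<^sup>1\<^sup>/\<^sup>2 \<Sum>\<^sub>j \<psi>(X\<^sub>j) \<le> sqrt n f(t\<^sub>n)\<close>, where \<open>f\<close> is the mean score.\<close>

theorem score_crossing_limit:
  fixes X :: "nat \<Rightarrow> 'a \<Rightarrow> real" and T :: "nat \<Rightarrow> 'a \<Rightarrow> real"
  assumes "prob_space M" and a: "0 < a" "a \<le> 1"
    and ind: "prob_space.indep_vars M (\<lambda>_. borel) X UNIV"
    and distr: "\<And>j. distr M borel (X j) = distr M borel (X 0)"
    and sq: "integrable M (\<lambda>\<omega>. \<bar>X 0 \<omega>\<bar> powr (2 * a))"
    and mean: "(\<integral>\<omega>. spow a (X 0 \<omega>) \<partial>M) = 0"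
    and v: "(\<integral>\<omega>. \<bar>X 0 \<omega>\<bar> powr (2 * a) \<partial>M) = v" "0 < v"
    and [measurable]: "\<And>n. T n \<in> borel_measurable M"
    and T: "\<And>n. 1 \<le> n \<Longrightarrow> AE \<omega> in M. (\<Sum>j<n. spow a (T n \<omega> - X j \<omega>)) = 0"
    and t: "t \<longlonglongrightarrow> 0"
    and L: "(\<lambda>n. sqrt n * (\<integral>\<omega>. spow a (t n - X 0 \<omega>) \<partial>M)) \<longlonglongrightarrow> L"
  shows "(\<lambda>n. measure M {\<omega> \<in> space M. T n \<omega> \<le> t n}) \<longlonglongrightarrow> measure (normal_law 0 v) {..L}"
proof -
  interpret prob_space M by fact
  have [measurable]: "X j \<in> borel_measurable M" for j
    using ind unfolding indep_vars_def2 by simp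
  have transfer: "integrable M (\<lambda>\<omega>. \<phi> (X j \<omega>)) \<longleftrightarrow> integrable M (\<lambda>\<omega>. \<phi> (X 0 \<omega>))"
      "expectation (\<lambda>\<omega>. \<phi> (X j \<omega>)) = expectation (\<lambda>\<omega>. \<phi> (X 0 \<omega>))"
    if "\<phi> \<in> borel_measurable borel" for \<phi> :: "real \<Rightarrow> real" and j
    using integrable_distr_eq[of "X j" M borel \<phi>] integrable_distr_eq[of "X 0" M borel \<phi>]
      integral_distr[of "X j" M borel \<phi>] integral_distr[of "X 0" M borel \<phi>] distr[of j] that
    by simp_all
  define f where "f n = expectation (\<lambda>\<omega>. spow a (t n - X 0 \<omega>))" for n
  define D where "D n j \<omega> = spow a (t n - X j \<omega>) + spow a (X j \<omega>) - f n" for n j \<omega>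
  define U where "U n \<omega> = (\<Sum>j<n. spow a (X j \<omega>)) / sqrt n" for n \<omega>
  define R where "R n \<omega> = (\<Sum>j<n. D n j \<omega>) / sqrt n + (sqrt n * f n - L)" for n \<omega>
  have [measurable]: "D n j \<in> borel_measurable M" "U n \<in> borel_measurable M" "R n \<in> borel_measurable M" for n j
    unfolding D_def[abs_def] U_def[abs_def] R_def[abs_def] by measurable
  have sq': "integrable M (\<lambda>\<omega>. (spow a (X j \<omega>))\<^sup>2)" "expectation (\<lambda>\<omega>. (spow a (X j \<omega>))\<^sup>2) = v" for j
    using transfer[of "\<lambda>x. (spow a x)\<^sup>2" j] sq v by (simp_all add: spow_power2)
  have int: "integrable M (\<lambda>\<omega>. spow a (X j \<omega>))" for j
    by (rule square_integrable_imp_integrable[OF _ sq'(1)]) simp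
  have mean': "expectation (\<lambda>\<omega>. spow a (X j \<omega>)) = 0" for j
    using transfer[of "spow a" j] mean by simp
  have int_sum: "integrable M (\<lambda>\<omega>. spow a (s - X j \<omega>) + spow a (X j \<omega>))" for s j
    using spow_shift_bound[OF a]
    by (intro integrable_const_bound[where B="2 * \<bar>s\<bar> powr a"]) auto
  have int_t: "integrable M (\<lambda>\<omega>. spow a (s - X j \<omega>))" for s j
    using Bochner_Integration.integrable_diff[OF int_sum int, of s j j] by simp
  have f_eq: "f n = expectation (\<lambda>\<omega>. spow a (t n - X j \<omega>) + spow a (X j \<omega>))" for n j
    using int_t int mean' transfer(2)[of "\<lambda>x. spow a (t n - x)" j] by (simp add: f_def)
  have f_bound: "\<bar>f n\<bar> \<le> 2 * \<bar>t n\<bar> powr a" for n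
  proof -
    have "\<bar>f n\<bar> \<le> expectation (\<lambda>\<omega>. \<bar>spow a (t n - X 0 \<omega>) + spow a (X 0 \<omega>)\<bar>)"
      unfolding f_eq[of n 0] by (rule integral_abs_bound)
    also have "\<dots> \<le> expectation (\<lambda>\<omega>. 2 * \<bar>t n\<bar> powr a)"
      using spow_shift_bound[OF a] int_sum by (intro integral_mono) auto
    finally show ?thesis by (simp add: prob_space)
  qed
  have D_bound: "\<bar>D n j \<omega>\<bar> \<le> 4 * \<bar>t n\<bar> powr a" for n j \<omega>
    using spow_shift_bound[OF a, of "t n" "X j \<omega>"] f_bound[of n] unfolding D_def by linarith
  have D_sq_bound: "(D n j \<omega>)\<^sup>2 \<le> 16 * (\<bar>t n\<bar> powr a)\<^sup>2" for n j \<omega>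
    using power_mono[OF D_bound[of n j \<omega>], of 2] by (simp add: power_mult_distrib)
  have D_sq: "integrable M (\<lambda>\<omega>. (D n j \<omega>)\<^sup>2)" for n j
    using D_sq_bound by (intro integrable_const_bound[where B="16 * (\<bar>t n\<bar> powr a)\<^sup>2"]) auto
  have D_mean: "expectation (D n j) = 0" for n j
    using f_eq[of n j] int_sum[of "t n" j] by (simp add: D_def[abs_def] prob_space)
  have D_ind: "indep_vars (\<lambda>_. borel) (D n) UNIV" for n
    using indep_vars_compose2[OF ind, of "\<lambda>_ x. spow a (t n - x) + spow a x - f n" "\<lambda>_. borel"]
    by (simp add: D_def[abs_def])
  have tail: "prob {\<omega> \<in> space M. \<delta> \<le> \<bar>(\<Sum>j<n. D n j \<omega>) / sqrt n\<bar>} \<le> 16 * (\<bar>t n\<bar> powr a)\<^sup>2 / \<delta>\<^sup>2"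
    if "0 < \<delta>" "0 < n" for \<delta> n
  proof -
    note S = expectation_sum_indep_power2[OF D_ind D_sq D_mean, of n n]
    have i: "integrable M (\<lambda>\<omega>. ((\<Sum>j<n. D n j \<omega>) / sqrt n)\<^sup>2)"
      using S(1) by (simp add: power_divide)
    have "expectation (\<lambda>\<omega>. ((\<Sum>j<n. D n j \<omega>) / sqrt n)\<^sup>2) = (\<Sum>j<n. expectation (\<lambda>\<omega>. (D n j \<omega>)\<^sup>2)) / n"
      using S by (simp add: power_divide)
    also have "\<dots> \<le> (\<Sum>j<n. 16 * (\<bar>t n\<bar> powr a)\<^sup>2) / n"
    proof (intro divide_right_mono sum_mono)
      fix j
      have "expectation (\<lambda>\<omega>. (D n j \<omega>)\<^sup>2) \<le> expectation (\<lambda>\<omega>. 16 * (\<bar>t n\<bar> powr a)\<^sup>2)"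
        using D_sq D_sq_bound by (intro integral_mono) auto
      then show "expectation (\<lambda>\<omega>. (D n j \<omega>)\<^sup>2) \<le> 16 * (\<bar>t n\<bar> powr a)\<^sup>2"
        by (simp add: prob_space)
    qed simp
    also have "\<dots> = 16 * (\<bar>t n\<bar> powr a)\<^sup>2" using that by simp
    finally have le: "expectation (\<lambda>\<omega>. ((\<Sum>j<n. D n j \<omega>) / sqrt n)\<^sup>2) \<le> 16 * (\<bar>t n\<bar> powr a)\<^sup>2" .
    have "prob {\<omega> \<in> space M. \<delta> \<le> \<bar>(\<Sum>j<n. D n j \<omega>) / sqrt n\<bar>}
        \<le> expectation (\<lambda>\<omega>. ((\<Sum>j<n. D n j \<omega>) / sqrt n)\<^sup>2) / \<delta>\<^sup>2"
      using i that(1) by (intro second_moment_method) auto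
    also have "\<dots> \<le> 16 * (\<bar>t n\<bar> powr a)\<^sup>2 / \<delta>\<^sup>2"
      using le by (intro divide_right_mono) auto
    finally show ?thesis .
  qed
  have lim0: "(\<lambda>n. 16 * (\<bar>t n\<bar> powr a)\<^sup>2 / \<delta>\<^sup>2) \<longlonglongrightarrow> 0" for \<delta>
  proof -
    have "(\<lambda>n. \<bar>t n\<bar> powr a) \<longlonglongrightarrow> \<bar>0\<bar> powr a"
      using t a by (intro tendsto_powr' tendsto_intros) auto
    then have "(\<lambda>n. (16 / \<delta>\<^sup>2) * (\<bar>t n\<bar> powr a)\<^sup>2) \<longlonglongrightarrow> (16 / \<delta>\<^sup>2) * (\<bar>0\<bar> powr a)\<^sup>2"
      by (rule tendsto_mult[OF tendsto_const tendsto_power])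
    then show ?thesis by simp
  qed
  have R0: "(\<lambda>n. prob {\<omega> \<in> space M. \<delta> \<le> \<bar>R n \<omega>\<bar>}) \<longlonglongrightarrow> 0" if "0 < \<delta>" for \<delta>
  proof (rule tendsto_sandwich)
    have "eventually (\<lambda>n. \<bar>sqrt n * f n - L\<bar> < \<delta> / 2) sequentially"
      using L[THEN tendstoD, of "\<delta> / 2"] that by (simp add: f_def dist_real_def)
    then show "eventually (\<lambda>n. prob {\<omega> \<in> space M. \<delta> \<le> \<bar>R n \<omega>\<bar>} \<le> 16 * (\<bar>t n\<bar> powr a)\<^sup>2 / (\<delta> / 2)\<^sup>2) sequentially"
      using eventually_gt_at_top[of 0]
    proof eventually_elim
      case (elim n)
      have "prob {\<omega> \<in> space M. \<delta> \<le> \<bar>R n \<omega>\<bar>} \<le> prob {\<omega> \<in> space M. \<delta> / 2 \<le> \<bar>(\<Sum>j<n. D n j \<omega>) / sqrt n\<bar>}"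
      proof (intro finite_measure_mono subsetI CollectI conjI; clarify?)
        fix \<omega> assume "\<omega> \<in> space M" "\<delta> \<le> \<bar>R n \<omega>\<bar>"
        then show "\<delta> / 2 \<le> \<bar>(\<Sum>j<n. D n j \<omega>) / sqrt n\<bar>"
          using elim(1) unfolding R_def by linarith
      qed auto
      also have "\<dots> \<le> 16 * (\<bar>t n\<bar> powr a)\<^sup>2 / (\<delta> / 2)\<^sup>2"
        using that elim by (intro tail) auto
      finally show ?case .
    qed
  qed (use lim0 in auto)
  interpret N: real_distribution "normal_law 0 v"
    by (rule real_distribution_normal_law) fact
  have "(\<lambda>n. prob {\<omega> \<in> space M. U n \<omega> \<le> L + R n \<omega>}) \<longlonglongrightarrow> cdf (normal_law 0 v) L"
  proof (rule slutsky_cdf[OF _ _ _ R0])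
    have d: "distr M borel (\<lambda>\<omega>. spow a (X j \<omega>)) = distr (distr M borel (X 0)) borel (spow a)" for j
      unfolding distr[of j, symmetric] by (subst distr_distr) (auto simp: comp_def)
    have i: "indep_vars (\<lambda>_. borel) (\<lambda>j \<omega>. spow a (X j \<omega>)) UNIV"
      using indep_vars_compose2[OF ind, of "\<lambda>_. spow a" "\<lambda>_. borel"] by simp
    show "(\<lambda>n. prob {\<omega> \<in> space M. U n \<omega> \<le> x}) \<longlonglongrightarrow> cdf (normal_law 0 v) x" for x
      unfolding cdf_def U_def
      by (rule cdf_tendsto_normal_law[OF prob_space_axioms i mean' sq' v(2) d])
  qed (auto simp: N.isCont_cdf measure_normal_law_singleton)
  moreover have "eventually (\<lambda>n. prob {\<omega> \<in> space M. U n \<omega> \<le> L + R n \<omega>} = prob {\<omega> \<in> space M. T n \<omega> \<le> t n}) sequentially"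
    using eventually_ge_at_top[of 1]
  proof eventually_elim
    case (elim n)
    then have n: "0 < sqrt (real n)" "sqrt (real n) * sqrt (real n) = n" by auto
    show ?case
    proof (rule measure_eq_AE)
      show "AE \<omega> in M. (\<omega> \<in> {\<omega> \<in> space M. U n \<omega> \<le> L + R n \<omega>}) = (\<omega> \<in> {\<omega> \<in> space M. T n \<omega> \<le> t n})"
        using T[OF elim] AE_space
      proof eventually_elim
        case (elim \<omega>)
        let ?S = "\<lambda>s. \<Sum>j<n. spow a (s - X j \<omega>)"
        have mono: "?S s < ?S s'" if "s < s'" for s s'
          using that \<open>1 \<le> n\<close> strict_monoD[OF strict_mono_spow[OF a(1)]]
          by (intro sum_strict_mono) (auto simp: lessThan_empty_iff)
        have "T n \<omega> \<le> t n \<longleftrightarrow> 0 \<le> ?S (t n)"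
          using mono[of "T n \<omega>" "t n"] mono[of "t n" "T n \<omega>"] elim(1)
          by (cases "T n \<omega>" "t n" rule: linorder_cases) auto
        also have "?S (t n) = (\<Sum>j<n. D n j \<omega>) + n * f n - (\<Sum>j<n. spow a (X j \<omega>))"
          by (simp add: D_def sum.distrib sum_subtractf)
        also have "0 \<le> \<dots> \<longleftrightarrow> (\<Sum>j<n. spow a (X j \<omega>)) / sqrt n \<le> ((\<Sum>j<n. D n j \<omega>) + n * f n) / sqrt n"
          using n(1) by (simp add: divide_le_cancel)
        also have "((\<Sum>j<n. D n j \<omega>) + n * f n) / sqrt n = L + R n \<omega>"
          using n by (simp add: R_def add_divide_distrib) (simp add: field_simps)
        finally show ?case using elim(2) by (simp add: U_def)
      qed
    qed auto
  qed
  ultimately show ?thesis unfolding cdf_def by (rule Lim_transform_eventually)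
qed

section \<open>Scaling limits and lower semi-continuous functionals\<close>

text \<open>Composition with the absolute value moves lower semi-continuity from the half-line to the whole line,
  where the open superlevel sets also give measurability.\<close>

lemma lower_semicontinuous_abs:
  assumes "lower_semicontinuous_on {0..} g" "c < g \<bar>x\<bar>"
  shows "\<exists>d>0. \<forall>y. dist y x < d \<longrightarrow> c < g \<bar>y\<bar>"
proof -
  obtain d where d: "0 < d" "\<And>y. 0 \<le> y \<Longrightarrow> y \<noteq> \<bar>x\<bar> \<Longrightarrow> dist y \<bar>x\<bar> < d \<Longrightarrow> c < g y"
    using assms unfolding lower_semicontinuous_on_def eventually_at
    by (metis abs_ge_zero atLeast_iff)
  have "c < g \<bar>y\<bar>" if "dist y x < d" for y
    using that d(2)[of "\<bar>y\<bar>"] assms(2) by (cases "\<bar>y\<bar> = \<bar>x\<bar>") (auto simp: dist_real_def)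
  then show ?thesis using d(1) by blast
qed

lemma lower_semicontinuous_abs_measurable:
  assumes "lower_semicontinuous_on {0..} g"
  shows "(\<lambda>x. g \<bar>x\<bar>) \<in> borel_measurable borel"
proof (unfold borel_measurable_iff_greater, intro allI)
  fix c
  have "open {x. c < g \<bar>x\<bar>}"
    using lower_semicontinuous_abs[OF assms] by (auto simp: open_dist)
  then show "{x \<in> space borel. c < g \<bar>x\<bar>} \<in> sets borel" by simp
qed

text \<open>One implication of the portmanteau theorem: Skorohod's representation turns weak convergence into
  pointwise convergence, to which lower semi-continuity and Fatou's lemma apply.\<close>

lemma weak_conv_liminf_lower_semicontinuous:
  assumes "weak_conv_m \<mu> \<nu>" "\<And>n. real_distribution (\<mu> n)" "real_distribution \<nu>"
    and g: "lower_semicontinuous_on {0..} g"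
  shows "(\<integral>\<^sup>+x. ennreal (g \<bar>x\<bar>) \<partial>\<nu>) \<le> liminf (\<lambda>n. \<integral>\<^sup>+x. ennreal (g \<bar>x\<bar>) \<partial>\<mu> n)"
proof -
  note [measurable] = lower_semicontinuous_abs_measurable[OF g]
  obtain \<Omega> :: "real measure" and Y V where
    Y': "\<forall>n. Y n \<in> borel_measurable \<Omega>" "\<forall>n. distr \<Omega> borel (Y n) = \<mu> n"
    and V': "V \<in> measurable \<Omega> lborel" and V: "distr \<Omega> borel V = \<nu>"
    and lim: "\<forall>x\<in>space \<Omega>. (\<lambda>n. Y n x) \<longlonglongrightarrow> V x"
    using Skorohod[OF assms(2,3,1)] by blast
  have [measurable]: "Y n \<in> borel_measurable \<Omega>" "V \<in> borel_measurable \<Omega>" and Y: "distr \<Omega> borel (Y n) = \<mu> n" for n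
    using Y' V' by auto
  have pointwise: "ennreal (g \<bar>V x\<bar>) \<le> liminf (\<lambda>n. ennreal (g \<bar>Y n x\<bar>))" if x: "x \<in> space \<Omega>" for x
    unfolding le_Liminf_iff
  proof (intro allI impI)
    fix y assume y: "y < ennreal (g \<bar>V x\<bar>)"
    then obtain c where c: "y = ennreal c" "0 \<le> c"
      by (cases y) auto
    then have "c < g \<bar>V x\<bar>" using y by (metis ennreal_leI not_le)
    then obtain d where d: "0 < d" "\<And>z. dist z (V x) < d \<Longrightarrow> c < g \<bar>z\<bar>"
      using lower_semicontinuous_abs[OF g] by blast
    have "eventually (\<lambda>n. dist (Y n x) (V x) < d) sequentially"
      using lim[rule_format, OF x] d(1) by (rule tendstoD)
    then show "eventually (\<lambda>n. y < ennreal (g \<bar>Y n x\<bar>)) sequentially"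
      by eventually_elim (use c d in \<open>auto simp: ennreal_less_iff\<close>)
  qed
  have "(\<integral>\<^sup>+x. ennreal (g \<bar>x\<bar>) \<partial>\<nu>) = (\<integral>\<^sup>+x. ennreal (g \<bar>V x\<bar>) \<partial>\<Omega>)"
    by (simp add: V[symmetric] nn_integral_distr)
  also have "\<dots> \<le> (\<integral>\<^sup>+x. liminf (\<lambda>n. ennreal (g \<bar>Y n x\<bar>)) \<partial>\<Omega>)"
    by (intro nn_integral_mono pointwise)
  also have "\<dots> \<le> liminf (\<lambda>n. \<integral>\<^sup>+x. ennreal (g \<bar>Y n x\<bar>) \<partial>\<Omega>)"
    by (intro nn_integral_liminf) simp
  also have "\<dots> = liminf (\<lambda>n. \<integral>\<^sup>+x. ennreal (g \<bar>x\<bar>) \<partial>\<mu> n)"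
    by (simp add: Y[symmetric] nn_integral_distr)
  finally show ?thesis .
qed

text \<open>At \<open>t\<^sub>n = u n\<^sup>-\<^sup>1\<^sup>/\<^sup>(\<^sup>2\<^sup>r\<^sup>)\<close> the quantity \<open>sqrt n f(t\<^sub>n)\<close> tends to \<open>c spow r u\<close>. Thus the distribution function
  of the rescaled root converges to \<open>u \<mapsto> P(W \<le> c spow r u)\<close>, which is that of \<open>V = spow (1 / r) (W / c)\<close>.\<close>

theorem liminf_score_root:
  fixes X :: "nat \<Rightarrow> 'a \<Rightarrow> real" and T :: "nat \<Rightarrow> 'a \<Rightarrow> real"
  assumes "prob_space M" and a: "0 < a" "a \<le> 1"
    and ind: "prob_space.indep_vars M (\<lambda>_. borel) X UNIV"
    and distr: "\<And>j. distr M borel (X j) = distr M borel (X 0)"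
    and sq: "integrable M (\<lambda>\<omega>. \<bar>X 0 \<omega>\<bar> powr (2 * a))"
    and mean: "(\<integral>\<omega>. spow a (X 0 \<omega>) \<partial>M) = 0"
    and v: "(\<integral>\<omega>. \<bar>X 0 \<omega>\<bar> powr (2 * a) \<partial>M) = v" "0 < v"
    and T_measurable [measurable]: "\<And>n. T n \<in> borel_measurable M"
    and T: "\<And>n. 1 \<le> n \<Longrightarrow> AE \<omega> in M. (\<Sum>j<n. spow a (T n \<omega> - X j \<omega>)) = 0"
    and c: "0 < c" and r: "0 < r"
    and f: "((\<lambda>t. (\<integral>\<omega>. spow a (t - X 0 \<omega>) \<partial>M) / spow r t) \<longlongrightarrow> c) (at 0)"
    and g: "lower_semicontinuous_on {0..} g"
  shows "(\<integral>\<^sup>+w. ennreal (g (c powr (- 1 / r) * \<bar>w\<bar> powr (1 / r))) \<partial>normal_law 0 v)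
     \<le> liminf (\<lambda>n. \<integral>\<^sup>+\<omega>. ennreal (g (real n powr (1 / (2 * r)) * \<bar>T n \<omega>\<bar>)) \<partial>M)"
proof -
  interpret prob_space M by fact
  interpret N: real_distribution "normal_law 0 v"
    by (rule real_distribution_normal_law) fact
  define f where "f t = (\<integral>\<omega>. spow a (t - X 0 \<omega>) \<partial>M)" for t
  have f0: "f 0 = 0" using mean by (simp add: f_def)
  define V where "V w = spow (1 / r) (w / c)" for w
  define S where "S n \<omega> = real n powr (1 / (2 * r)) * T n \<omega>" for n \<omega>
  have [measurable]: "V \<in> borel_measurable borel" "S n \<in> borel_measurable M" for n
    unfolding V_def[abs_def] S_def[abs_def] by measurable
  have V_le: "V w \<le> u \<longleftrightarrow> w \<le> c * spow r u" for w u
  proof -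
    have "V w \<le> u \<longleftrightarrow> spow (1 / r) (w / c) \<le> spow (1 / r) (spow r u)"
      using r by (simp add: V_def spow_spow_inverse)
    also have "\<dots> \<longleftrightarrow> w / c \<le> spow r u"
      using r by (intro strict_mono_less_eq strict_mono_spow) simp
    finally show ?thesis using c by (simp add: field_simps)
  qed
  have abs_V: "\<bar>V w\<bar> = c powr (- 1 / r) * \<bar>w\<bar> powr (1 / r)" for w
    using c by (simp add: V_def abs_spow powr_divide powr_minus_divide)
  have crossing: "(\<lambda>n. prob {\<omega> \<in> space M. S n \<omega> \<le> u}) \<longlonglongrightarrow> measure (normal_law 0 v) {..c * spow r u}" for u
  proof -
    define t where "t n = u * real n powr (- 1 / (2 * r))" for n
    have t0: "t \<longlonglongrightarrow> 0"
      using tendsto_mult_left[OF tendsto_neg_powr[OF _ filterlim_real_sequentially], of "- 1 / (2 * r)" u] r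
      by (simp add: t_def[abs_def])
    have t_spow: "sqrt n * spow r (t n) = spow r u" if "0 < n" for n
    proof -
      have "spow r (t n) = (real n powr (- 1 / (2 * r))) powr r * spow r u"
        using spow_mult[of "real n powr (- 1 / (2 * r))" r u] by (simp add: t_def mult.commute)
      also have "(real n powr (- 1 / (2 * r))) powr r = real n powr (- (1 / 2))"
        using r by (simp add: powr_powr)
      also have "\<dots> = 1 / sqrt n"
        using that by (simp add: powr_minus_divide powr_half_sqrt)
      finally show ?thesis using that by simp
    qed
    have "(\<lambda>n. sqrt n * f (t n)) \<longlonglongrightarrow> c * spow r u"
    proof (cases "u = 0")
      case True
      then show ?thesis by (simp add: t_def f0)
    next
      case False
      have ev: "eventually (\<lambda>n. t n \<noteq> 0) sequentially"
        using eventually_gt_at_top[of 0] by eventually_elim (use False in \<open>simp add: t_def\<close>)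
      have "filterlim t (at 0) sequentially"
        using t0 ev by (simp add: filterlim_at)
      from filterlim_compose[OF f this]
      have "(\<lambda>n. f (t n) / spow r (t n) * spow r u) \<longlonglongrightarrow> c * spow r u"
        unfolding f_def by (intro tendsto_intros)
      moreover have "eventually (\<lambda>n. f (t n) / spow r (t n) * spow r u = sqrt n * f (t n)) sequentially"
        using ev eventually_gt_at_top[of 0]
      proof eventually_elim
        case (elim n)
        then have "spow r (t n) \<noteq> 0" by (simp add: spow_def sgn_zero_iff)
        then show ?case using t_spow[OF elim(2)] by (simp add: field_simps)
      qed
      ultimately show ?thesis by (rule Lim_transform_eventually)
    qed
    then have "(\<lambda>n. prob {\<omega> \<in> space M. T n \<omega> \<le> t n}) \<longlonglongrightarrow> measure (normal_law 0 v) {..c * spow r u}"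
      using assms(1-10) T t0 unfolding f_def by (intro score_crossing_limit)
    moreover have "eventually (\<lambda>n. prob {\<omega> \<in> space M. T n \<omega> \<le> t n} = prob {\<omega> \<in> space M. S n \<omega> \<le> u}) sequentially"
      using eventually_gt_at_top[of 0]
    proof eventually_elim
      case (elim n)
      have "T n \<omega> \<le> t n \<longleftrightarrow> S n \<omega> \<le> u" for \<omega>
        using elim by (simp add: t_def S_def powr_minus_divide field_simps)
      then show ?case by simp
    qed
    ultimately show ?thesis by (rule Lim_transform_eventually)
  qed
  have "weak_conv_m (\<lambda>n. distr M borel (S n)) (distr (normal_law 0 v) borel V)"
    unfolding weak_conv_m_def weak_conv_def
  proof (intro allI impI)
    fix u
    have "V -` {..u} = {..c * spow r u}" by (auto simp: V_le)
    then have "cdf (distr (normal_law 0 v) borel V) u = measure (normal_law 0 v) {..c * spow r u}"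
      by (simp add: cdf_def measure_distr)
    moreover have "cdf (distr M borel (S n)) u = prob {\<omega> \<in> space M. S n \<omega> \<le> u}" for n
      by (auto simp: cdf_def measure_distr intro!: arg_cong[where f=prob])
    ultimately show "(\<lambda>n. cdf (distr M borel (S n)) u) \<longlonglongrightarrow> cdf (distr (normal_law 0 v) borel V) u"
      using crossing by simp
  qed
  then have "(\<integral>\<^sup>+x. ennreal (g \<bar>x\<bar>) \<partial>distr (normal_law 0 v) borel V)
     \<le> liminf (\<lambda>n. \<integral>\<^sup>+x. ennreal (g \<bar>x\<bar>) \<partial>distr M borel (S n))"
    by (rule weak_conv_liminf_lower_semicontinuous) (auto intro!: g real_distribution_distr N.real_distribution_distr)
  also have "(\<lambda>n. \<integral>\<^sup>+x. ennreal (g \<bar>x\<bar>) \<partial>distr M borel (S n))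
    = (\<lambda>n. \<integral>\<^sup>+\<omega>. ennreal (g (real n powr (1 / (2 * r)) * \<bar>T n \<omega>\<bar>)) \<partial>M)"
    using lower_semicontinuous_abs_measurable[OF g]
    by (simp add: nn_integral_distr S_def abs_mult)
  also have "(\<integral>\<^sup>+x. ennreal (g \<bar>x\<bar>) \<partial>distr (normal_law 0 v) borel V)
    = (\<integral>\<^sup>+w. ennreal (g (c powr (- 1 / r) * \<bar>w\<bar> powr (1 / r))) \<partial>normal_law 0 v)"
    using lower_semicontinuous_abs_measurable[OF g]
    by (simp add: nn_integral_distr abs_V)
  finally show ?thesis .
qed

section \<open>The mean score near its root: finite negative moment\<close>

text \<open>Fubini's theorem for the indicator of \<open>0 < h < f x\<close>.\<close>

lemma nn_integral_layer_cake:
  fixes f :: "'a \<Rightarrow> real"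
  assumes "sigma_finite_measure M" and [measurable]: "f \<in> borel_measurable M"
  shows "(\<integral>\<^sup>+x. ennreal (f x) \<partial>M) = (\<integral>\<^sup>+h. emeasure M {x \<in> space M. h < f x} * indicator {0<..} h \<partial>lborel)"
proof -
  interpret pair_sigma_finite M "lborel :: real measure"
    using assms(1) by (simp add: pair_sigma_finite_def sigma_finite_lborel)
  have "(\<integral>\<^sup>+x. ennreal (f x) \<partial>M) = (\<integral>\<^sup>+x. \<integral>\<^sup>+h. indicator {0<..<f x} h \<partial>lborel \<partial>M)"
  proof (rule nn_integral_cong)
    fix x
    show "ennreal (f x) = (\<integral>\<^sup>+h. indicator {0<..<f x} h \<partial>lborel)"
      by (cases "0 \<le> f x") (simp_all add: ennreal_neg)
  qed
  also have "\<dots> = (\<integral>\<^sup>+x. \<integral>\<^sup>+h. (if 0 < h \<and> h < f x then 1 else 0) \<partial>lborel \<partial>M)"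
    by (intro nn_integral_cong) (simp add: indicator_def)
  also have "\<dots> = (\<integral>\<^sup>+h. \<integral>\<^sup>+x. (if 0 < h \<and> h < f x then 1 else 0) \<partial>M \<partial>lborel)"
    by (rule Fubini'[symmetric]) measurable
  also have "\<dots> = (\<integral>\<^sup>+h. emeasure M {x \<in> space M. h < f x} * indicator {0<..} h \<partial>lborel)"
  proof (rule nn_integral_cong)
    fix h :: real
    have "(\<integral>\<^sup>+x. (if 0 < h \<and> h < f x then 1 else 0) \<partial>M) = (\<integral>\<^sup>+x. indicator {0<..} h * indicator {x \<in> space M. h < f x} x \<partial>M)"
      by (intro nn_integral_cong) (auto simp: indicator_def)
    also have "\<dots> = indicator {0<..} h * emeasure M {x \<in> space M. h < f x}"
      by (simp add: nn_integral_cmult)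
    finally show "(\<integral>\<^sup>+x. (if 0 < h \<and> h < f x then 1 else 0) \<partial>M) = emeasure M {x \<in> space M. h < f x} * indicator {0<..} h"
      by (simp add: mult.commute)
  qed
  finally show ?thesis .
qed

lemma measurable_level_measure:
  fixes f :: "'a \<Rightarrow> real"
  assumes "sigma_finite_measure M" and [measurable]: "f \<in> borel_measurable M"
  shows "(\<lambda>h. emeasure M {x \<in> space M. h < f x}) \<in> borel_measurable borel"
proof -
  interpret sigma_finite_measure M by fact
  have "(\<lambda>h. \<integral>\<^sup>+x. (if h < f x then 1 else 0 :: ennreal) \<partial>M) \<in> borel_measurable borel"
    by measurable
  moreover have "(\<integral>\<^sup>+x. (if h < f x then 1 else 0 :: ennreal) \<partial>M) = emeasure M {x \<in> space M. h < f x}" for h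
  proof -
    have "(\<integral>\<^sup>+x. (if h < f x then 1 else 0 :: ennreal) \<partial>M) = (\<integral>\<^sup>+x. indicator {x \<in> space M. h < f x} x \<partial>M)"
      by (intro nn_integral_cong) (auto simp: indicator_def)
    then show ?thesis by simp
  qed
  ultimately show ?thesis by simp
qed

lemma nn_integral_has_integral_on:
  fixes f :: "real \<Rightarrow> real"
  assumes [measurable]: "f \<in> borel_measurable borel" "A \<in> sets borel"
    and f: "\<And>x. 0 \<le> f x" "(f has_integral I) A"
  shows "(\<integral>\<^sup>+x. ennreal (f x) * indicator A x \<partial>lborel) = ennreal I"
proof -
  have "(\<integral>\<^sup>+x. ennreal (if x \<in> A then f x else 0) \<partial>lborel) = ennreal I"
    using f by (intro nn_integral_has_integral_lborel) (auto simp: has_integral_restrict_UNIV)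
  moreover have "ennreal (if x \<in> A then f x else 0) = ennreal (f x) * indicator A x" for x
    by (simp add: indicator_def)
  ultimately show ?thesis by simp
qed

text \<open>Near \<open>0\<close> the bound comes from the limit; away from \<open>0\<close> it holds because \<open>F\<close> is at most 1.\<close>

lemma small_ball_bound:
  fixes F :: "real \<Rightarrow> real"
  assumes lim: "((\<lambda>t. t powr (- \<rho>) * F t) \<longlongrightarrow> l) (at_right 0)"
    and F: "\<And>t. F t \<le> 1" and "0 < \<rho>"
  obtains K where "0 < K" "\<And>t. 0 < t \<Longrightarrow> F t \<le> K * t powr \<rho>"
proof -
  have "eventually (\<lambda>t. t powr (- \<rho>) * F t < \<bar>l\<bar> + 1) (at_right 0)"
    using lim by (rule order_tendstoD) simp
  then obtain t0 where t0: "0 < t0" "\<And>t. 0 < t \<Longrightarrow> t < t0 \<Longrightarrow> t powr (- \<rho>) * F t < \<bar>l\<bar> + 1"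
    unfolding eventually_at_right_field by auto
  define K where "K = \<bar>l\<bar> + 1 + t0 powr (- \<rho>)"
  have "F t \<le> K * t powr \<rho>" if "0 < t" for t
  proof (cases "t < t0")
    case True
    have "t powr (- \<rho>) * F t \<le> K" using t0(2)[OF that True] powr_ge_zero[of t0 "- \<rho>"] unfolding K_def by linarith
    then show ?thesis using that by (simp add: powr_minus field_simps)
  next
    case False
    then have "1 \<le> t0 powr (- \<rho>) * t powr \<rho>"
      using powr_mono2[of \<rho> t0 t] t0(1) \<open>0 < \<rho>\<close> by (simp add: powr_minus field_simps)
    also have "\<dots> \<le> K * t powr \<rho>" by (intro mult_right_mono) (auto simp: K_def)
    finally show ?thesis using F[of t] by linarith
  qed
  moreover have "0 < K" by (simp add: K_def add_pos_nonneg)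
  ultimately show ?thesis using that by blast
qed

lemma le_zero_if_le_powr:
  fixes c :: real
  assumes "0 < \<rho>" "\<And>t. 0 < t \<Longrightarrow> c \<le> K * t powr \<rho>"
  shows "c \<le> 0"
proof (rule tendsto_lowerbound)
  have "eventually (\<lambda>t :: real. 0 \<le> t) (at_right 0)"
    using eventually_at_right_less[of "0 :: real"] by eventually_elim simp
  then have "((\<lambda>t. K * t powr \<rho>) \<longlongrightarrow> K * 0 powr \<rho>) (at_right 0)"
    using assms(1) by (intro tendsto_mult tendsto_powr' tendsto_const tendsto_ident_at) simp
  then show "((\<lambda>t. K * t powr \<rho>) \<longlongrightarrow> 0) (at_right 0)" by simp
  show "eventually (\<lambda>t. c \<le> K * t powr \<rho>) (at_right 0)"
    using eventually_at_right_less by eventually_elim (rule assms(2))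
qed simp

text \<open>By the layer-cake formula the moment is the integral over \<open>h\<close> of \<open>P(|X| < h\<^sup>-\<^sup>1\<^sup>/\<^sup>\<delta>)\<close>, which is at most
  a constant times \<open>h\<^sup>-\<^sup>\<rho>\<^sup>/\<^sup>\<delta>\<close> and hence integrable at infinity, because \<open>\<delta> < \<rho>\<close>.\<close>

lemma negative_moment_finite:
  fixes X :: "'w \<Rightarrow> real"
  assumes "prob_space M" and [measurable]: "X \<in> borel_measurable M"
    and lim: "((\<lambda>t. t powr (- \<rho>) * measure M {\<omega> \<in> space M. \<bar>X \<omega>\<bar> \<le> t}) \<longlongrightarrow> 0) (at_right 0)"
    and \<rho>: "0 \<le> \<delta>" "\<delta> < \<rho>"
  shows "AE \<omega> in M. X \<omega> \<noteq> 0" "integrable M (\<lambda>\<omega>. \<bar>X \<omega>\<bar> powr (- \<delta>))"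
proof -
  interpret prob_space M by fact
  have "0 < \<rho>" using \<rho> by linarith
  obtain K where K: "0 < K" "\<And>t. 0 < t \<Longrightarrow> prob {\<omega> \<in> space M. \<bar>X \<omega>\<bar> \<le> t} \<le> K * t powr \<rho>"
    using small_ball_bound[OF lim _ \<open>0 < \<rho>\<close>] by auto
  have "prob {\<omega> \<in> space M. X \<omega> = 0} \<le> 0"
  proof (rule le_zero_if_le_powr[OF \<open>0 < \<rho>\<close>])
    fix t :: real assume t: "0 < t"
    have "prob {\<omega> \<in> space M. X \<omega> = 0} \<le> prob {\<omega> \<in> space M. \<bar>X \<omega>\<bar> \<le> t}"
      using t by (intro finite_measure_mono) auto
    then show "prob {\<omega> \<in> space M. X \<omega> = 0} \<le> K * t powr \<rho>" using K(2)[OF t] by linarith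
  qed
  then have "prob {\<omega> \<in> space M. \<not> X \<omega> \<noteq> 0} = 0" by (simp add: measure_le_0_iff)
  then show "AE \<omega> in M. X \<omega> \<noteq> 0"
    by (subst AE_iff_measurable[OF _ refl]) (auto simp: emeasure_eq_measure)
  show "integrable M (\<lambda>\<omega>. \<bar>X \<omega>\<bar> powr (- \<delta>))"
  proof (cases "\<delta> = 0")
    case True
    then show ?thesis by (intro integrable_const_bound[where B=1]) (auto simp: powr_def)
  next
    case False
    then have \<delta>: "0 < \<delta>" using \<rho> by linarith
    define p where "p = - (\<rho> / \<delta>)"
    have p: "p < - 1" using \<delta> \<rho> by (simp add: p_def field_simps)
    have level: "emeasure M {\<omega> \<in> space M. h < \<bar>X \<omega>\<bar> powr (- \<delta>)} * indicator {0<..} h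
        \<le> indicator {0..1} h + ennreal K * (ennreal (h powr p) * indicator {1..} h)" for h :: real
    proof (cases "1 \<le> h")
      case True
      have "{\<omega> \<in> space M. h < \<bar>X \<omega>\<bar> powr (- \<delta>)} \<subseteq> {\<omega> \<in> space M. \<bar>X \<omega>\<bar> \<le> h powr (- 1 / \<delta>)}"
      proof clarify
        fix \<omega> assume *: "h < \<bar>X \<omega>\<bar> powr (- \<delta>)"
        then have "0 < \<bar>X \<omega>\<bar> powr (- \<delta>)" using True by linarith
        then have "X \<omega> \<noteq> 0" by auto
        have "(\<bar>X \<omega>\<bar> powr (- \<delta>)) powr (- 1 / \<delta>) \<le> h powr (- 1 / \<delta>)"
          using * True \<delta> by (intro powr_mono2') auto
        then show "\<bar>X \<omega>\<bar> \<le> h powr (- 1 / \<delta>)" using \<delta> by (simp add: powr_powr)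
      qed
      then have "prob {\<omega> \<in> space M. h < \<bar>X \<omega>\<bar> powr (- \<delta>)} \<le> prob {\<omega> \<in> space M. \<bar>X \<omega>\<bar> \<le> h powr (- 1 / \<delta>)}"
        by (intro finite_measure_mono) auto
      also have "\<dots> \<le> K * (h powr (- 1 / \<delta>)) powr \<rho>" using True by (intro K) simp
      also have "(h powr (- 1 / \<delta>)) powr \<rho> = h powr p" by (simp add: powr_powr p_def)
      finally have "emeasure M {\<omega> \<in> space M. h < \<bar>X \<omega>\<bar> powr (- \<delta>)} \<le> ennreal K * ennreal (h powr p)"
        using K(1) by (simp add: emeasure_eq_measure flip: ennreal_mult)
      also have "\<dots> \<le> indicator {0..1} h + ennreal K * ennreal (h powr p)"
        by (rule add_increasing) auto
      finally show ?thesis using True by simp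
    next
      case False
      then show ?thesis by (auto simp: indicator_def emeasure_le_1)
    qed
    have "(\<integral>\<^sup>+\<omega>. ennreal (\<bar>X \<omega>\<bar> powr (- \<delta>)) \<partial>M)
       = (\<integral>\<^sup>+h. emeasure M {\<omega> \<in> space M. h < \<bar>X \<omega>\<bar> powr (- \<delta>)} * indicator {0<..} h \<partial>lborel)"
      by (rule nn_integral_layer_cake) (auto intro: sigma_finite_measure_axioms)
    also have "\<dots> \<le> (\<integral>\<^sup>+h. indicator {0..1::real} h + ennreal K * (ennreal (h powr p) * indicator {1..} h) \<partial>lborel)"
      by (intro nn_integral_mono level)
    also have "\<dots> = 1 + ennreal K * (\<integral>\<^sup>+h. ennreal (h powr p) * indicator {1..} h \<partial>lborel)"
      by (simp add: nn_integral_add nn_integral_cmult)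
    also have "(\<integral>\<^sup>+h. ennreal (h powr p) * indicator {1..} h \<partial>lborel) = ennreal (- (1 powr (p + 1)) / (p + 1))"
      using has_integral_powr_to_inf[of p 1] p by (intro nn_integral_has_integral_on) auto
    also have "1 + ennreal K * \<dots> < \<infinity>" by (simp add: ennreal_mult_less_top)
    finally have "(\<integral>\<^sup>+\<omega>. ennreal (\<bar>X \<omega>\<bar> powr (- \<delta>)) \<partial>M) < \<infinity>" .
    then show ?thesis by (intro integrableI_nonneg) auto
  qed
qed

text \<open>The difference quotients of \<open>\<psi>\<close> converge off the singularity \<open>X = 0\<close> and are dominated by a multiple of
  \<open>|X|\<^sup>a\<^sup>-\<^sup>1\<close>.\<close>

theorem score_derivative:
  fixes X :: "'w \<Rightarrow> real"
  assumes "prob_space M" and a: "0 < a" "a \<le> 1" and [measurable]: "X \<in> borel_measurable M"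
    and int: "integrable M (\<lambda>\<omega>. spow a (X \<omega>))" and mean: "(\<integral>\<omega>. spow a (X \<omega>) \<partial>M) = 0"
    and nz: "AE \<omega> in M. X \<omega> \<noteq> 0" and moment: "integrable M (\<lambda>\<omega>. \<bar>X \<omega>\<bar> powr (a - 1))"
  shows "((\<lambda>t. (\<integral>\<omega>. spow a (t - X \<omega>) \<partial>M) / t) \<longlongrightarrow> a * (\<integral>\<omega>. \<bar>X \<omega>\<bar> powr (a - 1) \<partial>M)) (at 0)"
  unfolding tendsto_at_iff_sequentially comp_def
proof (intro allI impI)
  interpret prob_space M by fact
  fix t :: "nat \<Rightarrow> real" assume t: "\<forall>n. t n \<in> UNIV - {0}" "t \<longlonglongrightarrow> 0"
  have int_sum: "integrable M (\<lambda>\<omega>. spow a (s - X \<omega>) + spow a (X \<omega>))" for s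
    using spow_shift_bound[OF a]
    by (intro integrable_const_bound[where B="2 * \<bar>s\<bar> powr a"]) auto
  have eq: "expectation (\<lambda>\<omega>. spow a (s - X \<omega>)) / s = expectation (\<lambda>\<omega>. (spow a (s - X \<omega>) + spow a (X \<omega>)) / s)" for s
    using int mean Bochner_Integration.integrable_diff[OF int_sum int, of s] by simp
  have "(\<lambda>n. expectation (\<lambda>\<omega>. (spow a (t n - X \<omega>) + spow a (X \<omega>)) / t n)) \<longlonglongrightarrow> expectation (\<lambda>\<omega>. a * \<bar>X \<omega>\<bar> powr (a - 1))"
  proof (rule integral_dominated_convergence)
    show "integrable M (\<lambda>\<omega>. 4 * \<bar>X \<omega>\<bar> powr (a - 1))" using moment by simp
    show "AE \<omega> in M. (\<lambda>n. (spow a (t n - X \<omega>) + spow a (X \<omega>)) / t n) \<longlonglongrightarrow> a * \<bar>X \<omega>\<bar> powr (a - 1)"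
      using nz
    proof eventually_elim
      case (elim \<omega>)
      have "((\<lambda>h. (spow a (- X \<omega> + h) - spow a (- X \<omega>)) / h) \<longlongrightarrow> a * \<bar>- X \<omega>\<bar> powr (a - 1)) (at 0)"
        using DERIV_spow[of "- X \<omega>" a] elim by (simp add: DERIV_def)
      moreover have "filterlim t (at 0) sequentially" using t by (simp add: filterlim_at)
      ultimately have "(\<lambda>n. (spow a (- X \<omega> + t n) - spow a (- X \<omega>)) / t n) \<longlonglongrightarrow> a * \<bar>- X \<omega>\<bar> powr (a - 1)"
        by (rule filterlim_compose)
      then show ?case by (simp add: add.commute)
    qed
    show "AE \<omega> in M. norm ((spow a (t n - X \<omega>) + spow a (X \<omega>)) / t n) \<le> 4 * \<bar>X \<omega>\<bar> powr (a - 1)" for n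
      using nz
    proof eventually_elim
      case (elim \<omega>)
      then show ?case using spow_increment_bound[OF a elim, of "t n"] t(1)
        by (simp add: field_simps)
    qed
  qed measurable
  then show "(\<lambda>n. expectation (\<lambda>\<omega>. spow a (t n - X \<omega>)) / t n) \<longlonglongrightarrow> a * expectation (\<lambda>\<omega>. \<bar>X \<omega>\<bar> powr (a - 1))"
    by (simp add: eq)
qed

section \<open>The mean score near its root: power-law concentration\<close>

text \<open>The limit of the law of \<open>X / t\<close> on the positive half-line, divided by \<open>t\<^sup>\<rho>\<close>, when \<open>P(0 \<le> X \<le> s)\<close>
  behaves like \<open>b s\<^sup>\<rho>\<close>.\<close>

definition power_law :: "real \<Rightarrow> real \<Rightarrow> real measure" where
  "power_law b \<rho> = density lborel (\<lambda>x. ennreal (b * \<rho> * x powr (\<rho> - 1)) * indicator {0<..} x)"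

lemma sets_power_law [measurable_cong, simp]: "sets (power_law b \<rho>) = sets borel"
  and space_power_law [simp]: "space (power_law b \<rho>) = UNIV"
  by (simp_all add: power_law_def)

lemma sigma_finite_power_law: "sigma_finite_measure (power_law b \<rho>)"
  unfolding power_law_def
  by (subst sigma_finite_measure.sigma_finite_iff_density_finite[OF sigma_finite_lborel]) (auto simp: ennreal_mult_eq_top_iff indicator_def)

lemma nn_integral_power_law:
  assumes [measurable]: "f \<in> borel_measurable borel"
  shows "(\<integral>\<^sup>+x. f x \<partial>power_law b \<rho>) = (\<integral>\<^sup>+x. ennreal (b * \<rho> * x powr (\<rho> - 1)) * indicator {0<..} x * f x \<partial>lborel)"
  unfolding power_law_def by (subst nn_integral_density) auto

lemma emeasure_power_law_Icc:
  assumes "0 < b" "0 < \<rho>" "0 \<le> s"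
  shows "emeasure (power_law b \<rho>) {0..s} = ennreal (b * s powr \<rho>)"
proof -
  have "emeasure (power_law b \<rho>) {0..s} = (\<integral>\<^sup>+x. ennreal (b * \<rho> * x powr (\<rho> - 1)) * indicator {0<..} x * indicator {0..s} x \<partial>lborel)"
    unfolding power_law_def by (subst emeasure_density) auto
  also have "\<dots> = (\<integral>\<^sup>+x. ennreal (b * \<rho> * x powr (\<rho> - 1)) * indicator {0..s} x \<partial>lborel)"
    using AE_lborel_singleton[of 0] by (intro nn_integral_cong_AE) (auto simp: indicator_def)
  also have "\<dots> = ennreal (b * \<rho> * (s powr (\<rho> - 1 + 1) / (\<rho> - 1 + 1)))"
    using assms has_integral_mult_right[OF has_integral_powr_from_0[of "\<rho> - 1" s], of "b * \<rho>"]
    by (intro nn_integral_has_integral_on) auto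
  finally show ?thesis using assms by simp
qed

lemma emeasure_power_law_interval:
  assumes b: "0 < b" "0 < \<rho>" and l: "0 \<le> l" "l \<le> r"
    and A: "{l<..<r} \<subseteq> A" "A \<subseteq> {l..r}" and [measurable]: "A \<in> sets borel"
  shows "emeasure (power_law b \<rho>) A = ennreal (b * r powr \<rho> - b * l powr \<rho>)"
proof -
  have "AE x in lborel. x \<noteq> l \<and> x \<noteq> r"
    using AE_lborel_singleton[of l] AE_lborel_singleton[of r] by eventually_elim simp
  then have "AE x in power_law b \<rho>. x \<noteq> l \<and> x \<noteq> r"
    unfolding power_law_def by (subst AE_density) auto
  then have "emeasure (power_law b \<rho>) A = emeasure (power_law b \<rho>) ({0..r} - {0..l})"
  proof (intro emeasure_eq_AE)
    assume "AE x in power_law b \<rho>. x \<noteq> l \<and> x \<noteq> r"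
    then show "AE x in power_law b \<rho>. (x \<in> A) = (x \<in> {0..r} - {0..l})"
    proof eventually_elim
      case (elim x)
      then have "x \<in> A \<longleftrightarrow> l < x \<and> x < r" using A by (force simp: less_le)
      then show ?case using l elim by auto
    qed
  qed auto
  also have "\<dots> = emeasure (power_law b \<rho>) {0..r} - emeasure (power_law b \<rho>) {0..l}"
    using b l by (intro emeasure_Diff) (auto simp: emeasure_power_law_Icc)
  also have "\<dots> = ennreal (b * r powr \<rho> - b * l powr \<rho>)"
    using b l by (simp add: emeasure_power_law_Icc ennreal_minus)
  finally show ?thesis .
qed

lemma convex_real_between_endpoints:
  fixes A :: "real set"
  assumes "convex A" "A \<noteq> {}" "A \<subseteq> {0..R}"
  obtains l r where "0 \<le> l" "l \<le> r" "{l<..<r} \<subseteq> A" "A \<subseteq> {l..r}"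
proof
  have bdd: "bdd_below A" "bdd_above A" 
    using assms(3) bdd_below_mono[of "{0..R}" A] bdd_above_mono[of "{0..R}" A] by simp_all
  show "A \<subseteq> {Inf A..Sup A}" using bdd by (auto intro: cInf_lower cSup_upper)
  then show "Inf A \<le> Sup A" using assms(2) by (meson all_not_in_conv atLeastAtMost_iff order_trans subsetD)
  show "0 \<le> Inf A" using assms(2,3) by (intro cInf_greatest) auto
  show "{Inf A<..<Sup A} \<subseteq> A"
  proof
    fix x assume "x \<in> {Inf A<..<Sup A}"
    then obtain y z where "y \<in> A" "y < x" "z \<in> A" "x < z"
      using assms(2) bdd by (auto simp: cInf_less_iff less_cSup_iff)
    then show "x \<in> A" using assms(1)
      by (meson is_interval_convex_1 mem_is_interval_1_I less_imp_le)
  qed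
qed

text \<open>A bounded interval differs from \<open>{l<..r}\<close> at most in its end points. Enlarging and
  shrinking it by \<open>e\<close> gives half-open intervals, whose probabilities are differences of \<open>N\<close>; the limits of
  these depend continuously on \<open>e\<close>.\<close>

lemma power_law_interval_limit:
  fixes X :: "'w \<Rightarrow> real"
  assumes "prob_space M" and [measurable]: "X \<in> borel_measurable M"
    and b: "0 < b" "0 < \<rho>"
    and F: "((\<lambda>s. measure M {\<omega> \<in> space M. 0 \<le> X \<omega> \<and> X \<omega> \<le> s} / (b * s powr \<rho>)) \<longlongrightarrow> 1) (at_right 0)"
    and null: "measure M {\<omega> \<in> space M. X \<omega> = 0} = 0"
    and A: "convex A" "A \<subseteq> {0<..R}" and [measurable]: "A \<in> sets borel"
    and t: "\<And>n. 0 < t n" "t \<longlonglongrightarrow> 0"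
  shows "(\<lambda>n. ennreal (t n powr (- \<rho>)) * emeasure M {\<omega> \<in> space M. X \<omega> / t n \<in> A}) \<longlonglongrightarrow> emeasure (power_law b \<rho>) A"
proof (cases "A = {}")
  case False
  interpret prob_space M by fact
  have "A \<subseteq> {0..R}" using A by auto
  then obtain l r where lr: "0 \<le> l" "l \<le> r" "{l<..<r} \<subseteq> A" "A \<subseteq> {l..r}"
    using convex_real_between_endpoints[OF A(1) False] by metis
  define N where "N s = prob {\<omega> \<in> space M. 0 \<le> X \<omega> \<and> X \<omega> \<le> s}" for s
  \<comment> \<open>Extending the limit by 0 to negative arguments covers the case \<open>l = 0\<close>, where \<open>l - e < 0\<close>.\<close>
  define G where "G s = b * (max s 0) powr \<rho>" for s
  define P where "P n = prob {\<omega> \<in> space M. X \<omega> / t n \<in> A}" for n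
  have N_lim: "(\<lambda>n. t n powr (- \<rho>) * N (t n * s)) \<longlonglongrightarrow> G s" for s
  proof (cases "0 < s")
    case True
    have "filterlim (\<lambda>n. t n * s) (at_right 0) sequentially"
      using t True tendsto_mult_right[OF t(2), of s]
      by (auto simp: filterlim_at less_imp_neq[symmetric] intro!: always_eventually)
    from filterlim_compose[OF F this]
    have "(\<lambda>n. N (t n * s) / (b * (t n * s) powr \<rho>) * (b * s powr \<rho>)) \<longlonglongrightarrow> 1 * (b * s powr \<rho>)"
      unfolding N_def by (intro tendsto_intros)
    moreover have "N (t n * s) / (b * (t n * s) powr \<rho>) * (b * s powr \<rho>) = t n powr (- \<rho>) * N (t n * s)" for n
      using t(1)[of n] True b by (simp add: powr_mult powr_minus field_simps)
    ultimately show ?thesis using True by (simp add: G_def)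
  next
    case False
    have "N (t n * s) = 0" for n
    proof -
      have "t n * s \<le> 0" using False t(1)[of n] by (simp add: mult_le_0_iff)
      then have "N (t n * s) \<le> prob {\<omega> \<in> space M. X \<omega> = 0}"
        unfolding N_def by (intro finite_measure_mono) auto
      then show ?thesis using null by (simp add: N_def measure_le_0_iff)
    qed
    then show ?thesis using False by (simp add: G_def)
  qed
  have N_mono: "N s \<le> N s'" if "s \<le> s'" for s s'
    unfolding N_def using that by (intro finite_measure_mono) auto
  have N_diff: "N s' - N s = prob {\<omega> \<in> space M. 0 \<le> X \<omega> \<and> s < X \<omega> \<and> X \<omega> \<le> s'}" if "s \<le> s'" for s s'
  proof -
    have "prob ({\<omega> \<in> space M. 0 \<le> X \<omega> \<and> X \<omega> \<le> s'} - {\<omega> \<in> space M. 0 \<le> X \<omega> \<and> X \<omega> \<le> s}) = N s' - N s"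
      unfolding N_def using that by (intro finite_measure_Diff) auto
    also have "{\<omega> \<in> space M. 0 \<le> X \<omega> \<and> X \<omega> \<le> s'} - {\<omega> \<in> space M. 0 \<le> X \<omega> \<and> X \<omega> \<le> s}
      = {\<omega> \<in> space M. 0 \<le> X \<omega> \<and> s < X \<omega> \<and> X \<omega> \<le> s'}" by auto
    finally show ?thesis by simp
  qed
  have up: "P n \<le> N (t n * (r + e)) - N (t n * (l - e))" if "0 < e" for n e
  proof -
    have "P n \<le> prob {\<omega> \<in> space M. 0 \<le> X \<omega> \<and> t n * (l - e) < X \<omega> \<and> X \<omega> \<le> t n * (r + e)}"
      unfolding P_def
    proof (intro finite_measure_mono subsetI CollectI; clarify?)
      fix \<omega> assume "\<omega> \<in> space M" "X \<omega> / t n \<in> A"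
      then have "l \<le> X \<omega> / t n" "X \<omega> / t n \<le> r" "0 < X \<omega> / t n" using lr(4) A(2) by auto
      then have "0 < X \<omega>" "t n * l \<le> X \<omega>" "X \<omega> \<le> t n * r"
        using t(1)[of n] by (auto simp: field_simps zero_less_divide_iff)
      moreover have "0 < t n * e" using t(1)[of n] that by simp
      ultimately show "0 \<le> X \<omega> \<and> t n * (l - e) < X \<omega> \<and> X \<omega> \<le> t n * (r + e)"
        by (simp add: algebra_simps)
    qed auto
    also have "\<dots> = N (t n * (r + e)) - N (t n * (l - e))"
      using lr(2) that t(1)[of n] by (intro N_diff[symmetric] mult_left_mono) auto
    finally show ?thesis .
  qed
  have lo: "N (t n * (r - e)) - N (t n * (l + e)) \<le> P n" if "0 < e" for n e
  proof (cases "l + e \<le> r - e")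
    case True
    have "N (t n * (r - e)) - N (t n * (l + e)) = prob {\<omega> \<in> space M. 0 \<le> X \<omega> \<and> t n * (l + e) < X \<omega> \<and> X \<omega> \<le> t n * (r - e)}"
      using True t(1)[of n] by (intro N_diff mult_left_mono) auto
    also have "\<dots> \<le> P n"
      unfolding P_def
    proof (intro finite_measure_mono subsetI CollectI; clarify?)
      fix \<omega> assume "\<omega> \<in> space M" "t n * (l + e) < X \<omega>" "X \<omega> \<le> t n * (r - e)"
      then have "l + e < X \<omega> / t n" "X \<omega> / t n \<le> r - e"
        using t(1)[of n] by (auto simp: field_simps)
      then show "X \<omega> / t n \<in> A" using lr(3) that by (intro subsetD[OF lr(3)]) auto
    qed auto
    finally show ?thesis .
  next
    case False
    then have "N (t n * (r - e)) \<le> N (t n * (l + e))"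
      using t(1)[of n] by (intro N_mono mult_left_mono) auto
    moreover have "0 \<le> P n" by (simp add: P_def)
    ultimately show ?thesis by linarith
  qed
  have G_cont: "isCont G s" for s
    unfolding G_def isCont_def using b by (intro tendsto_intros tendsto_powr') auto
  have "(\<lambda>n. t n powr (- \<rho>) * P n) \<longlonglongrightarrow> G r - G l"
  proof (rule LIMSEQ_I)
    fix \<epsilon> :: real assume \<epsilon>: "0 < \<epsilon>"
    have G_lim: "((\<lambda>e. (G (r + e) - G (l - e)) - (G r - G l)) \<longlongrightarrow> (G (r + 0) - G (l - 0)) - (G r - G l)) (at_right 0)"
      "((\<lambda>e. (G (r - e) - G (l + e)) - (G r - G l)) \<longlongrightarrow> (G (r - 0) - G (l + 0)) - (G r - G l)) (at_right 0)"
      by (intro tendsto_intros isCont_tendsto_compose[OF G_cont])+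
    have "eventually (\<lambda>e. (G (r + e) - G (l - e)) - (G r - G l) < \<epsilon> / 2) (at_right 0)"
      "eventually (\<lambda>e. - (\<epsilon> / 2) < (G (r - e) - G (l + e)) - (G r - G l)) (at_right 0)"
      using \<epsilon> by (intro order_tendstoD(2)[OF G_lim(1)] order_tendstoD(1)[OF G_lim(2)]; simp)+
    then have "eventually (\<lambda>e. 0 < e \<and> (G (r + e) - G (l - e)) - (G r - G l) < \<epsilon> / 2
        \<and> - (\<epsilon> / 2) < (G (r - e) - G (l + e)) - (G r - G l)) (at_right 0)"
      using eventually_at_right_less[of "0 :: real"] by eventually_elim auto
    then obtain e where e: "0 < e" "(G (r + e) - G (l - e)) - (G r - G l) < \<epsilon> / 2"
        "- (\<epsilon> / 2) < (G (r - e) - G (l + e)) - (G r - G l)"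
      using eventually_happens'[OF trivial_limit_at_right_real] by blast
    let ?U = "\<lambda>n. t n powr (- \<rho>) * N (t n * (r + e)) - t n powr (- \<rho>) * N (t n * (l - e))"
    let ?L = "\<lambda>n. t n powr (- \<rho>) * N (t n * (r - e)) - t n powr (- \<rho>) * N (t n * (l + e))"
    have "?U \<longlonglongrightarrow> G (r + e) - G (l - e)" "?L \<longlonglongrightarrow> G (r - e) - G (l + e)"
      by (intro tendsto_diff N_lim)+
    then have "eventually (\<lambda>n. ?U n < G r - G l + \<epsilon>) sequentially" "eventually (\<lambda>n. G r - G l - \<epsilon> < ?L n) sequentially"
      using e \<epsilon> by (auto intro: order_tendstoD)
    then have "eventually (\<lambda>n. norm (t n powr (- \<rho>) * P n - (G r - G l)) < \<epsilon>) sequentially"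
    proof eventually_elim
      case (elim n)
      have "t n powr (- \<rho>) * P n \<le> ?U n" "?L n \<le> t n powr (- \<rho>) * P n"
        using mult_left_mono[OF up[OF e(1), of n], of "t n powr (- \<rho>)"]
          mult_left_mono[OF lo[OF e(1), of n], of "t n powr (- \<rho>)"]
        by (simp_all add: right_diff_distrib)
      then show ?case using elim unfolding real_norm_def by linarith
    qed
    then show "\<exists>no. \<forall>n\<ge>no. norm (t n powr (- \<rho>) * P n - (G r - G l)) < \<epsilon>"
      by (simp add: eventually_sequentially)
  qed
  then have "(\<lambda>n. ennreal (t n powr (- \<rho>) * P n)) \<longlonglongrightarrow> ennreal (G r - G l)"
    by (rule tendsto_ennrealI)
  moreover have "ennreal (G r - G l) = emeasure (power_law b \<rho>) A"
    using emeasure_power_law_interval[OF b lr(1-4)] lr by (simp add: G_def)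
  moreover have "ennreal (t n powr (- \<rho>) * P n) = ennreal (t n powr (- \<rho>)) * emeasure M {\<omega> \<in> space M. X \<omega> / t n \<in> A}" for n
    by (simp add: P_def emeasure_eq_measure ennreal_mult)
  ultimately show ?thesis by simp
qed simp

text \<open>Both sides are integrals over the level \<open>h\<close> of measures of the superlevel set \<open>{f > h}\<close>, a bounded
  interval. The decay of \<open>f\<close> puts it into \<open>{0<..R h}\<close> with \<open>R h = (C / h)\<^sup>1\<^sup>/\<^sup>\<delta>\<close>, so that its rescaled
  probability is at most a multiple of \<open>h\<^sup>-\<^sup>\<rho>\<^sup>/\<^sup>\<delta>\<close>, which is integrable on \<open>(0, B)\<close> because \<open>\<rho> < \<delta>\<close>.\<close>

theorem power_law_scaling_limit:
  fixes X :: "'w \<Rightarrow> real" and f :: "real \<Rightarrow> real"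
  assumes "prob_space M" and [measurable]: "X \<in> borel_measurable M"
    and b: "0 < b" "0 < \<rho>" "\<rho> < \<delta>"
    and F: "((\<lambda>s. measure M {\<omega> \<in> space M. 0 \<le> X \<omega> \<and> X \<omega> \<le> s} / (b * s powr \<rho>)) \<longlongrightarrow> 1) (at_right 0)"
    and null: "measure M {\<omega> \<in> space M. X \<omega> = 0} = 0"
    and [measurable]: "f \<in> borel_measurable borel"
    and f: "\<And>x. x \<le> 0 \<Longrightarrow> f x = 0" "\<And>x. f x \<le> B" "\<And>x. 0 < x \<Longrightarrow> f x \<le> C * x powr (- \<delta>)"
    and BC: "0 < B" "0 < C"
    and conv: "\<And>h. 0 < h \<Longrightarrow> convex {x. h < f x}"
    and t: "\<And>n. 0 < t n" "t \<longlonglongrightarrow> 0"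
  shows "(\<lambda>n. ennreal (t n powr (- \<rho>)) * (\<integral>\<^sup>+\<omega>. ennreal (f (X \<omega> / t n)) \<partial>M)) \<longlonglongrightarrow> (\<integral>\<^sup>+x. ennreal (f x) \<partial>power_law b \<rho>)"
    and "(\<integral>\<^sup>+x. ennreal (f x) \<partial>power_law b \<rho>) < \<infinity>"
proof -
  interpret prob_space M by fact
  define N where "N s = prob {\<omega> \<in> space M. 0 \<le> X \<omega> \<and> X \<omega> \<le> s}" for s
  have "((\<lambda>s. s powr (- \<rho>) * N s) \<longlongrightarrow> b * 1) (at_right 0)"
  proof (rule Lim_transform_eventually)
    show "((\<lambda>s. b * (N s / (b * s powr \<rho>))) \<longlongrightarrow> b * 1) (at_right 0)"
      unfolding N_def by (intro tendsto_mult tendsto_const F)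
    show "eventually (\<lambda>s. b * (N s / (b * s powr \<rho>)) = s powr (- \<rho>) * N s) (at_right 0)"
      using b by (intro always_eventually) (auto simp: powr_minus divide_inverse)
  qed
  then obtain K where K: "0 < K" "\<And>s. 0 < s \<Longrightarrow> N s \<le> K * s powr \<rho>"
    using small_ball_bound[of \<rho> N] b by (auto simp: N_def)
  define p where "p = - (\<rho> / \<delta>)"
  have p: "- 1 < p" using b by (simp add: p_def)
  define R where "R h = (C / h) powr (1 / \<delta>)" for h
  have R: "0 < R h" if "0 < h" for h using that BC by (simp add: R_def)
  have level: "{x. h < f x} \<subseteq> {0<..R h}" if "0 < h" for h
  proof clarify
    fix x assume x: "h < f x"
    have x0: "0 < x" using f(1)[of x] x that by (cases "x \<le> 0") auto
    then have "h < C * x powr (- \<delta>)" using f(3) x by (meson less_le_trans)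
    then have "x powr \<delta> < C / h" using x0 that by (simp add: powr_minus field_simps)
    then have "(x powr \<delta>) powr (1 / \<delta>) \<le> R h"
      unfolding R_def using b by (intro powr_mono2) auto
    then show "x \<in> {0<..R h}" using x0 b by (simp add: powr_powr)
  qed
  define D where "D = K * C powr (\<rho> / \<delta>)"
  have D: "0 \<le> D" using K by (simp add: D_def)
  have bound: "ennreal (t n powr (- \<rho>)) * (emeasure M {\<omega> \<in> space M. h < f (X \<omega> / t n)} * indicator {0<..} h)
      \<le> ennreal D * (ennreal (h powr p) * indicator {0..B} h)" for n h
  proof (cases "0 < h \<and> h < B")
    case True
    then have h: "0 < h" by simp
    have "prob {\<omega> \<in> space M. h < f (X \<omega> / t n)} \<le> N (t n * R h)"
      unfolding N_def
    proof (intro finite_measure_mono subsetI CollectI; clarify?)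
      fix \<omega> assume "\<omega> \<in> space M" "h < f (X \<omega> / t n)"
      then have "X \<omega> / t n \<in> {0<..R h}" using level[OF h] by blast
      then show "0 \<le> X \<omega> \<and> X \<omega> \<le> t n * R h"
        using t(1)[of n] by (auto simp: field_simps zero_less_divide_iff)
    qed auto
    also have "\<dots> \<le> K * (t n * R h) powr \<rho>" using t(1) R[OF h] by (intro K) simp
    also have "\<dots> = t n powr \<rho> * (D * h powr p)"
      using t(1)[of n] h BC by (simp add: R_def powr_mult powr_powr powr_divide D_def p_def powr_minus field_simps)
    finally have "t n powr (- \<rho>) * prob {\<omega> \<in> space M. h < f (X \<omega> / t n)} \<le> t n powr (- \<rho>) * (t n powr \<rho> * (D * h powr p))"
      by (intro mult_left_mono) auto
    also have "\<dots> = D * h powr p" using t(1)[of n] by (simp add: powr_minus)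
    finally show ?thesis using True D
      by (simp add: emeasure_eq_measure flip: ennreal_mult)
  next
    case False
    then have "h \<le> 0 \<or> {\<omega> \<in> space M. h < f (X \<omega> / t n)} = {}"
      using f(2) by (auto simp: not_less intro: order_trans)
    then have z: "emeasure M {\<omega> \<in> space M. h < f (X \<omega> / t n)} * indicator {0<..} h = 0"
    proof
      assume *: "{\<omega> \<in> space M. h < f (X \<omega> / t n)} = {}"
      show ?thesis unfolding * by simp
    qed simp
    show ?thesis unfolding z by simp
  qed
  have meas: "(\<lambda>h. emeasure M {\<omega> \<in> space M. h < f (X \<omega> / t n)}) \<in> borel_measurable borel" for n
    by (rule measurable_level_measure) (auto intro: sigma_finite_measure_axioms)
  have meas': "(\<lambda>h. emeasure (power_law b \<rho>) {x \<in> space (power_law b \<rho>). h < f x}) \<in> borel_measurable borel"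
    by (rule measurable_level_measure) (auto intro: sigma_finite_power_law)
  have dom: "(\<integral>\<^sup>+h. ennreal D * (ennreal (h powr p) * indicator {0..B} h) \<partial>lborel) < \<infinity>"
  proof -
    have "(\<integral>\<^sup>+h. ennreal (h powr p) * indicator {0..B} h \<partial>lborel) = ennreal (B powr (p + 1) / (p + 1))"
      using has_integral_powr_from_0[OF p, of B] BC by (intro nn_integral_has_integral_on) auto
    then show ?thesis by (simp add: nn_integral_cmult ennreal_mult_less_top)
  qed
  have lc: "(\<integral>\<^sup>+x. ennreal (f x) \<partial>power_law b \<rho>) = (\<integral>\<^sup>+h. emeasure (power_law b \<rho>) {x \<in> space (power_law b \<rho>). h < f x} * indicator {0<..} h \<partial>lborel)"
    by (rule nn_integral_layer_cake) (auto intro: sigma_finite_power_law)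
  have lc': "ennreal (t n powr (- \<rho>)) * (\<integral>\<^sup>+\<omega>. ennreal (f (X \<omega> / t n)) \<partial>M)
     = (\<integral>\<^sup>+h. ennreal (t n powr (- \<rho>)) * (emeasure M {\<omega> \<in> space M. h < f (X \<omega> / t n)} * indicator {0<..} h) \<partial>lborel)" for n
    using meas[of n]
    by (subst nn_integral_layer_cake) (auto intro: sigma_finite_measure_axioms simp: nn_integral_cmult)
  have ptw: "(\<lambda>n. ennreal (t n powr (- \<rho>)) * (emeasure M {\<omega> \<in> space M. h < f (X \<omega> / t n)} * indicator {0<..} h))
     \<longlonglongrightarrow> emeasure (power_law b \<rho>) {x \<in> space (power_law b \<rho>). h < f x} * indicator {0<..} h" for h
  proof (cases "0 < h")
    case True
    have "(\<lambda>n. ennreal (t n powr (- \<rho>)) * emeasure M {\<omega> \<in> space M. X \<omega> / t n \<in> {x. h < f x}}) \<longlonglongrightarrow> emeasure (power_law b \<rho>) {x. h < f x}"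
      by (rule power_law_interval_limit[OF assms(1,2) b(1,2) F null conv[OF True] level[OF True] _ t]) simp
    then show ?thesis using True by simp
  qed simp
  show lim: "(\<lambda>n. ennreal (t n powr (- \<rho>)) * (\<integral>\<^sup>+\<omega>. ennreal (f (X \<omega> / t n)) \<partial>M)) \<longlonglongrightarrow> (\<integral>\<^sup>+x. ennreal (f x) \<partial>power_law b \<rho>)"
    unfolding lc lc'
    by (rule nn_integral_dominated_convergence[where w="\<lambda>h. ennreal D * (ennreal (h powr p) * indicator {0..B} h)"])
      (use meas meas' dom bound ptw in auto)
  have "(\<integral>\<^sup>+x. ennreal (f x) \<partial>power_law b \<rho>) \<le> (\<integral>\<^sup>+h. ennreal D * (ennreal (h powr p) * indicator {0..B} h) \<partial>lborel)"
    using lim by (rule LIMSEQ_le_const2) (auto simp: lc' intro!: nn_integral_mono bound)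
  then show "(\<integral>\<^sup>+x. ennreal (f x) \<partial>power_law b \<rho>) < \<infinity>" using dom by (rule le_less_trans)
qed

text \<open>The integrand that defines the rate constant, up to the density of the limiting power law.\<close>

definition score_kernel :: "real \<Rightarrow> real \<Rightarrow> real" where
  "score_kernel a x = spow a (1 - x) + spow a x"

lemma score_kernel_measurable [measurable]: "score_kernel a \<in> borel_measurable borel"
  unfolding score_kernel_def[abs_def] by measurable

lemma score_kernel_reflect: "score_kernel a (1 - x) = score_kernel a x"
  by (simp add: score_kernel_def)

lemma score_kernel_uminus: "score_kernel a (- x) = score_kernel a (1 + x)"
  using score_kernel_reflect[of a "1 + x"] by simp

lemma score_kernel_pos: "0 < a \<Longrightarrow> 0 < score_kernel a x"
  using strict_monoD[OF strict_mono_spow, of a "- x" "1 - x"] by (simp add: score_kernel_def)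

lemma score_kernel_le_2: "0 < a \<Longrightarrow> a \<le> 1 \<Longrightarrow> score_kernel a x \<le> 2"
  using spow_shift_bound[of a 1 x] by (simp add: score_kernel_def)

lemma score_kernel_decay:
  "0 < a \<Longrightarrow> a \<le> 1 \<Longrightarrow> x \<noteq> 0 \<Longrightarrow> score_kernel a x \<le> 4 * \<bar>x\<bar> powr (- (1 - a))"
  using spow_increment_bound[of a x 1] by (simp add: score_kernel_def)

lemma score_kernel_scale:
  assumes "0 < t"
  shows "spow a (t - x) + spow a x = t powr a * score_kernel a (x / t)"
proof -
  have "t * (1 - x / t) = t - x" "t * (x / t) = x"
    using assms by (simp_all add: right_diff_distrib)
  then have "spow a (t - x) = t powr a * spow a (1 - x / t)" "spow a x = t powr a * spow a (x / t)"
    using spow_mult[of t a "1 - x / t"] spow_mult[of t a "x / t"] assms by simp_all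
  then show ?thesis by (simp add: score_kernel_def distrib_left)
qed

text \<open>To the right of its centre of symmetry \<open>1 / 2\<close> the derivative
  \<open>a (|x|\<^sup>a\<^sup>-\<^sup>1 - |1 - x|\<^sup>a\<^sup>-\<^sup>1)\<close> is nonpositive, since \<open>x\<close> is farther from \<open>0\<close> than from \<open>1\<close>.
  The only singularity there is at \<open>1\<close>, where the interval is split.\<close>

lemma score_kernel_antimono:
  assumes a: "0 < a" "a \<le> 1" and xy: "1 / 2 \<le> x" "x \<le> y"
  shows "score_kernel a y \<le> score_kernel a x"
proof -
  have cont: "continuous_on S (score_kernel a)" for S
  proof (rule continuous_at_imp_continuous_on, rule ballI)
    fix z
    have "isCont (\<lambda>x. spow a (1 - x)) z"
      by (rule isCont_o2[OF _ isCont_spow[OF a(1)]]) (intro continuous_intros)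
    then show "isCont (score_kernel a) z"
      unfolding score_kernel_def[abs_def] by (rule isCont_add) (rule isCont_spow[OF a(1)])
  qed
  have piece: "score_kernel a v \<le> score_kernel a u" if uv: "1 / 2 \<le> u" "u \<le> v" and 1: "1 \<notin> {u<..<v}" for u v
  proof (cases "u < v")
    case True
    then show ?thesis
    proof (rule DERIV_nonpos_imp_decreasing_open[OF less_imp_le])
      fix z assume z: "u < z" "z < v"
      then have z': "1 / 2 < z" "z \<noteq> 1" using uv 1 by auto
      have "(score_kernel a has_real_derivative (a * \<bar>1 - z\<bar> powr (a - 1)) * (- 1) + a * \<bar>z\<bar> powr (a - 1)) (at z)"
        unfolding score_kernel_def[abs_def]
      proof (rule DERIV_add)
        show "((\<lambda>x. spow a (1 - x)) has_real_derivative (a * \<bar>1 - z\<bar> powr (a - 1)) * (- 1)) (at z)"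
          using z' by (intro DERIV_chain2[OF DERIV_spow]) (auto intro!: derivative_eq_intros)
        show "(spow a has_real_derivative a * \<bar>z\<bar> powr (a - 1)) (at z)"
          using z' by (intro DERIV_spow) auto
      qed
      moreover have "\<bar>z\<bar> powr (a - 1) \<le> \<bar>1 - z\<bar> powr (a - 1)"
        using z' a by (intro powr_mono2') auto
      then have "(a * \<bar>1 - z\<bar> powr (a - 1)) * (- 1) + a * \<bar>z\<bar> powr (a - 1) \<le> 0"
        using a by simp
      ultimately show "\<exists>d. DERIV (score_kernel a) z :> d \<and> d \<le> 0" by blast
    qed (rule cont)
  qed (use uv in auto)
  show ?thesis
  proof (cases "x < 1 \<and> 1 < y")
    case True
    then show ?thesis using piece[of x 1] piece[of 1 y] xy by auto
  next
    case False
    then show ?thesis using piece[of x y] xy by auto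
  qed
qed

lemma convex_realI:
  fixes S :: "real set"
  assumes "\<And>x y z. x \<in> S \<Longrightarrow> z \<in> S \<Longrightarrow> x \<le> y \<Longrightarrow> y \<le> z \<Longrightarrow> y \<in> S"
  shows "convex S"
  unfolding is_interval_convex_1[symmetric] is_interval_1 using assms by blast

text \<open>The kernel is unimodal about \<open>1 / 2\<close>; on the negative half-line it is monotone.\<close>

lemma convex_score_kernel_level:
  assumes a: "0 < a" "a \<le> 1" and h: "0 < h"
  shows "convex {x. h < (if 0 < x then score_kernel a x else 0)}"
    and "convex {x. h < (if 0 < x then score_kernel a (- x) else 0)}"
proof -
  show "convex {x. h < (if 0 < x then score_kernel a x else 0)}"
  proof (rule convex_realI)
    fix x y z :: real
    assume xz: "x \<in> {x. h < (if 0 < x then score_kernel a x else 0)}" "z \<in> {x. h < (if 0 < x then score_kernel a x else 0)}"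
      and "x \<le> y" "y \<le> z"
    then have k: "0 < x" "h < score_kernel a x" "h < score_kernel a z"
      using h by (auto split: if_splits)
    have "h < score_kernel a y"
    proof (cases "1 / 2 \<le> y")
      case True
      then show ?thesis using k score_kernel_antimono[OF a, of y z] \<open>y \<le> z\<close> by linarith
    next
      case False
      then have "score_kernel a (1 - x) \<le> score_kernel a (1 - y)"
        using \<open>x \<le> y\<close> by (intro score_kernel_antimono[OF a]) auto
      then show ?thesis using k by (simp add: score_kernel_reflect)
    qed
    then show "y \<in> {x. h < (if 0 < x then score_kernel a x else 0)}" using k(1) \<open>x \<le> y\<close> by simp
  qed
  show "convex {x. h < (if 0 < x then score_kernel a (- x) else 0)}"
  proof (rule convex_realI)
    fix x y z :: real
    assume xz: "x \<in> {x. h < (if 0 < x then score_kernel a (- x) else 0)}" "z \<in> {x. h < (if 0 < x then score_kernel a (- x) else 0)}"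
      and "x \<le> y" "y \<le> z"
    then have k: "0 < x" "h < score_kernel a (1 + z)"
      using h by (auto split: if_splits simp: score_kernel_uminus)
    have "score_kernel a (1 + z) \<le> score_kernel a (1 + y)"
      using k \<open>x \<le> y\<close> \<open>y \<le> z\<close> by (intro score_kernel_antimono[OF a]) auto
    then show "y \<in> {x. h < (if 0 < x then score_kernel a (- x) else 0)}"
      using k \<open>x \<le> y\<close> by (simp add: score_kernel_uminus)
  qed
qed

text \<open>The point \<open>0\<close> has at most the probability of \<open>[0, s]\<close>, which vanishes as \<open>s\<close> tends to \<open>0\<close>.\<close>

lemma power_law_null:
  fixes X :: "'w \<Rightarrow> real"
  assumes "prob_space M" and [measurable]: "X \<in> borel_measurable M" and b: "0 < b" "0 < \<rho>"
    and F1: "((\<lambda>s. measure M {\<omega> \<in> space M. 0 \<le> X \<omega> \<and> X \<omega> \<le> s} / (b * s powr \<rho>)) \<longlongrightarrow> 1) (at_right 0)"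
  shows "measure M {\<omega> \<in> space M. X \<omega> = 0} = 0" "AE \<omega> in M. X \<omega> \<noteq> 0"
proof -
  interpret prob_space M by fact
  show null: "prob {\<omega> \<in> space M. X \<omega> = 0} = 0"
  proof -
    have "((\<lambda>s. s powr (- \<rho>) * prob {\<omega> \<in> space M. 0 \<le> X \<omega> \<and> X \<omega> \<le> s}) \<longlongrightarrow> b * 1) (at_right 0)"
    proof (rule Lim_transform_eventually[OF tendsto_mult[OF tendsto_const F1]])
      show "eventually (\<lambda>s. b * (prob {\<omega> \<in> space M. 0 \<le> X \<omega> \<and> X \<omega> \<le> s} / (b * s powr \<rho>))
          = s powr (- \<rho>) * prob {\<omega> \<in> space M. 0 \<le> X \<omega> \<and> X \<omega> \<le> s}) (at_right 0)"
        using b by (intro always_eventually) (auto simp: powr_minus divide_inverse)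
    qed
    note ratio = this
    obtain K where K: "\<And>s. 0 < s \<Longrightarrow> prob {\<omega> \<in> space M. 0 \<le> X \<omega> \<and> X \<omega> \<le> s} \<le> K * s powr \<rho>"
      by (rule small_ball_bound[OF ratio prob_le_1 b(2)]) (blast intro: that)
    have "prob {\<omega> \<in> space M. X \<omega> = 0} \<le> 0"
    proof (rule le_zero_if_le_powr[OF b(2)])
      fix t :: real assume t: "0 < t"
      have "prob {\<omega> \<in> space M. X \<omega> = 0} \<le> prob {\<omega> \<in> space M. 0 \<le> X \<omega> \<and> X \<omega> \<le> t}"
        using t by (intro finite_measure_mono) auto
      then show "prob {\<omega> \<in> space M. X \<omega> = 0} \<le> K * t powr \<rho>" using K[OF t] by linarith
    qed
    then show ?thesis by (simp add: measure_le_0_iff)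
  qed
  then show "AE \<omega> in M. X \<omega> \<noteq> 0"
    by (subst AE_iff_measurable[OF _ refl]) (auto simp: emeasure_eq_measure)
qed

text \<open>As \<open>E \<psi>(X) = 0\<close>, the mean score equals \<open>E (\<psi>(t - X) + \<psi>(X)) = t\<^sup>a E k(X / t)\<close>, and the scaling limit
  applies separately to the positive and to the negative values of \<open>X\<close>.\<close>

lemma score_power_law_right:
  fixes X :: "'w \<Rightarrow> real"
  assumes "prob_space M" and a: "0 < a" and [measurable]: "X \<in> borel_measurable M"
    and b: "0 < b" "0 < \<rho>" "\<rho> < 1 - a"
    and F1: "((\<lambda>s. measure M {\<omega> \<in> space M. 0 \<le> X \<omega> \<and> X \<omega> \<le> s} / (b * s powr \<rho>)) \<longlongrightarrow> 1) (at_right 0)"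
    and F2: "((\<lambda>s. measure M {\<omega> \<in> space M. 0 \<le> - X \<omega> \<and> - X \<omega> \<le> s} / (b * s powr \<rho>)) \<longlongrightarrow> 1) (at_right 0)"
    and int: "integrable M (\<lambda>\<omega>. spow a (X \<omega>))" and mean: "(\<integral>\<omega>. spow a (X \<omega>) \<partial>M) = 0"
  shows "integrable lborel (\<lambda>x. score_kernel a x * \<bar>x\<bar> powr (\<rho> - 1))"
    and "((\<lambda>t. (\<integral>\<omega>. spow a (t - X \<omega>) \<partial>M) / spow (a + \<rho>) t)
      \<longlongrightarrow> b * \<rho> * (\<integral>x. score_kernel a x * \<bar>x\<bar> powr (\<rho> - 1) \<partial>lborel)) (at_right 0)"
proof -
  interpret prob_space M by fact
  have a1: "a \<le> 1" using b by linarith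
  let ?k = "score_kernel a"
  let ?f1 = "\<lambda>x. if 0 < x then ?k x else 0" and ?f2 = "\<lambda>x. if 0 < x then ?k (- x) else 0"
  note k_nonneg = less_imp_le[OF score_kernel_pos[OF a]]
  note null = power_law_null(1)[OF assms(1,3) b(1,2) F1] and nz = power_law_null(2)[OF assms(1,3) b(1,2) F1]
  have lim1: "(\<lambda>n. ennreal (t n powr (- \<rho>)) * (\<integral>\<^sup>+\<omega>. ennreal (?f1 (X \<omega> / t n)) \<partial>M)) \<longlonglongrightarrow> (\<integral>\<^sup>+x. ennreal (?f1 x) \<partial>power_law b \<rho>)"
    and fin1: "(\<integral>\<^sup>+x. ennreal (?f1 x) \<partial>power_law b \<rho>) < \<infinity>"
    and lim2: "(\<lambda>n. ennreal (t n powr (- \<rho>)) * (\<integral>\<^sup>+\<omega>. ennreal (?f2 (- X \<omega> / t n)) \<partial>M)) \<longlonglongrightarrow> (\<integral>\<^sup>+x. ennreal (?f2 x) \<partial>power_law b \<rho>)"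
    and fin2: "(\<integral>\<^sup>+x. ennreal (?f2 x) \<partial>power_law b \<rho>) < \<infinity>"
    if t: "\<And>n. 0 < t n" "t \<longlonglongrightarrow> 0" for t
  proof -
    have m: "?f1 \<in> borel_measurable borel" "?f2 \<in> borel_measurable borel" "(\<lambda>\<omega>. - X \<omega>) \<in> borel_measurable M"
      by measurable
    have z: "?f1 x = 0" "?f2 x = 0" if "x \<le> 0" for x using that by auto
    have le2: "?f1 x \<le> 2" "?f2 x \<le> 2" for x using score_kernel_le_2[OF a a1] by auto
    have decay: "?f1 x \<le> 4 * x powr (- (1 - a))" "?f2 x \<le> 4 * x powr (- (1 - a))" if "0 < x" for x
      using score_kernel_decay[OF a a1, of x] score_kernel_decay[OF a a1, of "- x"] that by auto
    have c: "(0 :: real) < 2" "(0 :: real) < 4" by simp_all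
    have null2: "prob {\<omega> \<in> space M. - X \<omega> = 0} = 0" using null by simp
    note level = convex_score_kernel_level[OF a a1]
    note pos = power_law_scaling_limit[OF prob_space_axioms assms(3) b F1 null m(1) z(1) le2(1) decay(1) c level(1) t]
    note neg = power_law_scaling_limit[OF prob_space_axioms m(3) b F2 null2 m(2) z(2) le2(2) decay(2) c level(2) t]
    show "(\<lambda>n. ennreal (t n powr (- \<rho>)) * (\<integral>\<^sup>+\<omega>. ennreal (?f1 (X \<omega> / t n)) \<partial>M)) \<longlonglongrightarrow> (\<integral>\<^sup>+x. ennreal (?f1 x) \<partial>power_law b \<rho>)"
      by (rule pos(1))
    show "(\<integral>\<^sup>+x. ennreal (?f1 x) \<partial>power_law b \<rho>) < \<infinity>" by (rule pos(2))
    show "(\<lambda>n. ennreal (t n powr (- \<rho>)) * (\<integral>\<^sup>+\<omega>. ennreal (?f2 (- X \<omega> / t n)) \<partial>M)) \<longlonglongrightarrow> (\<integral>\<^sup>+x. ennreal (?f2 x) \<partial>power_law b \<rho>)"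
      by (rule neg(1))
    show "(\<integral>\<^sup>+x. ennreal (?f2 x) \<partial>power_law b \<rho>) < \<infinity>" by (rule neg(2))
  qed
  let ?w = "\<lambda>x. b * \<rho> * (?k x * \<bar>x\<bar> powr (\<rho> - 1))"
  have w_eq: "(\<integral>\<^sup>+x. ennreal (?w x) \<partial>lborel) = (\<integral>\<^sup>+x. ennreal (?f1 x) \<partial>power_law b \<rho>) + (\<integral>\<^sup>+x. ennreal (?f2 x) \<partial>power_law b \<rho>)"
  proof -
    have "(\<integral>\<^sup>+x. ennreal (?w x) \<partial>lborel) = (\<integral>\<^sup>+x. ennreal (?w x) * indicator {0<..} x + ennreal (?w x) * indicator {..<0} x \<partial>lborel)"
      using AE_lborel_singleton[of 0] by (intro nn_integral_cong_AE) (auto simp: indicator_def)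
    also have "\<dots> = (\<integral>\<^sup>+x. ennreal (?w x) * indicator {0<..} x \<partial>lborel) + (\<integral>\<^sup>+x. ennreal (?w x) * indicator {..<0} x \<partial>lborel)"
      by (rule nn_integral_add) auto
    also have "(\<integral>\<^sup>+x. ennreal (?w x) * indicator {..<0} x \<partial>lborel) = (\<integral>\<^sup>+x. ennreal (?w (- x)) * indicator {..<0} (- x) \<partial>lborel)"
      using nn_integral_real_affine[of "\<lambda>x. ennreal (?w x) * indicator {..<0} x" "-1" 0] by simp
    also have "\<dots> = (\<integral>\<^sup>+x. ennreal (?f2 x) \<partial>power_law b \<rho>)"
      using b k_nonneg
      by (subst nn_integral_power_law) (auto intro!: nn_integral_cong simp: indicator_def ennreal_mult' [symmetric] mult_ac)
    also have "(\<integral>\<^sup>+x. ennreal (?w x) * indicator {0<..} x \<partial>lborel) = (\<integral>\<^sup>+x. ennreal (?f1 x) \<partial>power_law b \<rho>)"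
      using b k_nonneg
      by (subst nn_integral_power_law) (auto intro!: nn_integral_cong simp: indicator_def ennreal_mult' [symmetric] mult_ac)
    finally show ?thesis .
  qed
  have w_fin: "(\<integral>\<^sup>+x. ennreal (?w x) \<partial>lborel) < \<infinity>"
  proof -
    have "(\<lambda>n. inverse (real (Suc n))) \<longlonglongrightarrow> 0" by (rule LIMSEQ_inverse_real_of_nat)
    then show ?thesis using fin1[of "\<lambda>n. inverse (real (Suc n))"] fin2[of "\<lambda>n. inverse (real (Suc n))"]
      unfolding w_eq by (simp add: ennreal_add_less_top)
  qed
  have w_int: "integrable lborel ?w"
    using w_fin b k_nonneg by (intro integrableI_nonneg) auto
  then show kint: "integrable lborel (\<lambda>x. ?k x * \<bar>x\<bar> powr (\<rho> - 1))"
    using b by (simp add: integrable_mult_right_iff)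
  define V where "V = b * \<rho> * (\<integral>x. ?k x * \<bar>x\<bar> powr (\<rho> - 1) \<partial>lborel)"
  have V: "(\<integral>\<^sup>+x. ennreal (?w x) \<partial>lborel) = ennreal V" "0 \<le> V"
    using w_int b k_nonneg by (auto simp: V_def nn_integral_eq_integral)
  have int_k: "integrable M (\<lambda>\<omega>. ?k (X \<omega> / s))" for s
    using k_nonneg score_kernel_le_2[OF a a1] by (intro integrable_const_bound[where B=2]) auto
  have int_sum: "integrable M (\<lambda>\<omega>. spow a (s - X \<omega>) + spow a (X \<omega>))" for s
    using spow_shift_bound[OF a a1]
    by (intro integrable_const_bound[where B="2 * \<bar>s\<bar> powr a"]) auto
  have score: "expectation (\<lambda>\<omega>. spow a (s - X \<omega>)) / spow (a + \<rho>) s = s powr (- \<rho>) * expectation (\<lambda>\<omega>. ?k (X \<omega> / s))" if "0 < s" for s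
  proof -
    have "expectation (\<lambda>\<omega>. spow a (s - X \<omega>)) = expectation (\<lambda>\<omega>. spow a (s - X \<omega>) + spow a (X \<omega>))"
      using int mean Bochner_Integration.integrable_diff[OF int_sum int, of s] by simp
    also have "\<dots> = s powr a * expectation (\<lambda>\<omega>. ?k (X \<omega> / s))"
      using that by (simp add: score_kernel_scale)
    finally show ?thesis using that by (simp add: spow_pos powr_add powr_minus field_simps)
  qed
  show "((\<lambda>t. (\<integral>\<omega>. spow a (t - X \<omega>) \<partial>M) / spow (a + \<rho>) t) \<longlongrightarrow> b * \<rho> * (\<integral>x. ?k x * \<bar>x\<bar> powr (\<rho> - 1) \<partial>lborel)) (at_right 0)"
    unfolding tendsto_at_iff_sequentially comp_def V_def[symmetric]
  proof (intro allI impI)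
    fix t :: "nat \<Rightarrow> real" assume "\<forall>n. t n \<in> {0<..} - {0}" and t0: "t \<longlonglongrightarrow> 0"
    then have t: "0 < t n" for n by auto
    have split: "(\<integral>\<^sup>+\<omega>. ennreal (?k (X \<omega> / s)) \<partial>M) = (\<integral>\<^sup>+\<omega>. ennreal (?f1 (X \<omega> / s)) \<partial>M) + (\<integral>\<^sup>+\<omega>. ennreal (?f2 (- X \<omega> / s)) \<partial>M)" if "0 < s" for s
    proof -
      have "(\<integral>\<^sup>+\<omega>. ennreal (?k (X \<omega> / s)) \<partial>M) = (\<integral>\<^sup>+\<omega>. ennreal (?f1 (X \<omega> / s)) + ennreal (?f2 (- X \<omega> / s)) \<partial>M)"
        using nz
        by (intro nn_integral_cong_AE, eventually_elim) (use that in \<open>auto simp: zero_less_divide_iff divide_less_0_iff\<close>)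
      also have "\<dots> = (\<integral>\<^sup>+\<omega>. ennreal (?f1 (X \<omega> / s)) \<partial>M) + (\<integral>\<^sup>+\<omega>. ennreal (?f2 (- X \<omega> / s)) \<partial>M)"
        by (rule nn_integral_add) auto
      finally show ?thesis .
    qed
    have "(\<lambda>n. ennreal (t n powr (- \<rho>)) * (\<integral>\<^sup>+\<omega>. ennreal (?k (X \<omega> / t n)) \<partial>M)) \<longlonglongrightarrow> ennreal V"
      unfolding split[OF t] distrib_left V(1)[symmetric] w_eq
      by (intro tendsto_add lim1 lim2 t t0)
    also have "(\<lambda>n. ennreal (t n powr (- \<rho>)) * (\<integral>\<^sup>+\<omega>. ennreal (?k (X \<omega> / t n)) \<partial>M))
       = (\<lambda>n. ennreal (t n powr (- \<rho>) * expectation (\<lambda>\<omega>. ?k (X \<omega> / t n))))"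
      using int_k k_nonneg by (simp add: nn_integral_eq_integral ennreal_mult integral_nonneg_AE)
    finally have "(\<lambda>n. t n powr (- \<rho>) * expectation (\<lambda>\<omega>. ?k (X \<omega> / t n))) \<longlonglongrightarrow> V"
      using V(2) k_nonneg by (subst (asm) tendsto_ennreal_iff) (auto intro!: always_eventually)
    then show "(\<lambda>n. expectation (\<lambda>\<omega>. spow a (t n - X \<omega>)) / spow (a + \<rho>) (t n)) \<longlonglongrightarrow> V"
      using t by (simp add: score)
  qed
qed

text \<open>Negative \<open>t\<close> reduce to positive ones by passing from \<open>X\<close> to \<open>- X\<close>, which exchanges the two
  hypotheses and preserves the constant.\<close>

theorem score_power_law:
  fixes X :: "'w \<Rightarrow> real"
  assumes "prob_space M" and a: "0 < a" and [measurable]: "X \<in> borel_measurable M"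
    and b: "0 < b" "0 < \<rho>" "\<rho> < 1 - a"
    and F1: "((\<lambda>s. measure M {\<omega> \<in> space M. 0 \<le> X \<omega> \<and> X \<omega> \<le> s} / (b * s powr \<rho>)) \<longlongrightarrow> 1) (at_right 0)"
    and F2: "((\<lambda>s. measure M {\<omega> \<in> space M. 0 \<le> - X \<omega> \<and> - X \<omega> \<le> s} / (b * s powr \<rho>)) \<longlongrightarrow> 1) (at_right 0)"
    and int: "integrable M (\<lambda>\<omega>. spow a (X \<omega>))" and mean: "(\<integral>\<omega>. spow a (X \<omega>) \<partial>M) = 0"
  shows "0 < (\<integral>x. score_kernel a x * \<bar>x\<bar> powr (\<rho> - 1) \<partial>lborel)"
    and "((\<lambda>t. (\<integral>\<omega>. spow a (t - X \<omega>) \<partial>M) / spow (a + \<rho>) t)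
      \<longlongrightarrow> b * \<rho> * (\<integral>x. score_kernel a x * \<bar>x\<bar> powr (\<rho> - 1) \<partial>lborel)) (at 0)"
proof -
  let ?V = "b * \<rho> * (\<integral>x. score_kernel a x * \<bar>x\<bar> powr (\<rho> - 1) \<partial>lborel)"
  note right = score_power_law_right[OF assms(1-6) F1 F2 int mean]
  have "((\<lambda>t. (\<integral>\<omega>. spow a (t - - X \<omega>) \<partial>M) / spow (a + \<rho>) t) \<longlongrightarrow> ?V) (at_right 0)"
    using F1 F2 int mean by (intro score_power_law_right[OF assms(1,2) _ b]) auto
  moreover have "(\<integral>\<omega>. spow a (t - - X \<omega>) \<partial>M) / spow (a + \<rho>) t = (\<integral>\<omega>. spow a (- t - X \<omega>) \<partial>M) / spow (a + \<rho>) (- t)" for t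
  proof -
    have "spow a (- t - X \<omega>) = - spow a (t - - X \<omega>)" for \<omega>
      using spow_minus[of a "t - - X \<omega>"] by simp
    then show ?thesis by simp
  qed
  ultimately have "((\<lambda>t. (\<integral>\<omega>. spow a (t - X \<omega>) \<partial>M) / spow (a + \<rho>) t) \<longlongrightarrow> ?V) (at_left 0)"
    by (simp add: filterlim_at_left_to_right)
  then show "((\<lambda>t. (\<integral>\<omega>. spow a (t - X \<omega>) \<partial>M) / spow (a + \<rho>) t) \<longlongrightarrow> ?V) (at 0)"
    using right(2) by (rule filterlim_split_at)
  let ?w = "\<lambda>x. score_kernel a x * \<bar>x\<bar> powr (\<rho> - 1)"
  have pos: "AE x in lborel. 0 < ?w x"
    using AE_lborel_singleton[of 0] by eventually_elim (simp add: score_kernel_pos[OF a])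
  then have nonneg: "AE x in lborel. 0 \<le> ?w x" by eventually_elim simp
  have "(\<integral>x. ?w x \<partial>lborel) \<noteq> 0"
  proof
    assume "(\<integral>x. ?w x \<partial>lborel) = 0"
    then have "AE x in lborel. ?w x = 0"
      using integral_nonneg_eq_0_iff_AE[OF right(1) nonneg] by simp
    with pos have "AE x :: real in lborel. False" by eventually_elim simp
    then show False by (simp add: eventually_False ae_filter_eq_bot_iff)
  qed
  with integral_nonneg_AE[OF nonneg] show "0 < (\<integral>x. ?w x \<partial>lborel)" by linarith
qed

section \<open>Reduction of Frechet means to real coordinates\<close>

lemma (in prob_space) indep_sets_reindex:
  assumes f: "inj_on f I" and F: "indep_sets F (f ` I)"
  shows "indep_sets (\<lambda>i. F (f i)) I"
proof (rule indep_setsI)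
  fix i assume "i \<in> I"
  then show "F (f i) \<subseteq> events" using F by (auto simp: indep_sets_def)
next
  fix A K assume K: "K \<noteq> {}" "K \<subseteq> I" "finite K" and A: "\<forall>j\<in>K. A j \<in> F (f j)"
  have inj: "inj_on f K" using f K(2) by (rule inj_on_subset)
  let ?A = "\<lambda>j. A (inv_into K f j)"
  have "prob (\<Inter>j\<in>f ` K. ?A j) = (\<Prod>j\<in>f ` K. prob (?A j))"
    using K A inj by (intro indep_setsD[OF F]) auto
  moreover have "(\<Inter>j\<in>f ` K. ?A j) = (\<Inter>j\<in>K. A j)" using inj by simp
  moreover have "(\<Prod>j\<in>f ` K. prob (?A j)) = (\<Prod>j\<in>K. prob (A j))"
    using inj by (simp add: prod.reindex)
  ultimately show "prob (\<Inter>j\<in>K. A j) = (\<Prod>j\<in>K. prob (A j))" by simp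
qed

lemma (in prob_space) indep_vars_reindex:
  assumes "inj_on f I" "indep_vars M' X (f ` I)"
  shows "indep_vars (\<lambda>i. M' (f i)) (\<lambda>i. X (f i)) I"
  using assms indep_sets_reindex[OF assms(1)] unfolding indep_vars_def2 by auto

lemma dist_moment_pos_exponent:
  fixes Y :: "'w \<Rightarrow> 'a::metric_space"
  assumes Y [measurable]: "Y \<in> borel_measurable M" and \<phi>: "0 < \<phi>" and fin: "dist_moment M Y q \<phi> < \<infinity>"
  shows "integrable M (\<lambda>\<omega>. dist (Y \<omega>) q powr \<phi>)"
    and "enn2real (dist_moment M Y q \<phi>) = (\<integral>\<omega>. dist (Y \<omega>) q powr \<phi> \<partial>M)"
proof -
  have [measurable]: "(\<lambda>\<omega>. dist (Y \<omega>) q) \<in> borel_measurable M"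
    by (rule measurable_compose[OF Y borel_measurable_continuous_onI]) (auto intro!: continuous_intros)
  have "epow x \<phi> = ennreal (x powr \<phi>)" for x using \<phi> by (simp add: epow_def)
  then have eq: "dist_moment M Y q \<phi> = (\<integral>\<^sup>+\<omega>. ennreal (dist (Y \<omega>) q powr \<phi>) \<partial>M)"
    by (simp add: dist_moment_def)
  then show int: "integrable M (\<lambda>\<omega>. dist (Y \<omega>) q powr \<phi>)"
    using fin by (intro integrableI_nonneg) auto
  show "enn2real (dist_moment M Y q \<phi>) = (\<integral>\<omega>. dist (Y \<omega>) q powr \<phi> \<partial>M)"
    unfolding eq using int by (simp add: nn_integral_eq_integral)
qed

text \<open>An empirical mean is a Frechet mean with respect to the counting measure on the sample indices.\<close>

lemma empirical_frechet_mean_on_geodesic: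
  fixes y :: "nat \<Rightarrow> 'a::hadamard_space" and h :: "'a \<Rightarrow> real"
  assumes n: "1 \<le> n" and \<alpha>: "1 < \<alpha>" "\<alpha> \<le> 2"
    and \<gamma>: "unit_speed_geodesic J \<gamma>" "closed J"
    and h: "continuous_on UNIV h" "\<And>s. s \<in> J \<Longrightarrow> h (\<gamma> s) = s"
    and y: "\<And>j. 1 \<le> j \<Longrightarrow> j \<le> n \<Longrightarrow> y j \<in> \<gamma> ` J"
    and m: "is_empirical_frechet_mean \<alpha> n y m"
  shows "h m \<in> J" "\<gamma> (h m) = m" "(\<Sum>j<n. spow (\<alpha> - 1) (h m - h (y (Suc j)))) = 0"
proof -
  let ?C = "count_space {1..n}"
  have C: "finite_measure ?C" by (rule finite_measure_count_space) simp
  have nz: "emeasure ?C (space ?C) \<noteq> 0" using n by simp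
  have meas: "y \<in> borel_measurable ?C" by simp
  have int: "integrable ?C (\<lambda>j. dist (y j) m powr (\<alpha> - 1))" by (rule integrable_count_space) simp
  have AE: "AE j in ?C. y j \<in> \<gamma> ` J" using y by (simp add: AE_count_space)
  have eq: "(\<integral>j. dist (y j) q powr \<alpha> - dist (y j) m powr \<alpha> \<partial>?C)
      = (\<Sum>j=1..n. dist (y j) q powr \<alpha>) - (\<Sum>j=1..n. dist (y j) m powr \<alpha>)" for q
    by (simp add: lebesgue_integral_count_space_finite sum_subtractf)
  have "is_frechet_mean \<alpha> ?C y m m"
    using m unfolding is_frechet_mean_def is_empirical_frechet_mean_def eq by (simp add: is_arg_min_def)
  note * = frechet_mean_on_geodesic[OF C nz \<alpha> meas int \<gamma> h AE this]
  show "h m \<in> J" by (rule *(1))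
  show "\<gamma> (h m) = m" by (rule *(2))
  have "(\<Sum>j=1..n. spow (\<alpha> - 1) (h m - h (y j))) = 0"
    using *(3) by (simp add: lebesgue_integral_count_space_finite)
  then show "(\<Sum>j<n. spow (\<alpha> - 1) (h m - h (y (Suc j)))) = 0"
    by (simp add: sum.atLeast1_atMost_eq)
qed

text \<open>All that the asymptotics need to know about the geometry: the real coordinates, relative to that of
  \<open>m\<close>, of \<open>Y\<close>, of the sample and of the empirical means. The geodesic is first extended to the closure of
  its interval. The mean still lies on the original geodesic: if its coordinate were an end point missing from \<open>I\<close>, then \<open>X\<close>
  would have a strict sign, contrary to \<open>E \<psi>(X) = 0\<close>.\<close>

theorem frechet_mean_coordinates:
  fixes M :: "'w measure" and Y :: "'w \<Rightarrow> 'a::hadamard_space" and Ys :: "nat \<Rightarrow> 'w \<Rightarrow> 'a"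
    and I :: "real set" and \<gamma> :: "real \<Rightarrow> 'a"
  assumes "prob_space M" and \<alpha>: "1 < \<alpha>" "\<alpha> \<le> 2"
    and Y [measurable]: "Y \<in> borel_measurable M"
    and p: "dist_moment M Y p (\<alpha> - 1) < \<infinity>"
    and \<gamma>: "unit_speed_geodesic I \<gamma>"
    and conc: "measure M {\<omega> \<in> space M. Y \<omega> \<in> \<gamma> ` I} = 1"
    and m: "is_frechet_mean \<alpha> M Y p m"
    and ind: "prob_space.indep_vars M (\<lambda>_. borel) Ys {1..}"
    and distr: "\<And>j. 1 \<le> j \<Longrightarrow> distr M borel (Ys j) = distr M borel Y"
    and mn: "\<And>n. 1 \<le> n \<Longrightarrow> mn n \<in> borel_measurable M"
    and emp: "\<And>n. 1 \<le> n \<Longrightarrow> AE \<omega> in M. is_empirical_frechet_mean \<alpha> n (\<lambda>j. Ys j \<omega>) (mn n \<omega>)"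
    and sq: "dist_moment M Y m (2 * \<alpha> - 2) < \<infinity>"
  obtains X :: "'w \<Rightarrow> real" and Xs T :: "nat \<Rightarrow> 'w \<Rightarrow> real"
  where "X \<in> borel_measurable M" "AE \<omega> in M. dist (Y \<omega>) m = \<bar>X \<omega>\<bar>"
    and "AE \<omega> in M. inv_into I \<gamma> (Y \<omega>) - inv_into I \<gamma> m = X \<omega>"
    and "integrable M (\<lambda>\<omega>. spow (\<alpha> - 1) (X \<omega>))" "(\<integral>\<omega>. spow (\<alpha> - 1) (X \<omega>) \<partial>M) = 0"
    and "integrable M (\<lambda>\<omega>. \<bar>X \<omega>\<bar> powr (2 * \<alpha> - 2))"
    and "(\<integral>\<omega>. \<bar>X \<omega>\<bar> powr (2 * \<alpha> - 2) \<partial>M) = enn2real (dist_moment M Y m (2 * \<alpha> - 2))"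
    and "prob_space.indep_vars M (\<lambda>_. borel) Xs UNIV" "\<And>j. distr M borel (Xs j) = distr M borel X"
    and "\<And>n. T n \<in> borel_measurable M"
    and "\<And>n. 1 \<le> n \<Longrightarrow> AE \<omega> in M. (\<Sum>j<n. spow (\<alpha> - 1) (T n \<omega> - Xs j \<omega>)) = 0"
    and "\<And>n. 1 \<le> n \<Longrightarrow> AE \<omega> in M. dist m (mn n \<omega>) = \<bar>T n \<omega>\<bar>"
proof -
  interpret prob_space M by fact
  obtain \<gamma>' where \<gamma>': "unit_speed_geodesic (closure I) \<gamma>'" "\<And>s. s \<in> I \<Longrightarrow> \<gamma>' s = \<gamma> s"
    using geodesic_closure[OF \<gamma>] by blast
  define J where "J = closure I"
  have J: "unit_speed_geodesic J \<gamma>'" "closed J" "I \<subseteq> J"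
    using \<gamma>' closure_subset by (auto simp: J_def)
  obtain h where h: "continuous_on UNIV h" "\<And>s. s \<in> J \<Longrightarrow> h (\<gamma>' s) = s"
    using geodesic_coordinate[OF J(1)] by blast
  have [measurable]: "h \<in> borel_measurable borel" using h(1) by (rule borel_measurable_continuous_onI)
  have d: "dist (\<gamma>' s) (\<gamma>' t) = \<bar>s - t\<bar>" if "s \<in> J" "t \<in> J" for s t
    using J(1) that by (simp add: unit_speed_geodesic_def)
  have YI: "AE \<omega> in M. Y \<omega> \<in> \<gamma> ` I"
    using AE_prob_1[OF conc] by eventually_elim simp
  have img: "\<gamma> ` I \<subseteq> \<gamma>' ` J" using \<gamma>'(2) J(3) by force
  have YJ: "AE \<omega> in M. Y \<omega> \<in> \<gamma>' ` J" using YI by eventually_elim (use img in blast)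
  have p_int: "integrable M (\<lambda>\<omega>. dist (Y \<omega>) p powr (\<alpha> - 1))"
    using dist_moment_pos_exponent(1)[OF Y _ p] \<alpha> by simp
  define x0 where "x0 = h m"
  note mean = frechet_mean_on_geodesic[OF finite_measure_axioms _ \<alpha> Y p_int J(1,2) h YJ m, folded x0_def]
  have x0: "x0 \<in> J" "\<gamma>' x0 = m" and score: "(\<integral>\<omega>. spow (\<alpha> - 1) (x0 - h (Y \<omega>)) \<partial>M) = 0"
    using mean by (simp_all add: emeasure_space_1)
  define X where "X \<omega> = h (Y \<omega>) - x0" for \<omega>
  have X_meas [measurable]: "X \<in> borel_measurable M" unfolding X_def[abs_def] by measurable
  have X_I: "AE \<omega> in M. X \<omega> + x0 \<in> I \<and> Y \<omega> = \<gamma> (X \<omega> + x0)"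
    using YI
  proof eventually_elim
    case (elim \<omega>)
    then obtain s where s: "s \<in> I" "Y \<omega> = \<gamma> s" by blast
    then have "h (Y \<omega>) = s" using h(2)[of s] \<gamma>'(2)[of s] J(3) by auto
    then show ?case using s by (simp add: X_def)
  qed
  have X_dist: "AE \<omega> in M. dist (Y \<omega>) m = \<bar>X \<omega>\<bar>"
    using X_I
  proof eventually_elim
    case (elim \<omega>)
    then have "dist (Y \<omega>) m = dist (\<gamma>' (X \<omega> + x0)) (\<gamma>' x0)" using \<gamma>'(2) x0(2) by simp
    then show ?case using elim d x0(1) J(3) by auto
  qed
  have exp2: "0 < 2 * \<alpha> - 2" using \<alpha> by simp
  note sq_m = dist_moment_pos_exponent[OF Y exp2 sq]
  have eq2: "AE \<omega> in M. dist (Y \<omega>) m powr (2 * \<alpha> - 2) = \<bar>X \<omega>\<bar> powr (2 * \<alpha> - 2)"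
    using X_dist by eventually_elim simp
  have X_sq: "integrable M (\<lambda>\<omega>. \<bar>X \<omega>\<bar> powr (2 * \<alpha> - 2))"
    using sq_m(1) by (rule integrable_cong_AE_imp) (use eq2 in auto)
  have X_sq': "(\<integral>\<omega>. \<bar>X \<omega>\<bar> powr (2 * \<alpha> - 2) \<partial>M) = enn2real (dist_moment M Y m (2 * \<alpha> - 2))"
    unfolding sq_m(2)
  proof (rule integral_cong_AE)
    show "(\<lambda>\<omega>. dist (Y \<omega>) m powr (2 * \<alpha> - 2)) \<in> borel_measurable M" using sq_m(1) by simp
    show "AE \<omega> in M. \<bar>X \<omega>\<bar> powr (2 * \<alpha> - 2) = dist (Y \<omega>) m powr (2 * \<alpha> - 2)"
      using eq2 by eventually_elim simp
  qed simp
  have X_int: "integrable M (\<lambda>\<omega>. spow (\<alpha> - 1) (X \<omega>))"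
  proof (rule square_integrable_imp_integrable)
    show "integrable M (\<lambda>\<omega>. (spow (\<alpha> - 1) (X \<omega>))\<^sup>2)"
      using X_sq by (simp add: spow_power2 right_diff_distrib)
  qed simp
  have flip: "spow (\<alpha> - 1) (x0 - h (Y \<omega>)) = - spow (\<alpha> - 1) (X \<omega>)" for \<omega>
    using spow_minus[of "\<alpha> - 1" "X \<omega>"] by (simp add: X_def)
  have X_mean: "(\<integral>\<omega>. spow (\<alpha> - 1) (X \<omega>) \<partial>M) = 0"
    using score unfolding flip by simp
  have x0_I: "x0 \<in> I"
  proof (rule ccontr)
    assume "x0 \<notin> I"
    have conv: "convex I" using \<gamma> by (simp add: unit_speed_geodesic_def)
    have side: "(\<forall>s\<in>I. s < x0) \<or> (\<forall>s\<in>I. x0 < s)"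
    proof (rule ccontr)
      assume "\<not> ?thesis"
      then obtain s t where "s \<in> I" "x0 \<le> s" "t \<in> I" "t \<le> x0" by (auto simp: not_less)
      then show False using \<open>x0 \<notin> I\<close> conv by (meson is_interval_convex_1 mem_is_interval_1_I)
    qed
    have strict: False
      if "integrable M f" "AE \<omega> in M. 0 < f \<omega>" "expectation f = 0" for f :: "'w \<Rightarrow> real"
    proof -
      have nonneg: "AE \<omega> in M. 0 \<le> f \<omega>" using that(2) by eventually_elim simp
      have "AE \<omega> in M. f \<omega> = 0"
        using integral_nonneg_eq_0_iff_AE[OF that(1) nonneg] that(3) by simp
      with that(2) have "AE \<omega> in M. False" by eventually_elim simp
      then show False by simp
    qed
    from side show False
    proof
      assume s: "\<forall>s\<in>I. s < x0"
      have "AE \<omega> in M. 0 < - spow (\<alpha> - 1) (X \<omega>)"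
        using X_I
      proof eventually_elim
        case (elim \<omega>)
        then have "X \<omega> < 0" using s by auto
        then show ?case by (simp add: spow_neg)
      qed
      then show False using X_int X_mean by (intro strict[of "\<lambda>\<omega>. - spow (\<alpha> - 1) (X \<omega>)"]) auto
    next
      assume s: "\<forall>s\<in>I. x0 < s"
      have "AE \<omega> in M. 0 < spow (\<alpha> - 1) (X \<omega>)"
        using X_I
      proof eventually_elim
        case (elim \<omega>)
        then have "0 < X \<omega>" using s by fastforce
        then show ?case by (simp add: spow_pos)
      qed
      then show False using X_int X_mean by (intro strict[of "\<lambda>\<omega>. spow (\<alpha> - 1) (X \<omega>)"]) auto
    qed
  qed
  have inj: "inj_on \<gamma> I"
    using \<gamma> by (auto simp: unit_speed_geodesic_def inj_on_def) (metis abs_0_eq dist_self eq_iff_diff_eq_0)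
  have X_inv: "AE \<omega> in M. inv_into I \<gamma> (Y \<omega>) - inv_into I \<gamma> m = X \<omega>"
    using X_I
  proof eventually_elim
    case (elim \<omega>)
    have "m = \<gamma> x0" using x0(2) \<gamma>'(2)[OF x0_I] by simp
    then have "inv_into I \<gamma> m = x0" using inv_into_f_f[OF inj x0_I] by simp
    moreover have "inv_into I \<gamma> (Y \<omega>) = X \<omega> + x0" using inv_into_f_f[OF inj] elim by metis
    ultimately show ?case by simp
  qed
  define Xs where "Xs j \<omega> = h (Ys (Suc j) \<omega>) - x0" for j \<omega>
  have Ys_meas [measurable]: "Ys j \<in> borel_measurable M" if "1 \<le> j" for j
    using ind that unfolding indep_vars_def2 by simp
  have Xs_ind: "indep_vars (\<lambda>_. borel) Xs UNIV"
  proof -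
    have "Suc ` UNIV = {1..}" by (auto simp: image_iff) (metis Suc_le_D)
    then have "indep_vars (\<lambda>_. borel) (\<lambda>j. Ys (Suc j)) UNIV"
      using indep_vars_reindex[of Suc UNIV "\<lambda>_. borel" Ys] ind by simp
    then show ?thesis
      using indep_vars_compose2[of "\<lambda>_. borel" "\<lambda>j. Ys (Suc j)" UNIV "\<lambda>_ y. h y - x0" "\<lambda>_. borel"]
      by (simp add: Xs_def[abs_def])
  qed
  have Xs_distr: "distr M borel (Xs j) = distr M borel X" for j
  proof -
    have "distr M borel (Xs j) = distr (distr M borel (Ys (Suc j))) borel (\<lambda>y. h y - x0)"
      by (subst distr_distr) (auto simp: comp_def Xs_def[abs_def])
    also have "distr M borel (Ys (Suc j)) = distr M borel Y" by (rule distr) simp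
    also have "distr (distr M borel Y) borel (\<lambda>y. h y - x0) = distr M borel X"
      by (subst distr_distr) (auto simp: comp_def X_def[abs_def])
    finally show ?thesis .
  qed
  have Ys_J: "AE \<omega> in M. Ys j \<omega> \<in> \<gamma>' ` J" if "1 \<le> j" for j
  proof -
    have [measurable]: "\<gamma>' ` J \<in> sets borel" using closed_geodesic_image[OF J(1,2) h] by simp
    have "AE y in distr M borel Y. y \<in> \<gamma>' ` J" using YJ by (subst AE_distr_iff) auto
    then have "AE y in distr M borel (Ys j). y \<in> \<gamma>' ` J" unfolding distr[OF that] .
    then show ?thesis by (rule AE_distrD[OF Ys_meas[OF that]])
  qed
  \<comment> \<open>Nothing is known about \<open>mn 0\<close>; the value 0 makes \<open>T 0\<close> measurable.\<close>
  define T where "T n \<omega> = (if n = 0 then 0 else h (mn n \<omega>) - x0)" for n \<omega>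
  have T_meas: "T n \<in> borel_measurable M" for n
  proof (cases "n = 0")
    case False
    then have [measurable]: "mn n \<in> borel_measurable M" by (intro mn) simp
    show ?thesis using False unfolding T_def[abs_def] by simp
  qed (simp add: T_def[abs_def])
  have T_all: "AE \<omega> in M. (\<Sum>j<n. spow (\<alpha> - 1) (T n \<omega> - Xs j \<omega>)) = 0 \<and> dist m (mn n \<omega>) = \<bar>T n \<omega>\<bar>" if n: "1 \<le> n" for n
  proof -
    have "AE \<omega> in M. \<forall>j\<in>{1..n}. Ys j \<omega> \<in> \<gamma>' ` J"
      using Ys_J by (intro AE_finite_allI) auto
    with emp[OF n] show ?thesis
    proof eventually_elim
      case (elim \<omega>)
      note e = empirical_frechet_mean_on_geodesic[OF n \<alpha> J(1,2) h _ elim(1)]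
      have hm: "h (mn n \<omega>) \<in> J" "\<gamma>' (h (mn n \<omega>)) = mn n \<omega>"
        and sum: "(\<Sum>j<n. spow (\<alpha> - 1) (h (mn n \<omega>) - h (Ys (Suc j) \<omega>))) = 0"
        using e elim(2) by auto
      have "dist m (mn n \<omega>) = \<bar>x0 - h (mn n \<omega>)\<bar>"
        using d[OF x0(1) hm(1)] x0(2) hm(2) by simp
      then show ?case using n sum by (simp add: T_def Xs_def abs_minus_commute)
    qed
  qed
  show ?thesis
  proof (rule that[OF X_meas X_dist X_inv X_int X_mean X_sq X_sq' Xs_ind Xs_distr T_meas])
    fix n :: nat assume n: "1 \<le> n"
    show "AE \<omega> in M. (\<Sum>j<n. spow (\<alpha> - 1) (T n \<omega> - Xs j \<omega>)) = 0"
      using T_all[OF n] by eventually_elim simp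
    show "AE \<omega> in M. dist m (mn n \<omega>) = \<bar>T n \<omega>\<bar>"
      using T_all[OF n] by eventually_elim simp
  qed
qed
section \<open>Asymptotic lower bounds for the risk of the empirical Frechet mean\<close>

theorem corollary5p10:
  fixes M :: "'w measure"
    and Y :: "'w \<Rightarrow> 'a::hadamard_space"
    and Ys :: "nat \<Rightarrow> 'w \<Rightarrow> 'a"
    and I :: "real set" and \<gamma> :: "real \<Rightarrow> 'a"
    and p m :: 'a and mn :: "nat \<Rightarrow> 'w \<Rightarrow> 'a"
    and \<alpha> :: real and g :: "real \<Rightarrow> real"
  assumes "prob_space M"
    and "1 < \<alpha>" and "\<alpha> \<le> 2"
    and "Y \<in> borel_measurable M"
    and "dist_moment M Y p (\<alpha> - 1) < \<infinity>"
    and "unit_speed_geodesic I \<gamma>"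
    and "measure M {\<omega> \<in> space M. Y \<omega> \<in> \<gamma> ` I} = 1"
    and "is_frechet_mean \<alpha> M Y p m"
    and "prob_space.indep_vars M (\<lambda>_. borel) Ys {1..}"
    and "\<And>j. 1 \<le> j \<Longrightarrow> distr M borel (Ys j) = distr M borel Y"
    and "\<And>n. 1 \<le> n \<Longrightarrow> mn n \<in> borel_measurable M"
    and "\<And>n. 1 \<le> n \<Longrightarrow>
           AE \<omega> in M. is_empirical_frechet_mean \<alpha> n (\<lambda>j. Ys j \<omega>) (mn n \<omega>)"
    and "dist_moment M Y m (2 * \<alpha> - 2) < \<infinity>"
    and "\<And>x. 0 \<le> x \<Longrightarrow> 0 \<le> g x"
    and "lower_semicontinuous_on {0..} g"
  shows
    "((\<exists>\<beta>>2. ((\<lambda>t. t powr (\<alpha> - \<beta>) * measure M {\<omega> \<in> space M. dist (Y \<omega>) m \<le> t})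
               \<longlongrightarrow> 0) (at_right 0))
      \<longrightarrow>
        dist_moment M Y m (\<alpha> - 2) < \<infinity> \<and>
        liminf (\<lambda>n. \<integral>\<^sup>+\<omega>. ennreal (g (sqrt (real n) * dist m (mn n \<omega>))) \<partial>M)
          \<ge> (\<integral>\<^sup>+z. ennreal (g \<bar>z\<bar>)
               \<partial>normal_law 0
                 ((\<alpha> - 1) powi (-2) * enn2real (dist_moment M Y m (\<alpha> - 2)) powi (-2)
                   * enn2real (dist_moment M Y m (2 * \<alpha> - 2)))))
     \<and>
     (\<forall>\<beta> b. \<alpha> < \<beta> \<and> \<beta> < 2 \<and> 0 < b \<and>
        ((\<lambda>t. measure M {\<omega> \<in> space M.
                 0 \<le> inv_into I \<gamma> (Y \<omega>) - inv_into I \<gamma> m \<and>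
                 inv_into I \<gamma> (Y \<omega>) - inv_into I \<gamma> m \<le> t}
               / (b * t powr (\<beta> - \<alpha>))) \<longlongrightarrow> 1) (at_right 0) \<and>
        ((\<lambda>t. measure M {\<omega> \<in> space M.
                 0 \<ge> inv_into I \<gamma> (Y \<omega>) - inv_into I \<gamma> m \<and>
                 inv_into I \<gamma> (Y \<omega>) - inv_into I \<gamma> m \<ge> - t}
               / (b * t powr (\<beta> - \<alpha>))) \<longlongrightarrow> 1) (at_right 0)
      \<longrightarrow>
        0 < frechet_rate_const \<alpha> \<beta> b \<and>
        liminf (\<lambda>n. \<integral>\<^sup>+\<omega>. ennreal (g (real n powr (1 / (2 * (\<beta> - 1))) * dist m (mn n \<omega>))) \<partial>M)
          \<ge> (\<integral>\<^sup>+w. ennreal (g (frechet_rate_const \<alpha> \<beta> b * \<bar>w\<bar> powr (1 / (\<beta> - 1))))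
               \<partial>normal_law 0 (enn2real (dist_moment M Y m (2 * \<alpha> - 2)))))"
proof -
  interpret prob_space M by fact
  note \<alpha> = assms(2,3) and Y [measurable] = assms(4)
  let ?a = "\<alpha> - 1"
  define v where "v = enn2real (dist_moment M Y m (2 * \<alpha> - 2))"
  obtain X :: "'w \<Rightarrow> real" and Xs T :: "nat \<Rightarrow> 'w \<Rightarrow> real" where
    X [measurable]: "X \<in> borel_measurable M" and X_dist: "AE \<omega> in M. dist (Y \<omega>) m = \<bar>X \<omega>\<bar>"
    and X_inv: "AE \<omega> in M. inv_into I \<gamma> (Y \<omega>) - inv_into I \<gamma> m = X \<omega>"
    and X_int: "integrable M (\<lambda>\<omega>. spow ?a (X \<omega>))" and X_mean: "(\<integral>\<omega>. spow ?a (X \<omega>) \<partial>M) = 0"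
    and X_sq: "integrable M (\<lambda>\<omega>. \<bar>X \<omega>\<bar> powr (2 * \<alpha> - 2))"
    and X_v: "(\<integral>\<omega>. \<bar>X \<omega>\<bar> powr (2 * \<alpha> - 2) \<partial>M) = v"
    and Xs_ind: "indep_vars (\<lambda>_. borel) Xs UNIV" and Xs_distr: "\<And>j. distr M borel (Xs j) = distr M borel X"
    and T [measurable]: "\<And>n. T n \<in> borel_measurable M"
    and T_root: "\<And>n. 1 \<le> n \<Longrightarrow> AE \<omega> in M. (\<Sum>j<n. spow ?a (T n \<omega> - Xs j \<omega>)) = 0"
    and T_dist: "\<And>n. 1 \<le> n \<Longrightarrow> AE \<omega> in M. dist m (mn n \<omega>) = \<bar>T n \<omega>\<bar>"
    unfolding v_def
  proof (rule frechet_mean_coordinates[of M \<alpha> Y p I \<gamma> m Ys mn], goal_cases)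
    case (14 X Xs T)
    show ?case by (rule that) (fact 14[folded v_def])+
  qed (rule assms; assumption)+
  have [measurable]: "(\<lambda>\<omega>. dist (Y \<omega>) m) \<in> borel_measurable M"
    by (rule measurable_compose[OF Y borel_measurable_continuous_onI]) (auto intro!: continuous_intros)
  have [measurable]: "Xs j \<in> borel_measurable M" for j
    using Xs_ind unfolding indep_vars_def2 by simp
  have transfer: "integrable M (\<lambda>\<omega>. \<phi> (Xs 0 \<omega>)) \<longleftrightarrow> integrable M (\<lambda>\<omega>. \<phi> (X \<omega>))"
      "expectation (\<lambda>\<omega>. \<phi> (Xs 0 \<omega>)) = expectation (\<lambda>\<omega>. \<phi> (X \<omega>))"
    if "\<phi> \<in> borel_measurable borel" for \<phi> :: "real \<Rightarrow> real"
    using integrable_distr_eq[of X M borel \<phi>] integrable_distr_eq[of "Xs 0" M borel \<phi>]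
      integral_distr[of X M borel \<phi>] integral_distr[of "Xs 0" M borel \<phi>] Xs_distr[of 0] that
    by simp_all
  have v_pos: "0 < v" if nz: "AE \<omega> in M. X \<omega> \<noteq> 0"
  proof -
    have "v \<noteq> 0"
    proof
      assume "v = 0"
      then have "AE \<omega> in M. \<bar>X \<omega>\<bar> powr (2 * \<alpha> - 2) = 0"
        using integral_nonneg_eq_0_iff_AE[OF X_sq] X_v by simp
      with nz have "AE \<omega> in M. False" by eventually_elim simp
      then show False by simp
    qed
    moreover have "0 \<le> v" by (simp add: v_def)
    ultimately show ?thesis by simp
  qed
  have limit: "(\<integral>\<^sup>+w. ennreal (g (c powr (- 1 / r) * \<bar>w\<bar> powr (1 / r))) \<partial>normal_law 0 v)
      \<le> liminf (\<lambda>n. \<integral>\<^sup>+\<omega>. ennreal (g (real n powr (1 / (2 * r)) * dist m (mn n \<omega>))) \<partial>M)"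
    if nz: "AE \<omega> in M. X \<omega> \<noteq> 0" and cr: "0 < c" "0 < r"
      and f: "((\<lambda>t. (\<integral>\<omega>. spow ?a (t - X \<omega>) \<partial>M) / spow r t) \<longlongrightarrow> c) (at 0)" for c r
  proof -
    have a: "0 < ?a" "?a \<le> 1" using \<alpha> by simp_all
    have e: "2 * ?a = 2 * \<alpha> - 2" by simp
    have "(\<integral>\<^sup>+w. ennreal (g (c powr (- 1 / r) * \<bar>w\<bar> powr (1 / r))) \<partial>normal_law 0 v)
      \<le> liminf (\<lambda>n. \<integral>\<^sup>+\<omega>. ennreal (g (real n powr (1 / (2 * r)) * \<bar>T n \<omega>\<bar>)) \<partial>M)"
    proof (rule liminf_score_root[OF prob_space_axioms a Xs_ind _ _ _ _ v_pos[OF nz] T T_root cr _ assms(15)])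
      show "distr M borel (Xs j) = distr M borel (Xs 0)" for j by (simp add: Xs_distr)
      show "integrable M (\<lambda>\<omega>. \<bar>Xs 0 \<omega>\<bar> powr (2 * ?a))"
        using transfer(1)[of "\<lambda>x. \<bar>x\<bar> powr (2 * ?a)"] X_sq unfolding e by simp
      show "(\<integral>\<omega>. spow ?a (Xs 0 \<omega>) \<partial>M) = 0"
        using transfer(2)[of "spow ?a"] X_mean by simp
      show "(\<integral>\<omega>. \<bar>Xs 0 \<omega>\<bar> powr (2 * ?a) \<partial>M) = v"
        using transfer(2)[of "\<lambda>x. \<bar>x\<bar> powr (2 * ?a)"] X_v unfolding e by simp
      have "(\<integral>\<omega>. spow ?a (t - Xs 0 \<omega>) \<partial>M) = (\<integral>\<omega>. spow ?a (t - X \<omega>) \<partial>M)" for t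
        by (rule transfer(2)) simp
      then show "((\<lambda>t. (\<integral>\<omega>. spow ?a (t - Xs 0 \<omega>) \<partial>M) / spow r t) \<longlongrightarrow> c) (at 0)"
        using f by simp
    qed
    also have "\<dots> = liminf (\<lambda>n. \<integral>\<^sup>+\<omega>. ennreal (g (real n powr (1 / (2 * r)) * dist m (mn n \<omega>))) \<partial>M)"
    proof (rule Liminf_eq)
      show "eventually (\<lambda>n. (\<integral>\<^sup>+\<omega>. ennreal (g (real n powr (1 / (2 * r)) * \<bar>T n \<omega>\<bar>)) \<partial>M)
          = (\<integral>\<^sup>+\<omega>. ennreal (g (real n powr (1 / (2 * r)) * dist m (mn n \<omega>))) \<partial>M)) sequentially"
        using eventually_ge_at_top[of 1]
      proof eventually_elim
        case (elim n)
        show ?case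
          using T_dist[OF elim] by (intro nn_integral_cong_AE, eventually_elim) simp
      qed
    qed
    finally show ?thesis .
  qed
  show ?thesis
    unfolding v_def[symmetric]
  proof (intro conjI impI allI; (elim exE conjE)?)
    fix \<beta> :: real
    assume \<beta>: "2 < \<beta>"
      and lim: "((\<lambda>t. t powr (\<alpha> - \<beta>) * prob {\<omega> \<in> space M. dist (Y \<omega>) m \<le> t}) \<longlongrightarrow> 0) (at_right 0)"
    have eq: "prob {\<omega> \<in> space M. dist (Y \<omega>) m \<le> t} = prob {\<omega> \<in> space M. \<bar>X \<omega>\<bar> \<le> t}" for t
      using X_dist by (intro measure_eq_AE) (auto elim!: eventually_mono)
    have "((\<lambda>t. t powr (- (\<beta> - \<alpha>)) * prob {\<omega> \<in> space M. \<bar>X \<omega>\<bar> \<le> t}) \<longlongrightarrow> 0) (at_right 0)"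
      using lim by (simp add: eq)
    from negative_moment_finite[OF prob_space_axioms X this, of "2 - \<alpha>"]
    have nz: "AE \<omega> in M. X \<omega> \<noteq> 0" and mom: "integrable M (\<lambda>\<omega>. \<bar>X \<omega>\<bar> powr (\<alpha> - 2))"
      using \<alpha> \<beta> by simp_all
    define E where "E = expectation (\<lambda>\<omega>. \<bar>X \<omega>\<bar> powr (\<alpha> - 2))"
    have "dist_moment M Y m (\<alpha> - 2) = (\<integral>\<^sup>+\<omega>. ennreal (\<bar>X \<omega>\<bar> powr (\<alpha> - 2)) \<partial>M)"
      unfolding dist_moment_def using X_dist nz
      by (intro nn_integral_cong_AE, eventually_elim) (simp add: epow_def)
    also have "\<dots> = ennreal E" using mom by (simp add: E_def nn_integral_eq_integral)
    finally have moment: "dist_moment M Y m (\<alpha> - 2) = ennreal E" .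
    then show "dist_moment M Y m (\<alpha> - 2) < \<infinity>" by simp
    have "0 \<le> E" by (simp add: E_def)
    moreover have "E \<noteq> 0"
    proof
      assume "E = 0"
      then have "AE \<omega> in M. \<bar>X \<omega>\<bar> powr (\<alpha> - 2) = 0"
        using integral_nonneg_eq_0_iff_AE[OF mom] by (simp add: E_def)
      with nz have "AE \<omega> in M. False" by eventually_elim simp
      then show False by simp
    qed
    ultimately have E: "0 < E" by simp
    define c where "c = ?a * E"
    have c: "0 < c" using E \<alpha> by (simp add: c_def)
    have "((\<lambda>t. (\<integral>\<omega>. spow ?a (t - X \<omega>) \<partial>M) / spow 1 t) \<longlongrightarrow> c) (at 0)"
      using score_derivative[OF prob_space_axioms _ _ X X_int X_mean nz] mom \<alpha> by (simp add: c_def E_def)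
    from limit[OF nz c _ this]
    have "(\<integral>\<^sup>+w. ennreal (g (c powr (- 1) * \<bar>w\<bar>)) \<partial>normal_law 0 v)
        \<le> liminf (\<lambda>n. \<integral>\<^sup>+\<omega>. ennreal (g (real n powr (1 / 2) * dist m (mn n \<omega>))) \<partial>M)"
      by (simp add: powr_one_gt_zero_iff)
    \<comment> \<open>The limit is \<open>W / c\<close>, a normal variable again.\<close>
    also have "(\<integral>\<^sup>+w. ennreal (g (c powr (- 1) * \<bar>w\<bar>)) \<partial>normal_law 0 v)
        = (\<integral>\<^sup>+z. ennreal (g \<bar>z\<bar>) \<partial>distr (normal_law 0 v) borel (\<lambda>w. (1 / c) * w))"
      using lower_semicontinuous_abs_measurable[OF assms(15)] c
      by (subst nn_integral_distr) (auto simp: normal_law_def abs_mult powr_minus_divide)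
    also have "distr (normal_law 0 v) borel (\<lambda>w. (1 / c) * w) = normal_law 0 ((1 / c)\<^sup>2 * v)"
      using c by (intro normal_law_scale v_pos nz) simp
    also have "(1 / c)\<^sup>2 * v = ?a powi (- 2) * enn2real (dist_moment M Y m (\<alpha> - 2)) powi (- 2) * v"
      using E by (simp add: moment c_def power_int_minus divide_inverse power_mult_distrib power_inverse)
    finally show "(\<integral>\<^sup>+z. ennreal (g \<bar>z\<bar>) \<partial>normal_law 0 (?a powi (- 2) * enn2real (dist_moment M Y m (\<alpha> - 2)) powi (- 2) * v))
        \<le> liminf (\<lambda>n. \<integral>\<^sup>+\<omega>. ennreal (g (sqrt (real n) * dist m (mn n \<omega>))) \<partial>M)"
      by (simp add: powr_half_sqrt)
  next
    fix \<beta> b :: real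
    assume \<beta>: "\<alpha> < \<beta>" "\<beta> < 2" and b: "0 < b"
      and F1: "((\<lambda>t. prob {\<omega> \<in> space M. 0 \<le> inv_into I \<gamma> (Y \<omega>) - inv_into I \<gamma> m \<and>
            inv_into I \<gamma> (Y \<omega>) - inv_into I \<gamma> m \<le> t} / (b * t powr (\<beta> - \<alpha>))) \<longlongrightarrow> 1) (at_right 0)"
      and F2: "((\<lambda>t. prob {\<omega> \<in> space M. 0 \<ge> inv_into I \<gamma> (Y \<omega>) - inv_into I \<gamma> m \<and>
            inv_into I \<gamma> (Y \<omega>) - inv_into I \<gamma> m \<ge> - t} / (b * t powr (\<beta> - \<alpha>))) \<longlongrightarrow> 1) (at_right 0)"
    have transfer_prob: "((\<lambda>t. prob {\<omega> \<in> space M. P t (X \<omega>)} / w t) \<longlongrightarrow> 1) (at_right 0)"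
      if lim: "((\<lambda>t. prob {\<omega> \<in> space M. P t (inv_into I \<gamma> (Y \<omega>) - inv_into I \<gamma> m)} / w t) \<longlongrightarrow> 1) (at_right 0)"
        and [measurable]: "\<And>t. {\<omega> \<in> space M. P t (X \<omega>)} \<in> events" for P and w :: "real \<Rightarrow> real"
    proof (rule Lim_transform_eventually[OF lim])
      let ?S = "\<lambda>t. {\<omega> \<in> space M. P t (inv_into I \<gamma> (Y \<omega>) - inv_into I \<gamma> m)}"
      have "eventually (\<lambda>t. 0 < prob (?S t) / w t) (at_right 0)"
        using lim by (rule order_tendstoD) simp
      then show "eventually (\<lambda>t. prob (?S t) / w t = prob {\<omega> \<in> space M. P t (X \<omega>)} / w t) (at_right 0)"
      proof eventually_elim
        case (elim t)
        \<comment> \<open>Off the geodesic the inverse is unspecified, but only measurable sets have nonzero measure.\<close>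
        then have "?S t \<in> events" using measure_notin_sets[of "?S t" M] by fastforce
        then have "prob (?S t) = prob {\<omega> \<in> space M. P t (X \<omega>)}"
          using X_inv by (intro measure_eq_AE) (auto elim!: eventually_mono)
        then show ?case by simp
      qed
    qed
    have G1: "((\<lambda>s. prob {\<omega> \<in> space M. 0 \<le> X \<omega> \<and> X \<omega> \<le> s} / (b * s powr (\<beta> - \<alpha>))) \<longlongrightarrow> 1) (at_right 0)"
      by (rule transfer_prob[of "\<lambda>s x. 0 \<le> x \<and> x \<le> s", OF F1]) simp
    have "((\<lambda>s. prob {\<omega> \<in> space M. 0 \<ge> X \<omega> \<and> X \<omega> \<ge> - s} / (b * s powr (\<beta> - \<alpha>))) \<longlongrightarrow> 1) (at_right 0)"
      by (rule transfer_prob[of "\<lambda>s x. 0 \<ge> x \<and> x \<ge> - s", OF F2]) simp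
    moreover have "0 \<ge> x \<and> x \<ge> - s \<longleftrightarrow> 0 \<le> - x \<and> - x \<le> s" for x s :: real by linarith
    ultimately have G2: "((\<lambda>s. prob {\<omega> \<in> space M. 0 \<le> - X \<omega> \<and> - X \<omega> \<le> s} / (b * s powr (\<beta> - \<alpha>))) \<longlongrightarrow> 1) (at_right 0)"
      by simp
    define c where "c = b * (\<beta> - \<alpha>) * (\<integral>x. score_kernel ?a x * \<bar>x\<bar> powr (\<beta> - \<alpha> - 1) \<partial>lborel)"
    have a: "0 < ?a" "0 < \<beta> - \<alpha>" "\<beta> - \<alpha> < 1 - ?a" "0 < \<beta> - 1" using \<alpha> \<beta> by simp_all
    note score = score_power_law[OF prob_space_axioms a(1) X b a(2,3) G1 G2 X_int X_mean]
    have c: "0 < c" using score(1) b a(2) by (simp add: c_def)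
    have rate: "frechet_rate_const \<alpha> \<beta> b = c powr (- 1 / (\<beta> - 1))"
      by (simp add: frechet_rate_const_def c_def score_kernel_def spow_def)
    show "0 < frechet_rate_const \<alpha> \<beta> b" using c by (simp add: rate)
    have "?a + (\<beta> - \<alpha>) = \<beta> - 1" by simp
    then have f: "((\<lambda>t. (\<integral>\<omega>. spow ?a (t - X \<omega>) \<partial>M) / spow (\<beta> - 1) t) \<longlongrightarrow> c) (at 0)"
      using score(2) unfolding c_def by metis
    show "(\<integral>\<^sup>+w. ennreal (g (frechet_rate_const \<alpha> \<beta> b * \<bar>w\<bar> powr (1 / (\<beta> - 1)))) \<partial>normal_law 0 v)
        \<le> liminf (\<lambda>n. \<integral>\<^sup>+\<omega>. ennreal (g (real n powr (1 / (2 * (\<beta> - 1))) * dist m (mn n \<omega>))) \<partial>M)"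
      unfolding rate using power_law_null(2)[OF prob_space_axioms X b a(2) G1] c a(4) f by (rule limit)
  qed
qed

end
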